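(* The identity on objects (i.e. on underlying reflexive graphs of $\mathcal P$-algebras) and on morphisms defines a functor which is an isomorphism of categories $$\mathrm{Cat}^1(\mathcal P\text{-}alg)\simeq\mathrm{Cat}(\mathcal P\text{-}alg),$$ where $\mathrm{Cat}(\mathcal P\text{-}alg)$ is the category of internal categories in $\mathcal P$-algebras. In particular, a reflexive graph $s,t:E\to B$, $i:B\to E$ of $\mathcal P$-algebras admits a composition $E\times_{s,t}E\to E$ turning it into an internal category in $\mathcal P$-algebras if and only if for all $n\ge2$ the composite $\mathcal P_n\otimes(\ker(s)\otimes\ker(t)\otimes E^{\otimes n-2})\to\mathcal P_n\otimes_{\Sigma_n}E^{\otimes n}\xrightarrow{\mu^E}E$ is zero.
   Context: Standing assumptions: $(\mathcal A,\otimes,k)$ is a bicomplete abelian category with a closed symmetric monoidal structure with unit $k$. $\mathcal P$ is a symmetric operad in $\mathcal A$ that is reduced: $\mathcal P_0=0$ and $\mathcal P_1=k$. Its Schur functor is $\mathcal P(x)=\bigoplus_n\mathcal P_n\otimes_{\Sigma_n}x^{\otimes n}$; a $\mathcal P$-algebra $E$ has structure map $\mu^E:\mathcal P(E)\to E$. A reflexive graph of $\mathcal P$-algebras is a diagram of $\mathcal P$-algebra morphisms $s,t:E\to B$ (source and target), $i:B\to E$ (identities) with $si=ti=\mathrm{Id}_B$; morphisms are morphisms of diagrams. It is a $\mathrm{Cat}^1$-$\mathcal P$-algebra if for all $n\ge2$ the composite $\mathcal P_n\otimes(\ker(s)\otimes\ker(t)\otimes E^{\otimes n-2})\to\mathcal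 P(E)\xrightarrow{\mu^E}E$ is zero. $\mathrm{Cat}^1(\mathcal P\text{-}alg)$ is the full subcategory of reflexive graphs of $\mathcal P$-algebras on the $\mathrm{Cat}^1$-$\mathcal P$-algebras. An internal category in $\mathcal P$-algebras is a reflexive graph of $\mathcal P$-algebras with a composition $\circ:E\times_{s,t}E\to E$ that is a $\mathcal P$-algebra morphism, defined on pairs $(g,f)$ with $s(g)=t(f)$, satisfying the usual source/target, unit and associativity axioms; morphisms are internal functors. Since a reflexive graph in an abelian category carries a unique internal category structure, and the forgetful functor $\mathcal P\text{-}alg\to\mathcal A$ is a faithful right adjoint, a reflexive graph of $\mathcal P$-algebras carries at most one internal category structure. *)

theory Defs
  imports "HOL-Algebra.Group" "HOL-Combinatorics.Permutations"
begin

section \<open>Categories\<close>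

text \<open>
  Composition is a total HOL function, meaningful only on composable pairs;
  \<open>g \<cdot> f\<close> is "g after f".
\<close>

record ('o, 'm) category =
  Obj :: "'o set"
  Arr :: "'m set"
  Dom :: "'m \<Rightarrow> 'o"
  Cod :: "'m \<Rightarrow> 'o"
  Idn :: "'o \<Rightarrow> 'm"
  Cmp :: "'m \<Rightarrow> 'm \<Rightarrow> 'm"  (infixl "\<cdot>\<index>" 70)

definition Hom :: "('o, 'm, 'z) category_scheme \<Rightarrow> 'o \<Rightarrow> 'o \<Rightarrow> 'm set" where
  "Hom C a b = {f \<in> Arr C. Dom C f = a \<and> Cod C f = b}"

locale category =
  fixes C :: "('o, 'm, 'z) category_scheme" (structure)
  assumes Dom_in: "f \<in> Arr C \<Longrightarrow> Dom C f \<in> Obj C"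
    and Cod_in: "f \<in> Arr C \<Longrightarrow> Cod C f \<in> Obj C"
    and Idn_in: "a \<in> Obj C \<Longrightarrow> Idn C a \<in> Hom C a a"
    and Cmp_in: "f \<in> Hom C a b \<Longrightarrow> g \<in> Hom C b c \<Longrightarrow> g \<cdot> f \<in> Hom C a c"
    and Cmp_Idn: "f \<in> Hom C a b \<Longrightarrow> f \<cdot> Idn C a = f"
    and Idn_Cmp: "f \<in> Hom C a b \<Longrightarrow> Idn C b \<cdot> f = f"
    and Cmp_assoc: "f \<in> Hom C a b \<Longrightarrow> g \<in> Hom C b c \<Longrightarrow> h \<in> Hom C c d \<Longrightarrow>
          h \<cdot> (g \<cdot> f) = (h \<cdot> g) \<cdot> f"

definition full_subcategory ::
  "('o, 'm) category \<Rightarrow> ('o \<Rightarrow> bool) \<Rightarrow> ('o, 'm) category" where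
  "full_subcategory C S = C
    \<lparr>Obj := {a \<in> Obj C. S a},
     Arr := {f \<in> Arr C. S (Dom C f) \<and> S (Cod C f)}\<rparr>"

locale is_functor =
  source: category C + target: category D
  for C :: "('o, 'm, 'z) category_scheme" and D :: "('p, 'n, 'y) category_scheme" +
  fixes Fo :: "'o \<Rightarrow> 'p" and Fa :: "'m \<Rightarrow> 'n"
  assumes F_Obj: "a \<in> Obj C \<Longrightarrow> Fo a \<in> Obj D"
    and F_Arr: "f \<in> Hom C a b \<Longrightarrow> Fa f \<in> Hom D (Fo a) (Fo b)"
    and F_Idn: "a \<in> Obj C \<Longrightarrow> Fa (Idn C a) = Idn D (Fo a)"
    and F_Cmp: "f \<in> Hom C a b \<Longrightarrow> g \<in> Hom C b c \<Longrightarrow>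
          Fa (g \<cdot>\<^bsub>C\<^esub> f) = Fa g \<cdot>\<^bsub>D\<^esub> Fa f"

definition category_iso ::
  "('o, 'm, 'z) category_scheme \<Rightarrow> ('p, 'n, 'y) category_scheme \<Rightarrow>
    ('o \<Rightarrow> 'p) \<Rightarrow> ('m \<Rightarrow> 'n) \<Rightarrow> bool" where
  "category_iso C D Fo Fa \<longleftrightarrow>
     is_functor C D Fo Fa \<and>
     (\<exists>Go Ga. is_functor D C Go Ga \<and>
        (\<forall>a \<in> Obj C. Go (Fo a) = a) \<and> (\<forall>f \<in> Arr C. Ga (Fa f) = f) \<and>
        (\<forall>b \<in> Obj D. Fo (Go b) = b) \<and> (\<forall>g \<in> Arr D. Fa (Ga g) = g))"

context
  fixes C :: "('o, 'm, 'z) category_scheme" (structure)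
begin

definition is_iso :: "'m \<Rightarrow> bool" where
  "is_iso f \<longleftrightarrow> f \<in> Arr C \<and>
     (\<exists>g \<in> Hom C (Cod C f) (Dom C f). g \<cdot> f = Idn C (Dom C f) \<and> f \<cdot> g = Idn C (Cod C f))"

definition inverse_arr :: "'m \<Rightarrow> 'm" where
  "inverse_arr f = (THE g. g \<in> Hom C (Cod C f) (Dom C f) \<and>
     g \<cdot> f = Idn C (Dom C f) \<and> f \<cdot> g = Idn C (Cod C f))"

definition is_mono :: "'m \<Rightarrow> bool" where
  "is_mono f \<longleftrightarrow> f \<in> Arr C \<and>
     (\<forall>a. \<forall>u \<in> Hom C a (Dom C f). \<forall>v \<in> Hom C a (Dom C f). f \<cdot> u = f \<cdot> v \<longrightarrow> u = v)"

definition is_epi :: "'m \<Rightarrow> bool" where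
  "is_epi f \<longleftrightarrow> f \<in> Arr C \<and>
     (\<forall>a. \<forall>u \<in> Hom C (Cod C f) a. \<forall>v \<in> Hom C (Cod C f) a. u \<cdot> f = v \<cdot> f \<longrightarrow> u = v)"

definition zero_object :: "'o \<Rightarrow> bool" where
  "zero_object z \<longleftrightarrow> z \<in> Obj C \<and>
     (\<forall>a \<in> Obj C. (\<exists>!f. f \<in> Hom C a z) \<and> (\<exists>!f. f \<in> Hom C z a))"

text \<open>The arrows \<open>\<iota> n : a n \<rightarrow> x\<close> exhibit \<open>x\<close> as the coproduct of the sequence \<open>a\<close>.\<close>

definition is_coproduct :: "(nat \<Rightarrow> 'o) \<Rightarrow> 'o \<Rightarrow> (nat \<Rightarrow> 'm) \<Rightarrow> bool" where
  "is_coproduct a x \<iota> \<longleftrightarrow> x \<in> Obj C \<and> (\<forall>n. \<iota> n \<in> Hom C (a n) x) \<and>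
     (\<forall>y \<in> Obj C. \<forall>f. (\<forall>n. f n \<in> Hom C (a n) y) \<longrightarrow>
        (\<exists>!h. h \<in> Hom C x y \<and> (\<forall>n. h \<cdot> \<iota> n = f n)))"

text \<open>The projections \<open>p\<close>, \<open>q\<close> form a pullback of the cospan \<open>f\<close>, \<open>g\<close>: \<open>f p = g q\<close>.\<close>

definition is_pullback :: "'m \<Rightarrow> 'm \<Rightarrow> 'm \<Rightarrow> 'm \<Rightarrow> bool" where
  "is_pullback f g p q \<longleftrightarrow>
     f \<in> Arr C \<and> g \<in> Arr C \<and> Cod C f = Cod C g \<and>
     p \<in> Arr C \<and> q \<in> Hom C (Dom C p) (Dom C g) \<and> Cod C p = Dom C f \<and> f \<cdot> p = g \<cdot> q \<and>
     (\<forall>a. \<forall>u \<in> Hom C a (Dom C f). \<forall>v \<in> Hom C a (Dom C g). f \<cdot> u = g \<cdot> v \<longrightarrow>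
        (\<exists>!h. h \<in> Hom C a (Dom C p) \<and> p \<cdot> h = u \<and> q \<cdot> h = v))"

definition pullback :: "'m \<Rightarrow> 'm \<Rightarrow> 'm \<times> 'm" where
  "pullback f g = (SOME pq. is_pullback f g (fst pq) (snd pq))"

definition pb_pair :: "'m \<times> 'm \<Rightarrow> 'm \<Rightarrow> 'm \<Rightarrow> 'm" where
  "pb_pair pq u v = (THE h. h \<in> Hom C (Dom C u) (Dom C (fst pq)) \<and>
     fst pq \<cdot> h = u \<and> snd pq \<cdot> h = v)"

end

subsection \<open>Limits and colimits\<close>

definition is_cone ::
  "('i, 'j, 'x) category_scheme \<Rightarrow> ('o, 'm, 'z) category_scheme \<Rightarrow>
    ('i \<Rightarrow> 'o) \<Rightarrow> ('j \<Rightarrow> 'm) \<Rightarrow> 'o \<Rightarrow> ('i \<Rightarrow> 'm) \<Rightarrow> bool" where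
  "is_cone J C Do Da x c \<longleftrightarrow> x \<in> Obj C \<and> (\<forall>j \<in> Obj J. c j \<in> Hom C x (Do j)) \<and>
     (\<forall>f \<in> Arr J. Da f \<cdot>\<^bsub>C\<^esub> c (Dom J f) = c (Cod J f))"

definition is_cocone ::
  "('i, 'j, 'x) category_scheme \<Rightarrow> ('o, 'm, 'z) category_scheme \<Rightarrow>
    ('i \<Rightarrow> 'o) \<Rightarrow> ('j \<Rightarrow> 'm) \<Rightarrow> 'o \<Rightarrow> ('i \<Rightarrow> 'm) \<Rightarrow> bool" where
  "is_cocone J C Do Da x c \<longleftrightarrow> x \<in> Obj C \<and> (\<forall>j \<in> Obj J. c j \<in> Hom C (Do j) x) \<and>
     (\<forall>f \<in> Arr J. c (Cod J f) \<cdot>\<^bsub>C\<^esub> Da f = c (Dom J f))"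

definition is_limit ::
  "('i, 'j, 'x) category_scheme \<Rightarrow> ('o, 'm, 'z) category_scheme \<Rightarrow>
    ('i \<Rightarrow> 'o) \<Rightarrow> ('j \<Rightarrow> 'm) \<Rightarrow> 'o \<Rightarrow> ('i \<Rightarrow> 'm) \<Rightarrow> bool" where
  "is_limit J C Do Da x c \<longleftrightarrow> is_cone J C Do Da x c \<and>
     (\<forall>y d. is_cone J C Do Da y d \<longrightarrow>
        (\<exists>!h. h \<in> Hom C y x \<and> (\<forall>j \<in> Obj J. c j \<cdot>\<^bsub>C\<^esub> h = d j)))"

definition is_colimit ::
  "('i, 'j, 'x) category_scheme \<Rightarrow> ('o, 'm, 'z) category_scheme \<Rightarrow>
    ('i \<Rightarrow> 'o) \<Rightarrow> ('j \<Rightarrow> 'm) \<Rightarrow> 'o \<Rightarrow> ('i \<Rightarrow> 'm) \<Rightarrow> bool" where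
  "is_colimit J C Do Da x c \<longleftrightarrow> is_cocone J C Do Da x c \<and>
     (\<forall>y d. is_cocone J C Do Da y d \<longrightarrow>
        (\<exists>!h. h \<in> Hom C x y \<and> (\<forall>j \<in> Obj J. h \<cdot>\<^bsub>C\<^esub> c j = d j)))"

text \<open>
  HOL has no universe of small sets. Smallness is measured by a type \<open>'i\<close>: a diagram is
  small if its index category has its objects and its arrows in \<open>'i\<close>. Statements about
  bicomplete categories are made for an arbitrary infinite type \<open>'i\<close>.
\<close>

definition bicomplete :: "'i itself \<Rightarrow> ('o, 'm, 'z) category_scheme \<Rightarrow> bool" where
  "bicomplete _ C \<longleftrightarrow>
     (\<forall>(J :: ('i, 'i) category) Do Da. is_functor J C Do Da \<longrightarrow>
        (\<exists>x c. is_limit J C Do Da x c) \<and> (\<exists>x c. is_colimit J C Do Da x c))"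

section \<open>Abelian categories\<close>

record ('o, 'm) preadditive = "('o, 'm) category" +
  Add :: "'m \<Rightarrow> 'm \<Rightarrow> 'm"  (infixl "\<boxplus>\<index>" 65)
  Zero :: "'o \<Rightarrow> 'o \<Rightarrow> 'm"

locale preadditive_category = category A
  for A :: "('o, 'm, 'z) preadditive_scheme" (structure) +
  assumes Hom_group: "a \<in> Obj A \<Longrightarrow> b \<in> Obj A \<Longrightarrow>
        comm_group \<lparr>carrier = Hom A a b, monoid.mult = Add A, one = Zero A a b\<rparr>"
    and Cmp_Add: "f \<in> Hom A a b \<Longrightarrow> g \<in> Hom A a b \<Longrightarrow> h \<in> Hom A b c \<Longrightarrow>
        h \<cdot> (f \<boxplus> g) = h \<cdot> f \<boxplus> h \<cdot> g"
    and Add_Cmp: "f \<in> Hom A a b \<Longrightarrow> g \<in> Hom A b c \<Longrightarrow> h \<in> Hom A b c \<Longrightarrow>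
        (g \<boxplus> h) \<cdot> f = g \<cdot> f \<boxplus> h \<cdot> f"

context
  fixes A :: "('o, 'm, 'z) preadditive_scheme" (structure)
begin

definition is_kernel :: "'m \<Rightarrow> 'm \<Rightarrow> bool" where
  "is_kernel f k \<longleftrightarrow> f \<in> Arr A \<and> k \<in> Arr A \<and> Cod A k = Dom A f \<and>
     f \<cdot> k = Zero A (Dom A k) (Cod A f) \<and>
     (\<forall>a. \<forall>u \<in> Hom A a (Dom A f). f \<cdot> u = Zero A a (Cod A f) \<longrightarrow>
        (\<exists>!v. v \<in> Hom A a (Dom A k) \<and> k \<cdot> v = u))"

definition is_cokernel :: "'m \<Rightarrow> 'm \<Rightarrow> bool" where
  "is_cokernel f k \<longleftrightarrow> f \<in> Arr A \<and> k \<in> Arr A \<and> Dom A k = Cod A f \<and>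
     k \<cdot> f = Zero A (Dom A f) (Cod A k) \<and>
     (\<forall>a. \<forall>u \<in> Hom A (Cod A f) a. u \<cdot> f = Zero A (Dom A f) a \<longrightarrow>
        (\<exists>!v. v \<in> Hom A (Cod A k) a \<and> v \<cdot> k = u))"

definition kernel_arr :: "'m \<Rightarrow> 'm" where
  "kernel_arr f = (SOME k. is_kernel f k)"

definition is_biproduct :: "'o \<Rightarrow> 'o \<Rightarrow> 'o \<Rightarrow> 'm \<Rightarrow> 'm \<Rightarrow> 'm \<Rightarrow> 'm \<Rightarrow> bool" where
  "is_biproduct a b x i1 i2 p1 p2 \<longleftrightarrow> x \<in> Obj A \<and>
     i1 \<in> Hom A a x \<and> i2 \<in> Hom A b x \<and> p1 \<in> Hom A x a \<and> p2 \<in> Hom A x b \<and>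
     p1 \<cdot> i1 = Idn A a \<and> p2 \<cdot> i2 = Idn A b \<and>
     i1 \<cdot> p1 \<boxplus> i2 \<cdot> p2 = Idn A x"

end

locale abelian_category = preadditive_category A
  for A :: "('o, 'm, 'z) preadditive_scheme" (structure) +
  assumes zero_object_exists: "\<exists>z. zero_object A z"
    and biproduct_exists: "a \<in> Obj A \<Longrightarrow> b \<in> Obj A \<Longrightarrow>
        \<exists>x i1 i2 p1 p2. is_biproduct A a b x i1 i2 p1 p2"
    and kernel_exists: "f \<in> Arr A \<Longrightarrow> \<exists>k. is_kernel A f k"
    and cokernel_exists: "f \<in> Arr A \<Longrightarrow> \<exists>k. is_cokernel A f k"
    and mono_is_kernel: "is_mono A f \<Longrightarrow> \<exists>g. is_kernel A g f"
    and epi_is_cokernel: "is_epi A f \<Longrightarrow> \<exists>g. is_cokernel A g f"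

section \<open>Closed symmetric monoidal structures\<close>

record ('o, 'm) monoidal = "('o, 'm) preadditive" +
  TensO :: "'o \<Rightarrow> 'o \<Rightarrow> 'o"  (infixr "\<odot>\<index>" 75)
  TensA :: "'m \<Rightarrow> 'm \<Rightarrow> 'm"  (infixr "\<boxtimes>\<index>" 75)
  Unit :: "'o"
  Assoc :: "'o \<Rightarrow> 'o \<Rightarrow> 'o \<Rightarrow> 'm"  \<comment> \<open>\<open>(a \<odot> b) \<odot> c \<rightarrow> a \<odot> (b \<odot> c)\<close>\<close>
  LUnit :: "'o \<Rightarrow> 'm"
  RUnit :: "'o \<Rightarrow> 'm"
  Braid :: "'o \<Rightarrow> 'o \<Rightarrow> 'm"

locale monoidal_category = category A
  for A :: "('o, 'm, 'z) monoidal_scheme" (structure) +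
  assumes TensO_in: "a \<in> Obj A \<Longrightarrow> b \<in> Obj A \<Longrightarrow> a \<odot> b \<in> Obj A"
    and TensA_in: "f \<in> Hom A a b \<Longrightarrow> g \<in> Hom A c d \<Longrightarrow> f \<boxtimes> g \<in> Hom A (a \<odot> c) (b \<odot> d)"
    and TensA_Idn: "a \<in> Obj A \<Longrightarrow> b \<in> Obj A \<Longrightarrow> Idn A a \<boxtimes> Idn A b = Idn A (a \<odot> b)"
    and TensA_Cmp: "f \<in> Hom A a b \<Longrightarrow> g \<in> Hom A b c \<Longrightarrow> f' \<in> Hom A a' b' \<Longrightarrow> g' \<in> Hom A b' c' \<Longrightarrow>
        (g \<cdot> f) \<boxtimes> (g' \<cdot> f') = (g \<boxtimes> g') \<cdot> (f \<boxtimes> f')"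
    and Unit_in: "Unit A \<in> Obj A"
    and Assoc_in: "a \<in> Obj A \<Longrightarrow> b \<in> Obj A \<Longrightarrow> c \<in> Obj A \<Longrightarrow>
        Assoc A a b c \<in> Hom A ((a \<odot> b) \<odot> c) (a \<odot> b \<odot> c)"
    and Assoc_iso: "a \<in> Obj A \<Longrightarrow> b \<in> Obj A \<Longrightarrow> c \<in> Obj A \<Longrightarrow> is_iso A (Assoc A a b c)"
    and Assoc_natural: "f \<in> Hom A a a' \<Longrightarrow> g \<in> Hom A b b' \<Longrightarrow> h \<in> Hom A c c' \<Longrightarrow>
        Assoc A a' b' c' \<cdot> ((f \<boxtimes> g) \<boxtimes> h) = (f \<boxtimes> g \<boxtimes> h) \<cdot> Assoc A a b c"
    and LUnit_in: "a \<in> Obj A \<Longrightarrow> LUnit A a \<in> Hom A (Unit A \<odot> a) a"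
    and LUnit_iso: "a \<in> Obj A \<Longrightarrow> is_iso A (LUnit A a)"
    and LUnit_natural: "f \<in> Hom A a b \<Longrightarrow>
        LUnit A b \<cdot> (Idn A (Unit A) \<boxtimes> f) = f \<cdot> LUnit A a"
    and RUnit_in: "a \<in> Obj A \<Longrightarrow> RUnit A a \<in> Hom A (a \<odot> Unit A) a"
    and RUnit_iso: "a \<in> Obj A \<Longrightarrow> is_iso A (RUnit A a)"
    and RUnit_natural: "f \<in> Hom A a b \<Longrightarrow>
        RUnit A b \<cdot> (f \<boxtimes> Idn A (Unit A)) = f \<cdot> RUnit A a"
    and pentagon: "a \<in> Obj A \<Longrightarrow> b \<in> Obj A \<Longrightarrow> c \<in> Obj A \<Longrightarrow> d \<in> Obj A \<Longrightarrow>
        (Idn A a \<boxtimes> Assoc A b c d) \<cdot> Assoc A a (b \<odot> c) d \<cdot> (Assoc A a b c \<boxtimes> Idn A d)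
        = Assoc A a b (c \<odot> d) \<cdot> Assoc A (a \<odot> b) c d"
    and triangle: "a \<in> Obj A \<Longrightarrow> b \<in> Obj A \<Longrightarrow>
        (Idn A a \<boxtimes> LUnit A b) \<cdot> Assoc A a (Unit A) b = RUnit A a \<boxtimes> Idn A b"

locale symmetric_monoidal_category = monoidal_category A
  for A :: "('o, 'm, 'z) monoidal_scheme" (structure) +
  assumes Braid_in: "a \<in> Obj A \<Longrightarrow> b \<in> Obj A \<Longrightarrow> Braid A a b \<in> Hom A (a \<odot> b) (b \<odot> a)"
    and Braid_natural: "f \<in> Hom A a a' \<Longrightarrow> g \<in> Hom A b b' \<Longrightarrow>
        Braid A a' b' \<cdot> (f \<boxtimes> g) = (g \<boxtimes> f) \<cdot> Braid A a b"
    and Braid_symmetric: "a \<in> Obj A \<Longrightarrow> b \<in> Obj A \<Longrightarrow>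
        Braid A b a \<cdot> Braid A a b = Idn A (a \<odot> b)"
    and hexagon: "a \<in> Obj A \<Longrightarrow> b \<in> Obj A \<Longrightarrow> c \<in> Obj A \<Longrightarrow>
        Assoc A b c a \<cdot> Braid A a (b \<odot> c) \<cdot> Assoc A a b c
        = (Idn A b \<boxtimes> Braid A a c) \<cdot> Assoc A b a c \<cdot> (Braid A a b \<boxtimes> Idn A c)"

text \<open>
  Closedness: every \<open>- \<odot> x\<close> has a right adjoint, given by universal evaluation arrows.
\<close>

locale closed_symmetric_monoidal_category = symmetric_monoidal_category A
  for A :: "('o, 'm, 'z) monoidal_scheme" (structure) +
  assumes internal_hom: "x \<in> Obj A \<Longrightarrow> y \<in> Obj A \<Longrightarrow>
        \<exists>h \<in> Obj A. \<exists>ev \<in> Hom A (h \<odot> x) y. \<forall>z \<in> Obj A. \<forall>f \<in> Hom A (z \<odot> x) y.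
          \<exists>!g. g \<in> Hom A z h \<and> ev \<cdot> (g \<boxtimes> Idn A x) = f"

section \<open>Iterated tensor products and the symmetry maps\<close>

definition remove_nth :: "nat \<Rightarrow> 'a list \<Rightarrow> 'a list" where
  "remove_nth j xs = take j xs @ drop (Suc j) xs"

context
  fixes A :: "('o, 'm, 'z) monoidal_scheme" (structure)
begin

text \<open>\<open>tensor [x\<^sub>1, \<dots>, x\<^sub>n] = x\<^sub>1 \<odot> (x\<^sub>2 \<odot> \<dots> (x\<^sub>n \<odot> Unit))\<close>.\<close>

fun tensor :: "'o list \<Rightarrow> 'o" where
  "tensor [] = Unit A"
| "tensor (x # xs) = x \<odot> tensor xs"

fun tensor_arr :: "'m list \<Rightarrow> 'm" where
  "tensor_arr [] = Idn A (Unit A)"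
| "tensor_arr (f # fs) = f \<boxtimes> tensor_arr fs"

text \<open>The canonical isomorphism \<open>tensor xs \<odot> tensor ys \<rightarrow> tensor (xs @ ys)\<close>.\<close>

fun tensor_append :: "'o list \<Rightarrow> 'o list \<Rightarrow> 'm" where
  "tensor_append [] ys = LUnit A (tensor ys)"
| "tensor_append (x # xs) ys =
     (Idn A x \<boxtimes> tensor_append xs ys) \<cdot> Assoc A x (tensor xs) (tensor ys)"

text \<open>The canonical isomorphism \<open>x \<odot> (y \<odot> z) \<rightarrow> y \<odot> (x \<odot> z)\<close>.\<close>

definition swap_front :: "'o \<Rightarrow> 'o \<Rightarrow> 'o \<Rightarrow> 'm" where
  "swap_front x y z =
     Assoc A y x z \<cdot> (Braid A x y \<boxtimes> Idn A z) \<cdot> inverse_arr A (Assoc A x y z)"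

text \<open>The canonical isomorphism \<open>(a \<odot> x) \<odot> (b \<odot> y) \<rightarrow> (a \<odot> b) \<odot> (x \<odot> y)\<close>.\<close>

definition interchange :: "'o \<Rightarrow> 'o \<Rightarrow> 'o \<Rightarrow> 'o \<Rightarrow> 'm" where
  "interchange a x b y =
     inverse_arr A (Assoc A a b (x \<odot> y)) \<cdot> (Idn A a \<boxtimes> swap_front x b y)
       \<cdot> Assoc A a x (b \<odot> y)"

text \<open>
  For \<open>zs = [(a\<^sub>1, xs\<^sub>1), \<dots>, (a\<^sub>n, xs\<^sub>n)]\<close>, the canonical isomorphism from the tensor product
  of the \<open>a\<^sub>i \<odot> tensor xs\<^sub>i\<close> to \<open>tensor [a\<^sub>1, \<dots>, a\<^sub>n] \<odot> tensor (xs\<^sub>1 @ \<dots> @ xs\<^sub>n)\<close>.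
\<close>

fun unshuffle :: "('o \<times> 'o list) list \<Rightarrow> 'm" where
  "unshuffle [] = inverse_arr A (LUnit A (Unit A))"
| "unshuffle ((a, xs) # zs) =
     (let as = tensor (map fst zs); ys = concat (map snd zs)
      in (Idn A (a \<odot> as) \<boxtimes> tensor_append xs ys)
           \<cdot> interchange a (tensor xs) as (tensor ys)
           \<cdot> (Idn A (a \<odot> tensor xs) \<boxtimes> unshuffle zs))"

text \<open>The canonical isomorphism \<open>tensor (replicate n Unit) \<rightarrow> Unit\<close>.\<close>

fun unit_power :: "nat \<Rightarrow> 'm" where
  "unit_power 0 = Idn A (Unit A)"
| "unit_power (Suc n) = LUnit A (Unit A) \<cdot> (Idn A (Unit A) \<boxtimes> unit_power n)"

text \<open>
  \<open>pull_front j xs\<close> moves the \<open>j\<close>-th factor to the front: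
  \<open>tensor xs \<rightarrow> (xs ! j) \<odot> tensor (remove_nth j xs)\<close>.
\<close>

fun pull_front :: "nat \<Rightarrow> 'o list \<Rightarrow> 'm" where
  "pull_front j [] = undefined"
| "pull_front 0 (x # xs) = Idn A (x \<odot> tensor xs)"
| "pull_front (Suc j) (x # xs) =
     swap_front x (xs ! j) (tensor (remove_nth j xs)) \<cdot> (Idn A x \<boxtimes> pull_front j xs)"

text \<open>
  If \<open>js\<close> is an arrangement of the positions of \<open>xs\<close>, then \<open>rearrange js xs\<close> is the symmetry
  isomorphism \<open>tensor xs \<rightarrow> tensor (map (\<lambda>j. xs ! j) js)\<close>. After \<open>xs ! j\<close> has been moved to
  the front, the positions beyond \<open>j\<close> drop by one.
\<close>

fun rearrange :: "nat list \<Rightarrow> 'o list \<Rightarrow> 'm" where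
  "rearrange [] xs = Idn A (Unit A)"
| "rearrange (j # js) xs =
     (Idn A (xs ! j) \<boxtimes> rearrange (map (\<lambda>i. if j < i then i - 1 else i) js) (remove_nth j xs))
       \<cdot> pull_front j xs"

end

text \<open>
  The left action of permutations on lists and on tensor products: \<open>\<sigma>\<close> moves the entry in
  position \<open>i\<close> to position \<open>\<sigma> i\<close>, i.e.
  \<open>\<sigma> (x\<^sub>1 \<otimes> \<dots> \<otimes> x\<^sub>n) = x_{\<sigma>\<inverse>(1)} \<otimes> \<dots> \<otimes> x_{\<sigma>\<inverse>(n)}\<close>.
\<close>

definition perm_list :: "(nat \<Rightarrow> nat) \<Rightarrow> 'a list \<Rightarrow> 'a list" where
  "perm_list \<sigma> xs = permute_list (inv_into UNIV \<sigma>) xs"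

definition perm_tensor :: "('o, 'm, 'z) monoidal_scheme \<Rightarrow> (nat \<Rightarrow> nat) \<Rightarrow> 'o list \<Rightarrow> 'm" where
  "perm_tensor A \<sigma> xs = rearrange A (perm_list \<sigma> [0..<length xs]) xs"

section \<open>Symmetric operads\<close>

text \<open>
  The permutation moving position \<open>bs ! j\<close> to position \<open>j\<close>, for \<open>bs\<close> an arrangement of
  \<open>[0..<length bs]\<close>.
\<close>

definition arrangement_perm :: "nat list \<Rightarrow> nat \<Rightarrow> nat" where
  "arrangement_perm bs = inv_into UNIV (\<lambda>j. if j < length bs then bs ! j else j)"

text \<open>\<open>[0..<k\<^sub>1 + \<dots> + k\<^sub>n]\<close>, shifted by \<open>m\<close>, cut into consecutive blocks of lengths \<open>k\<^sub>i\<close>.\<close>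

fun blocks :: "nat \<Rightarrow> nat list \<Rightarrow> nat list list" where
  "blocks m [] = []"
| "blocks m (k # ks) = [m..<m + k] # blocks (m + k) ks"

definition block_perm :: "(nat \<Rightarrow> nat) \<Rightarrow> nat list \<Rightarrow> nat \<Rightarrow> nat" where
  "block_perm \<sigma> ks = arrangement_perm (concat (perm_list \<sigma> (blocks 0 ks)))"

definition sum_perm :: "(nat \<Rightarrow> nat) list \<Rightarrow> nat list \<Rightarrow> nat \<Rightarrow> nat" where
  "sum_perm \<tau>s ks = arrangement_perm (concat (map2 perm_list \<tau>s (blocks 0 ks)))"

text \<open>
  \<open>OAct n \<sigma>\<close> is the right action of \<open>\<sigma>\<close> on the component of arity \<open>n\<close>, and
  \<open>OCmp [k\<^sub>1, \<dots>, k\<^sub>n] : P\<^sub>n \<odot> tensor [P_{k\<^sub>1}, \<dots>, P_{k\<^sub>n}] \<rightarrow> P_{k\<^sub>1 + \<dots> + k\<^sub>n}\<close>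
  is the operadic composition.
\<close>

record ('o, 'm) operad =
  OObj :: "nat \<Rightarrow> 'o"
  OAct :: "nat \<Rightarrow> (nat \<Rightarrow> nat) \<Rightarrow> 'm"
  OUnit :: "'m"
  OCmp :: "nat list \<Rightarrow> 'm"

locale symmetric_operad = symmetric_monoidal_category A
  for A :: "('o, 'm, 'z) monoidal_scheme" (structure) +
  fixes P :: "('o, 'm) operad"
  assumes OObj_in: "OObj P n \<in> Obj A"
    and OAct_in: "\<sigma> permutes {..<n} \<Longrightarrow> OAct P n \<sigma> \<in> Hom A (OObj P n) (OObj P n)"
    and OAct_id: "OAct P n id = Idn A (OObj P n)"
    and OAct_comp: "\<sigma> permutes {..<n} \<Longrightarrow> \<tau> permutes {..<n} \<Longrightarrow>
        OAct P n (\<sigma> \<circ> \<tau>) = OAct P n \<tau> \<cdot> OAct P n \<sigma>"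
    and OUnit_in: "OUnit P \<in> Hom A (Unit A) (OObj P 1)"
    and OCmp_in: "OCmp P ks \<in>
        Hom A (OObj P (length ks) \<odot> tensor A (map (OObj P) ks)) (OObj P (sum_list ks))"
    and left_unit:
      "OCmp P [k] \<cdot> (OUnit P \<boxtimes> tensor_arr A [Idn A (OObj P k)])
       = RUnit A (OObj P k) \<cdot> LUnit A (OObj P k \<odot> Unit A)"
    and right_unit:
      "OCmp P (replicate n 1) \<cdot> (Idn A (OObj P n) \<boxtimes> tensor_arr A (replicate n (OUnit P)))
       = RUnit A (OObj P n) \<cdot> (Idn A (OObj P n) \<boxtimes> unit_power A n)"
    and associativity:
      "OCmp P (map sum_list kss)
         \<cdot> (Idn A (OObj P (length kss)) \<boxtimes> tensor_arr A (map (OCmp P) kss))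
       = OCmp P (concat kss)
         \<cdot> (OCmp P (map length kss) \<boxtimes> Idn A (tensor A (map (OObj P) (concat kss))))
         \<cdot> inverse_arr A (Assoc A (OObj P (length kss)) (tensor A (map (OObj P) (map length kss)))
             (tensor A (map (OObj P) (concat kss))))
         \<cdot> (Idn A (OObj P (length kss))
             \<boxtimes> unshuffle A (map (\<lambda>ks. (OObj P (length ks), map (OObj P) ks)) kss))"
    and equivariance_outer: "\<sigma> permutes {..<length ks} \<Longrightarrow>
        OCmp P ks \<cdot> (OAct P (length ks) \<sigma> \<boxtimes> Idn A (tensor A (map (OObj P) ks)))
        = OAct P (sum_list ks) (block_perm \<sigma> ks) \<cdot> OCmp P (perm_list \<sigma> ks)
          \<cdot> (Idn A (OObj P (length ks)) \<boxtimes> perm_tensor A \<sigma> (map (OObj P) ks))"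
    and equivariance_inner: "list_all2 (\<lambda>\<tau> k. \<tau> permutes {..<k}) \<tau>s ks \<Longrightarrow>
        OCmp P ks \<cdot> (Idn A (OObj P (length ks)) \<boxtimes> tensor_arr A (map2 (OAct P) ks \<tau>s))
        = OAct P (sum_list ks) (sum_perm \<tau>s ks) \<cdot> OCmp P ks"

text \<open>\<open>P\<^sub>1 = k\<close> is understood through the operad unit \<open>k \<rightarrow> P\<^sub>1\<close>.\<close>

definition reduced_operad :: "('o, 'm, 'z) monoidal_scheme \<Rightarrow> ('o, 'm) operad \<Rightarrow> bool" where
  "reduced_operad A P \<longleftrightarrow> zero_object A (OObj P 0) \<and> is_iso A (OUnit P)"

subsection \<open>The Schur functor\<close>

context
  fixes A :: "('o, 'm, 'z) monoidal_scheme" (structure) and P :: "('o, 'm) operad"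
begin

abbreviation tensor_power :: "nat \<Rightarrow> 'o \<Rightarrow> 'o" where
  "tensor_power n x \<equiv> tensor A (replicate n x)"

text \<open>\<open>q\<close> exhibits its codomain as \<open>P\<^sub>n\<close> tensored over \<open>\<Sigma>\<^sub>n\<close> with the \<open>n\<close>-th tensor power of \<open>x\<close>.\<close>

definition is_sym_quotient :: "nat \<Rightarrow> 'o \<Rightarrow> 'm \<Rightarrow> bool" where
  "is_sym_quotient n x q \<longleftrightarrow>
     q \<in> Arr A \<and> Dom A q = OObj P n \<odot> tensor_power n x \<and>
     (\<forall>\<sigma>. \<sigma> permutes {..<n} \<longrightarrow>
        q \<cdot> (OAct P n \<sigma> \<boxtimes> Idn A (tensor_power n x))
        = q \<cdot> (Idn A (OObj P n) \<boxtimes> perm_tensor A \<sigma> (replicate n x))) \<and>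
     (\<forall>y. \<forall>f \<in> Hom A (OObj P n \<odot> tensor_power n x) y.
        (\<forall>\<sigma>. \<sigma> permutes {..<n} \<longrightarrow>
           f \<cdot> (OAct P n \<sigma> \<boxtimes> Idn A (tensor_power n x))
           = f \<cdot> (Idn A (OObj P n) \<boxtimes> perm_tensor A \<sigma> (replicate n x))) \<longrightarrow>
        (\<exists>!h. h \<in> Hom A (Cod A q) y \<and> h \<cdot> q = f))"

definition sym_quotient :: "nat \<Rightarrow> 'o \<Rightarrow> 'm" where
  "sym_quotient n x = (SOME q. is_sym_quotient n x q)"

definition schur_cocone :: "'o \<Rightarrow> 'o \<times> (nat \<Rightarrow> 'm)" where
  "schur_cocone x =
     (SOME X\<iota>. is_coproduct A (\<lambda>n. Cod A (sym_quotient n x)) (fst X\<iota>) (snd X\<iota>))"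

definition schur :: "'o \<Rightarrow> 'o" where
  "schur x = fst (schur_cocone x)"

definition schur_in :: "nat \<Rightarrow> 'o \<Rightarrow> 'm" where
  "schur_in n x = snd (schur_cocone x) n \<cdot> sym_quotient n x"

definition schur_map :: "'m \<Rightarrow> 'm" where
  "schur_map f = (THE g. g \<in> Hom A (schur (Dom A f)) (schur (Cod A f)) \<and>
     (\<forall>n. g \<cdot> schur_in n (Dom A f)
        = schur_in n (Cod A f) \<cdot> (Idn A (OObj P n) \<boxtimes> tensor_arr A (replicate n f))))"

subsection \<open>Algebras\<close>

text \<open>
  A \<open>P\<close>-algebra is a pair of an object and a structure map \<open>\<mu> : P(E) \<rightarrow> E\<close>. The unit and
  associativity laws are expressed by the components
  \<open>\<mu>\<^sub>n : P\<^sub>n \<odot> E^n \<rightarrow> P(E) \<rightarrow> E\<close>; equivariance of \<open>\<mu>\<^sub>n\<close> is built into \<open>P(E)\<close>.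
\<close>

definition alg_component :: "'o \<times> 'm \<Rightarrow> nat \<Rightarrow> 'm" where
  "alg_component X n = snd X \<cdot> schur_in n (fst X)"

definition is_algebra :: "'o \<times> 'm \<Rightarrow> bool" where
  "is_algebra X \<longleftrightarrow>
     fst X \<in> Obj A \<and> snd X \<in> Hom A (schur (fst X)) (fst X) \<and>
     alg_component X 1 \<cdot> (OUnit P \<boxtimes> tensor_arr A [Idn A (fst X)])
       = RUnit A (fst X) \<cdot> LUnit A (fst X \<odot> Unit A) \<and>
     (\<forall>ks. alg_component X (length ks)
             \<cdot> (Idn A (OObj P (length ks)) \<boxtimes> tensor_arr A (map (alg_component X) ks))
           = alg_component X (sum_list ks)
             \<cdot> (OCmp P ks \<boxtimes> Idn A (tensor_power (sum_list ks) (fst X)))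
             \<cdot> inverse_arr A (Assoc A (OObj P (length ks)) (tensor A (map (OObj P) ks))
                 (tensor_power (sum_list ks) (fst X)))
             \<cdot> (Idn A (OObj P (length ks))
                 \<boxtimes> unshuffle A (map (\<lambda>k. (OObj P k, replicate k (fst X))) ks)))"

definition is_algebra_arr :: "'o \<times> 'm \<Rightarrow> 'm \<Rightarrow> 'o \<times> 'm \<Rightarrow> bool" where
  "is_algebra_arr X f Y \<longleftrightarrow> is_algebra X \<and> is_algebra Y \<and>
     f \<in> Hom A (fst X) (fst Y) \<and> f \<cdot> snd X = snd Y \<cdot> schur_map f"

text \<open>In the derived categories an arrow carries its source and target: \<open>(X, f, Y)\<close>.\<close>

definition algebras ::
  "('o \<times> 'm, ('o \<times> 'm) \<times> 'm \<times> ('o \<times> 'm)) category" where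
  "algebras =
     \<lparr>Obj = {X. is_algebra X},
      Arr = {(X, f, Y). is_algebra_arr X f Y},
      Dom = fst,
      Cod = (\<lambda>u. snd (snd u)),
      Idn = (\<lambda>X. (X, Idn A (fst X), X)),
      Cmp = (\<lambda>v u. (fst u, fst (snd v) \<cdot> fst (snd u), snd (snd v)))\<rparr>"

end

section \<open>Reflexive graphs and internal categories\<close>

record ('o, 'm) reflexive_graph =
  GE :: 'o
  GB :: 'o
  Gs :: 'm
  Gt :: 'm
  Gi :: 'm

context
  fixes C :: "('o, 'm, 'z) category_scheme" (structure)
begin

definition is_reflexive_graph :: "('o, 'm) reflexive_graph \<Rightarrow> bool" where
  "is_reflexive_graph G \<longleftrightarrow> GE G \<in> Obj C \<and> GB G \<in> Obj C \<and>
     Gs G \<in> Hom C (GE G) (GB G) \<and> Gt G \<in> Hom C (GE G) (GB G) \<and> Gi G \<in> Hom C (GB G) (GE G) \<and>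
     Gs G \<cdot> Gi G = Idn C (GB G) \<and> Gt G \<cdot> Gi G = Idn C (GB G)"

definition is_graph_arr ::
  "('o, 'm) reflexive_graph \<Rightarrow> 'm \<times> 'm \<Rightarrow> ('o, 'm) reflexive_graph \<Rightarrow> bool" where
  "is_graph_arr G \<phi> H \<longleftrightarrow> is_reflexive_graph G \<and> is_reflexive_graph H \<and>
     fst \<phi> \<in> Hom C (GE G) (GE H) \<and> snd \<phi> \<in> Hom C (GB G) (GB H) \<and>
     Gs H \<cdot> fst \<phi> = snd \<phi> \<cdot> Gs G \<and> Gt H \<cdot> fst \<phi> = snd \<phi> \<cdot> Gt G \<and>
     Gi H \<cdot> snd \<phi> = fst \<phi> \<cdot> Gi G"

definition reflexive_graphs ::
  "(('o, 'm) reflexive_graph,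
    ('o, 'm) reflexive_graph \<times> ('m \<times> 'm) \<times> ('o, 'm) reflexive_graph) category" where
  "reflexive_graphs =
     \<lparr>Obj = {G. is_reflexive_graph G},
      Arr = {(G, \<phi>, H). is_graph_arr G \<phi> H},
      Dom = fst,
      Cod = (\<lambda>u. snd (snd u)),
      Idn = (\<lambda>G. (G, (Idn C (GE G), Idn C (GB G)), G)),
      Cmp = (\<lambda>v u. (fst u,
               (fst (fst (snd v)) \<cdot> fst (fst (snd u)), snd (fst (snd v)) \<cdot> snd (fst (snd u))),
               snd (snd v)))\<rparr>"

text \<open>The projections \<open>(g, f) \<mapsto> g\<close> and \<open>(g, f) \<mapsto> f\<close> of the object of composable pairs, \<open>s g = t f\<close>.\<close>

definition composable_pairs :: "('o, 'm) reflexive_graph \<Rightarrow> 'm \<times> 'm" where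
  "composable_pairs G = pullback C (Gs G) (Gt G)"

text \<open>
  The projections \<open>(h, g, f) \<mapsto> (h, g)\<close> and \<open>(h, g, f) \<mapsto> (g, f)\<close> of the object of composable
  triples.
\<close>

definition composable_triples :: "('o, 'm) reflexive_graph \<Rightarrow> 'm \<times> 'm" where
  "composable_triples G = pullback C (snd (composable_pairs G)) (fst (composable_pairs G))"

definition is_internal_category :: "('o, 'm) reflexive_graph \<Rightarrow> 'm \<Rightarrow> bool" where
  "is_internal_category G c \<longleftrightarrow> is_reflexive_graph G \<and>
     (let pq = composable_pairs G; p = fst pq; q = snd pq;
          ab = composable_triples G; a = fst ab; b = snd ab
      in c \<in> Hom C (Dom C p) (GE G) \<and>
         Gs G \<cdot> c = Gs G \<cdot> q \<and> Gt G \<cdot> c = Gt G \<cdot> p \<and>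
         c \<cdot> pb_pair C pq (Idn C (GE G)) (Gi G \<cdot> Gs G) = Idn C (GE G) \<and>
         c \<cdot> pb_pair C pq (Gi G \<cdot> Gt G) (Idn C (GE G)) = Idn C (GE G) \<and>
         c \<cdot> pb_pair C pq (c \<cdot> a) (q \<cdot> b) = c \<cdot> pb_pair C pq (p \<cdot> a) (c \<cdot> b))"

definition is_internal_functor ::
  "('o, 'm) reflexive_graph \<times> 'm \<Rightarrow> 'm \<times> 'm \<Rightarrow> ('o, 'm) reflexive_graph \<times> 'm \<Rightarrow> bool" where
  "is_internal_functor X \<phi> Y \<longleftrightarrow>
     is_internal_category (fst X) (snd X) \<and> is_internal_category (fst Y) (snd Y) \<and>
     is_graph_arr (fst X) \<phi> (fst Y) \<and>
     (let pq = composable_pairs (fst X)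
      in fst \<phi> \<cdot> snd X
         = snd Y \<cdot> pb_pair C (composable_pairs (fst Y)) (fst \<phi> \<cdot> fst pq) (fst \<phi> \<cdot> snd pq))"

definition internal_categories ::
  "(('o, 'm) reflexive_graph \<times> 'm,
    (('o, 'm) reflexive_graph \<times> 'm) \<times> ('m \<times> 'm) \<times> (('o, 'm) reflexive_graph \<times> 'm)) category" where
  "internal_categories =
     \<lparr>Obj = {X. is_internal_category (fst X) (snd X)},
      Arr = {(X, \<phi>, Y). is_internal_functor X \<phi> Y},
      Dom = fst,
      Cod = (\<lambda>u. snd (snd u)),
      Idn = (\<lambda>X. (X, (Idn C (GE (fst X)), Idn C (GB (fst X))), X)),
      Cmp = (\<lambda>v u. (fst u,
               (fst (fst (snd v)) \<cdot> fst (fst (snd u)), snd (fst (snd v)) \<cdot> snd (fst (snd u))),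
               snd (snd v)))\<rparr>"

end

text \<open>The effect on arrows of forgetting the composition of an internal category.\<close>

definition underlying_graph_arr ::
  "('g \<times> 'm) \<times> 'f \<times> ('g \<times> 'm) \<Rightarrow> 'g \<times> 'f \<times> 'g" where
  "underlying_graph_arr u = (fst (fst u), fst (snd u), fst (snd (snd u)))"

section \<open>\<open>Cat\<^sup>1\<close>-algebras\<close>

type_synonym ('o, 'm) algebra_graph =
  "('o \<times> 'm, ('o \<times> 'm) \<times> 'm \<times> ('o \<times> 'm)) reflexive_graph"

text \<open>
  The composite
  \<open>P\<^sub>n \<odot> (ker s \<odot> ker t \<odot> E^(n-2)) \<rightarrow> P\<^sub>n \<odot> E^n \<rightarrow> P(E) \<rightarrow> E\<close> vanishes for all \<open>n \<ge> 2\<close>;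
  kernels are taken in \<open>A\<close>, of the underlying arrows.
\<close>

definition cat1_condition ::
  "('o, 'm, 'z) monoidal_scheme \<Rightarrow> ('o, 'm) operad \<Rightarrow> ('o, 'm) algebra_graph \<Rightarrow> bool" where
  "cat1_condition A P G \<longleftrightarrow>
     (let E = fst (GE G); \<mu> = snd (GE G);
          ks = kernel_arr A (fst (snd (Gs G))); kt = kernel_arr A (fst (snd (Gt G)))
      in \<forall>n\<ge>2.
           \<mu> \<cdot>\<^bsub>A\<^esub> schur_in A P n E
             \<cdot>\<^bsub>A\<^esub> (Idn A (OObj P n) \<boxtimes>\<^bsub>A\<^esub> tensor_arr A (ks # kt # replicate (n - 2) (Idn A E)))
           = Zero A
               (OObj P n \<odot>\<^bsub>A\<^esub> tensor A (Dom A ks # Dom A kt # replicate (n - 2) E)) E)"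

definition cat1_algebras ::
  "('o, 'm, 'z) monoidal_scheme \<Rightarrow> ('o, 'm) operad \<Rightarrow>
    (('o, 'm) algebra_graph,
     ('o, 'm) algebra_graph \<times>
       ((('o \<times> 'm) \<times> 'm \<times> ('o \<times> 'm)) \<times> (('o \<times> 'm) \<times> 'm \<times> ('o \<times> 'm))) \<times>
       ('o, 'm) algebra_graph) category" where
  "cat1_algebras A P =
     full_subcategory (reflexive_graphs (algebras A P)) (cat1_condition A P)"

end

theory Submission
  imports Defs
begin

text \<open>
  Let \<open>s, t : E \<rightarrow> B\<close>, \<open>i : B \<rightarrow> E\<close> be a reflexive graph of algebras, and write a generalised element
  of \<open>E \<times>\<^bsub>B\<^esub> E\<close> as \<open>(g, f)\<close> with \<open>s g = t f\<close>. In an additive category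
  \<open>(g, f) = (g, i s g) + (i t f, f) - (i s g, i s g)\<close>, so the unit laws force
  \<open>g \<circ> f = g + f - i s g\<close> (\<open>composition_of_units\<close>). Conversely this formula satisfies all category
  axioms, and every graph morphism respects it. Hence a graph of algebras carries at most one
  internal category structure, and it carries one exactly when the formula defines an algebra
  morphism. Since pullbacks of algebras are computed in the underlying category
  (\<open>pullback_underlying\<close>), this says that for all \<open>n\<close> the operation \<open>\<mu>\<^sub>n : P\<^sub>n \<odot> E\<^sup>n \<rightarrow> E\<close> satisfies
  \<open>\<mu>\<^sub>n(c\<^sup>n) + \<mu>\<^sub>n(e\<^sup>n) = \<mu>\<^sub>n(g\<^sup>n) + \<mu>\<^sub>n(f\<^sup>n)\<close>, where \<open>e = i s g\<close> and \<open>c = g + f - e\<close>.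

  The tensor product has right adjoints, hence is additive in each variable, and \<open>\<mu>\<^sub>n\<close> may be
  expanded. Put \<open>k = g - e\<close>, which lies in \<open>ker s\<close>, and \<open>l = f - e\<close>, which lies in \<open>ker t\<close>; then
  \<open>g = e + k\<close>, \<open>f = e + l\<close>, \<open>c = e + k + l\<close>. The two sides of the equation differ by the values of
  \<open>\<mu>\<^sub>n\<close> on the words in \<open>e\<close>, \<open>k\<close>, \<open>l\<close> that contain both \<open>k\<close> and \<open>l\<close>. As \<open>\<mu>\<^sub>n\<close> is equivariant, these
  letters can be moved to the first two places, where the vanishing condition applies
  (\<open>multilinear_telescope\<close>, \<open>word_value_perm\<close>, \<open>cat1_condition_imp_algebra_arr\<close>). In the other
  direction, if the composition is an algebra morphism, apply it to the word
  \<open>(k, 0), (0, l), (x, i s x), \<dots>, (x, i s x)\<close>: the composites are \<open>k, l, x, \<dots>, x\<close>, while the words of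
  first components, of second components and of middle identities each contain a zero, so
  \<open>\<mu>\<^sub>n\<close> vanishes on \<open>k, l, x, \<dots>, x\<close> (\<open>algebra_arr_imp_cat1_condition\<close>).
\<close>

section \<open>Categories\<close>

text \<open>
  Typing is handled through conditions on \<open>Dom\<close> and \<open>Cod\<close>, which the simplifier can discharge by
  rewriting; a premise \<open>f \<in> Hom C a b\<close> would leave the intermediate objects of a composite to be
  guessed.
\<close>

lemma Hom_iff [simp]: "f \<in> Hom C a b \<longleftrightarrow> f \<in> Arr C \<and> Dom C f = a \<and> Cod C f = b"
  by (simp add: Hom_def)

context category
begin

lemma Dom_Obj [simp]: "f \<in> Arr C \<Longrightarrow> Dom C f \<in> Obj C"
  and Cod_Obj [simp]: "f \<in> Arr C \<Longrightarrow> Cod C f \<in> Obj C"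
  by (simp_all add: Dom_in Cod_in)

lemma Idn_Arr [simp]:
  assumes "a \<in> Obj C"
  shows "Idn C a \<in> Arr C" "Dom C (Idn C a) = a" "Cod C (Idn C a) = a"
  using Idn_in[OF assms] by auto

lemma Cmp_Arr [simp]:
  assumes "f \<in> Arr C" "g \<in> Arr C" "Cod C f = Dom C g"
  shows "g \<cdot> f \<in> Arr C" "Dom C (g \<cdot> f) = Dom C f" "Cod C (g \<cdot> f) = Cod C g"
  using Cmp_in[of f "Dom C f" "Dom C g" g "Cod C g"] assms by auto

lemma Cmp_Idn_Arr [simp]: "f \<in> Arr C \<Longrightarrow> Dom C f = a \<Longrightarrow> f \<cdot> Idn C a = f"
  using Cmp_Idn[of f a "Cod C f"] by simp

lemma Idn_Cmp_Arr [simp]: "f \<in> Arr C \<Longrightarrow> Cod C f = b \<Longrightarrow> Idn C b \<cdot> f = f"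
  using Idn_Cmp[of f "Dom C f" b] by simp

lemma Cmp_assoc_Arr [simp]:
  "f \<in> Arr C \<Longrightarrow> g \<in> Arr C \<Longrightarrow> h \<in> Arr C \<Longrightarrow> Cod C f = Dom C g \<Longrightarrow> Cod C g = Dom C h \<Longrightarrow>
    (h \<cdot> g) \<cdot> f = h \<cdot> (g \<cdot> f)"
  using Cmp_assoc[of f "Dom C f" "Dom C g" g "Dom C h" h "Cod C h"] by simp

lemma inverse_arr_props:
  assumes "is_iso C f"
  shows "inverse_arr C f \<in> Hom C (Cod C f) (Dom C f) \<and>
    inverse_arr C f \<cdot> f = Idn C (Dom C f) \<and> f \<cdot> inverse_arr C f = Idn C (Cod C f)"
proof -
  let ?P = "\<lambda>g. g \<in> Hom C (Cod C f) (Dom C f) \<and> g \<cdot> f = Idn C (Dom C f) \<and> f \<cdot> g = Idn C (Cod C f)"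
  have f: "f \<in> Arr C"
    using assms by (simp add: is_iso_def)
  obtain g where g: "?P g"
    using assms by (auto simp: is_iso_def)
  have uniq: "h = g" if h: "?P h" for h
  proof -
    have "h = h \<cdot> (f \<cdot> g)"
      using f g h by simp
    also have "\<dots> = (h \<cdot> f) \<cdot> g"
      using f g h by (subst Cmp_assoc_Arr) auto
    also have "\<dots> = g"
      using f g h by simp
    finally show ?thesis .
  qed
  show ?thesis
    unfolding inverse_arr_def by (rule theI[of ?P, OF g uniq])
qed

lemma inverse_arr_Arr [simp]:
  assumes "is_iso C f"
  shows "inverse_arr C f \<in> Arr C" "Dom C (inverse_arr C f) = Cod C f" "Cod C (inverse_arr C f) = Dom C f"
    "inverse_arr C f \<cdot> f = Idn C (Dom C f)" "f \<cdot> inverse_arr C f = Idn C (Cod C f)"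
  using inverse_arr_props[OF assms] by auto

lemma is_iso_Arr: "is_iso C f \<Longrightarrow> f \<in> Arr C"
  by (simp add: is_iso_def)

text \<open>An equation between composites, applied in front of a further arrow in right-nested form.\<close>

lemma Cmp_reassoc:
  "g \<cdot> f = g' \<cdot> f' \<Longrightarrow> x \<in> Arr C \<Longrightarrow> f \<in> Arr C \<Longrightarrow> g \<in> Arr C \<Longrightarrow> f' \<in> Arr C \<Longrightarrow> g' \<in> Arr C \<Longrightarrow>
    Cod C f = Dom C g \<Longrightarrow> Cod C f' = Dom C g' \<Longrightarrow> Cod C x = Dom C f \<Longrightarrow> Dom C f' = Dom C f \<Longrightarrow>
    g \<cdot> (f \<cdot> x) = g' \<cdot> (f' \<cdot> x)"
  by (metis Cmp_assoc_Arr)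

lemma inverse_arr_natural:
  assumes "is_iso C \<alpha>" "is_iso C \<beta>" "f \<in> Arr C" "g \<in> Arr C" "Cod C f = Dom C \<beta>" "Cod C \<alpha> = Dom C g"
    and "Dom C f = Dom C \<alpha>" "Cod C g = Cod C \<beta>" and nat: "\<beta> \<cdot> f = g \<cdot> \<alpha>"
  shows "inverse_arr C \<beta> \<cdot> g = f \<cdot> inverse_arr C \<alpha>"
proof -
  have arr: "\<alpha> \<in> Arr C" "\<beta> \<in> Arr C"
    using assms by (auto simp: is_iso_Arr)
  have "inverse_arr C \<beta> \<cdot> g = inverse_arr C \<beta> \<cdot> (g \<cdot> (\<alpha> \<cdot> inverse_arr C \<alpha>))"
    using assms arr by simp
  also have "\<dots> = inverse_arr C \<beta> \<cdot> (\<beta> \<cdot> (f \<cdot> inverse_arr C \<alpha>))"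
    using assms(1-8) arr by (subst Cmp_reassoc[OF nat]) auto
  also have "\<dots> = (inverse_arr C \<beta> \<cdot> \<beta>) \<cdot> (f \<cdot> inverse_arr C \<alpha>)"
    using assms arr by (subst Cmp_assoc_Arr) auto
  also have "\<dots> = f \<cdot> inverse_arr C \<alpha>"
    using assms arr by simp
  finally show ?thesis .
qed

lemma is_pullbackD:
  assumes "is_pullback C f g p q"
  shows "f \<in> Arr C" "g \<in> Arr C" "Cod C g = Cod C f" "p \<in> Arr C" "q \<in> Arr C" "Dom C q = Dom C p"
    "Cod C p = Dom C f" "Cod C q = Dom C g" "f \<cdot> p = g \<cdot> q"
  using assms by (auto simp: is_pullback_def)

lemma pullback_ex1:
  assumes pb: "is_pullback C f g p q" and uv: "u \<in> Arr C" "v \<in> Arr C" "Dom C v = Dom C u"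
    "Cod C u = Dom C f" "Cod C v = Dom C g" "f \<cdot> u = g \<cdot> v"
  shows "\<exists>!h. h \<in> Hom C (Dom C u) (Dom C p) \<and> p \<cdot> h = u \<and> q \<cdot> h = v"
proof -
  have "u \<in> Hom C (Dom C u) (Dom C f)" "v \<in> Hom C (Dom C u) (Dom C g)"
    using uv by simp_all
  then show ?thesis
    using pb uv(6) unfolding is_pullback_def by blast
qed

lemma pullback_lift:
  assumes "is_pullback C f g p q" "u \<in> Arr C" "v \<in> Arr C" "Dom C v = Dom C u"
    "Cod C u = Dom C f" "Cod C v = Dom C g" "f \<cdot> u = g \<cdot> v"
  obtains h where "h \<in> Arr C" "Dom C h = Dom C u" "Cod C h = Dom C p" "p \<cdot> h = u" "q \<cdot> h = v"
  using pullback_ex1[OF assms] unfolding Hom_iff by blast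

lemma pullback_joint_mono:
  assumes pb: "is_pullback C f g p q" and "u \<in> Arr C" "v \<in> Arr C" "Dom C u = Dom C v"
    "Cod C u = Dom C p" "Cod C v = Dom C p" "p \<cdot> u = p \<cdot> v" "q \<cdot> u = q \<cdot> v"
  shows "u = v"
proof -
  note D = is_pullbackD[OF pb]
  have sq: "f \<cdot> (p \<cdot> v) = g \<cdot> (q \<cdot> v)"
    by (rule Cmp_reassoc[OF D(9)]) (use D(1-8) assms(2-6) in auto)
  have "\<exists>!h. h \<in> Hom C (Dom C (p \<cdot> v)) (Dom C p) \<and> p \<cdot> h = p \<cdot> v \<and> q \<cdot> h = q \<cdot> v"
    by (rule pullback_ex1[OF pb]) (use sq D(1-8) assms(2-6) in auto)
  moreover have "u \<in> Hom C (Dom C (p \<cdot> v)) (Dom C p)" "v \<in> Hom C (Dom C (p \<cdot> v)) (Dom C p)"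
    using D(1-8) assms(2-6) by auto
  ultimately show ?thesis
    using assms(7,8) by blast
qed

lemma is_pullbackI:
  assumes "f \<in> Arr C" "g \<in> Arr C" "Cod C g = Cod C f" "p \<in> Arr C" "q \<in> Arr C" "Dom C q = Dom C p"
    "Cod C p = Dom C f" "Cod C q = Dom C g" "f \<cdot> p = g \<cdot> q"
    and lift: "\<And>u v. u \<in> Arr C \<Longrightarrow> v \<in> Arr C \<Longrightarrow> Dom C v = Dom C u \<Longrightarrow> Cod C u = Dom C f \<Longrightarrow>
      Cod C v = Dom C g \<Longrightarrow> f \<cdot> u = g \<cdot> v \<Longrightarrow>
      \<exists>h \<in> Arr C. Dom C h = Dom C u \<and> Cod C h = Dom C p \<and> p \<cdot> h = u \<and> q \<cdot> h = v"
    and mono: "\<And>u v. u \<in> Arr C \<Longrightarrow> v \<in> Arr C \<Longrightarrow> Dom C u = Dom C v \<Longrightarrow>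
      Cod C u = Dom C p \<Longrightarrow> Cod C v = Dom C p \<Longrightarrow> p \<cdot> u = p \<cdot> v \<Longrightarrow> q \<cdot> u = q \<cdot> v \<Longrightarrow> u = v"
  shows "is_pullback C f g p q"
proof -
  have "\<exists>!h. h \<in> Hom C a (Dom C p) \<and> p \<cdot> h = u \<and> q \<cdot> h = v"
    if "u \<in> Hom C a (Dom C f)" "v \<in> Hom C a (Dom C g)" "f \<cdot> u = g \<cdot> v" for a u v
  proof (rule ex_ex1I)
    show "\<exists>h. h \<in> Hom C a (Dom C p) \<and> p \<cdot> h = u \<and> q \<cdot> h = v"
      using lift[of u v] that by auto
    show "h = h'" if "h \<in> Hom C a (Dom C p) \<and> p \<cdot> h = u \<and> q \<cdot> h = v"
      "h' \<in> Hom C a (Dom C p) \<and> p \<cdot> h' = u \<and> q \<cdot> h' = v" for h h'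
      using mono[of h h'] that by simp
  qed
  moreover have "q \<in> Hom C (Dom C p) (Dom C g)"
    using assms(5,6,8) by simp
  ultimately show ?thesis
    using assms(1-9) by (simp add: is_pullback_def del: Hom_iff)
qed

lemma pb_pair_props:
  assumes pb: "is_pullback C f g (fst pq) (snd pq)" and uv: "u \<in> Arr C" "v \<in> Arr C" "Dom C v = Dom C u"
    "Cod C u = Dom C f" "Cod C v = Dom C g" "f \<cdot> u = g \<cdot> v"
  shows "pb_pair C pq u v \<in> Arr C" "Dom C (pb_pair C pq u v) = Dom C u"
    "Cod C (pb_pair C pq u v) = Dom C (fst pq)"
    "fst pq \<cdot> pb_pair C pq u v = u" "snd pq \<cdot> pb_pair C pq u v = v"
proof -
  from theI'[OF pullback_ex1[OF assms]]
  show "pb_pair C pq u v \<in> Arr C" "Dom C (pb_pair C pq u v) = Dom C u"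
    "Cod C (pb_pair C pq u v) = Dom C (fst pq)"
    "fst pq \<cdot> pb_pair C pq u v = u" "snd pq \<cdot> pb_pair C pq u v = v"
    unfolding pb_pair_def by auto
qed

lemma pullback_chosen:
  assumes "is_pullback C f g p q"
  shows "is_pullback C f g (fst (pullback C f g)) (snd (pullback C f g))"
  unfolding pullback_def by (rule someI[of _ "(p, q)"]) (simp add: assms)

lemma pullback_comparison:
  assumes pb: "is_pullback C f g p q" and pb': "is_pullback C f g p' q'"
  obtains h k where "h \<in> Arr C" "Dom C h = Dom C p'" "Cod C h = Dom C p" "p \<cdot> h = p'" "q \<cdot> h = q'"
    "k \<in> Arr C" "Dom C k = Dom C p" "Cod C k = Dom C p'" "h \<cdot> k = Idn C (Dom C p)" "k \<cdot> h = Idn C (Dom C p')"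
proof -
  note D = is_pullbackD[OF pb] and D' = is_pullbackD[OF pb']
  obtain h where h: "h \<in> Arr C" "Dom C h = Dom C p'" "Cod C h = Dom C p" "p \<cdot> h = p'" "q \<cdot> h = q'"
    using pullback_lift[OF pb D'(4,5)] D D' by metis
  obtain k where k: "k \<in> Arr C" "Dom C k = Dom C p" "Cod C k = Dom C p'" "p' \<cdot> k = p" "q' \<cdot> k = q"
    using pullback_lift[OF pb' D(4,5)] D D' by metis
  have "p \<cdot> (h \<cdot> k) = (p \<cdot> h) \<cdot> k" "q \<cdot> (h \<cdot> k) = (q \<cdot> h) \<cdot> k"
    "p' \<cdot> (k \<cdot> h) = (p' \<cdot> k) \<cdot> h" "q' \<cdot> (k \<cdot> h) = (q' \<cdot> k) \<cdot> h"
    using D D' h(1-3) k(1-3) by (subst Cmp_assoc_Arr; simp)+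
  then have eq: "p \<cdot> (h \<cdot> k) = p" "q \<cdot> (h \<cdot> k) = q" "p' \<cdot> (k \<cdot> h) = p'" "q' \<cdot> (k \<cdot> h) = q'"
    using h k by simp_all
  have "h \<cdot> k = Idn C (Dom C p)"
    by (rule pullback_joint_mono[OF pb]) (use D(1-8) D'(1-8) eq h(1-3) k(1-3) in auto)
  moreover have "k \<cdot> h = Idn C (Dom C p')"
    by (rule pullback_joint_mono[OF pb']) (use D(1-8) D'(1-8) eq h(1-3) k(1-3) in auto)
  ultimately have "h \<cdot> k = Idn C (Dom C p)" "k \<cdot> h = Idn C (Dom C p')"
    by simp_all
  with h k show ?thesis
    by (intro that)
qed

text \<open>Being a pullback is invariant under an isomorphism of the apex.\<close>

lemma pullback_transport:
  assumes pb: "is_pullback C f g p q" and h: "h \<in> Arr C" "Cod C h = Dom C p"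
    and k: "k \<in> Arr C" "Dom C k = Dom C p" "Cod C k = Dom C h"
    and inv: "h \<cdot> k = Idn C (Dom C p)" "k \<cdot> h = Idn C (Dom C h)"
  shows "is_pullback C f g (p \<cdot> h) (q \<cdot> h)"
proof (rule is_pullbackI)
  note D = is_pullbackD[OF pb]
  show "f \<cdot> (p \<cdot> h) = g \<cdot> (q \<cdot> h)"
    by (rule Cmp_reassoc[OF D(9)]) (use D(1-8) h in auto)
  show "\<exists>w \<in> Arr C. Dom C w = Dom C u \<and> Cod C w = Dom C (p \<cdot> h) \<and> (p \<cdot> h) \<cdot> w = u \<and> (q \<cdot> h) \<cdot> w = v"
    if uv: "u \<in> Arr C" "v \<in> Arr C" "Dom C v = Dom C u" "Cod C u = Dom C f" "Cod C v = Dom C g"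
      "f \<cdot> u = g \<cdot> v" for u v
  proof -
    obtain w where w: "w \<in> Arr C" "Dom C w = Dom C u" "Cod C w = Dom C p" "p \<cdot> w = u" "q \<cdot> w = v"
      using pullback_lift[OF pb uv] by metis
    have "h \<cdot> (k \<cdot> w) = (h \<cdot> k) \<cdot> w"
      using h k w by (subst Cmp_assoc_Arr) auto
    then have "h \<cdot> (k \<cdot> w) = w"
      using inv w by simp
    then show ?thesis
      using w D(1-8) h k by (intro bexI[of _ "k \<cdot> w"]) auto
  qed
  show "u = v" if uv: "u \<in> Arr C" "v \<in> Arr C" "Dom C u = Dom C v" "Cod C u = Dom C (p \<cdot> h)"
    "Cod C v = Dom C (p \<cdot> h)" "(p \<cdot> h) \<cdot> u = (p \<cdot> h) \<cdot> v" "(q \<cdot> h) \<cdot> u = (q \<cdot> h) \<cdot> v" for u v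
  proof -
    have "h \<cdot> u = h \<cdot> v"
      by (rule pullback_joint_mono[OF pb]) (use uv D(1-8) h in auto)
    moreover have "k \<cdot> (h \<cdot> w) = w" if "w \<in> Arr C" "Cod C w = Dom C h" for w
    proof -
      have "k \<cdot> (h \<cdot> w) = (k \<cdot> h) \<cdot> w"
        using h k that by (subst Cmp_assoc_Arr) auto
      then show ?thesis
        using inv that by simp
    qed
    ultimately show ?thesis
      using uv D h by (metis Cmp_Arr(2))
  qed
qed (use is_pullbackD[OF pb] h in auto)

end

section \<open>Additive structure\<close>

context preadditive_category
begin

abbreviation hom_group :: "'o \<Rightarrow> 'o \<Rightarrow> 'm monoid" where
  "hom_group a b \<equiv> \<lparr>carrier = Hom A a b, monoid.mult = Add A, one = Zero A a b\<rparr>"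

definition neg :: "'m \<Rightarrow> 'm" where
  "neg f = m_inv (hom_group (Dom A f) (Cod A f)) f"

lemma Add_Arr [simp]:
  assumes "f \<in> Arr A" "g \<in> Arr A" "Dom A f = Dom A g" "Cod A f = Cod A g"
  shows "f \<boxplus> g \<in> Arr A" "Dom A (f \<boxplus> g) = Dom A g" "Cod A (f \<boxplus> g) = Cod A g"
proof -
  interpret G: comm_group "hom_group (Dom A g) (Cod A g)"
    using assms by (intro Hom_group) auto
  show "f \<boxplus> g \<in> Arr A" "Dom A (f \<boxplus> g) = Dom A g" "Cod A (f \<boxplus> g) = Cod A g"
    using G.m_closed[of f g] assms by auto
qed

lemma Zero_Arr [simp]:
  assumes "a \<in> Obj A" "b \<in> Obj A"
  shows "Zero A a b \<in> Arr A" "Dom A (Zero A a b) = a" "Cod A (Zero A a b) = b"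
proof -
  interpret G: comm_group "hom_group a b"
    using assms by (intro Hom_group) auto
  show "Zero A a b \<in> Arr A" "Dom A (Zero A a b) = a" "Cod A (Zero A a b) = b"
    using G.one_closed by auto
qed

lemma Add_assoc:
  assumes "f \<in> Arr A" "g \<in> Arr A" "h \<in> Arr A" "Dom A f = Dom A g" "Cod A f = Cod A g"
    "Dom A g = Dom A h" "Cod A g = Cod A h"
  shows "f \<boxplus> g \<boxplus> h = f \<boxplus> (g \<boxplus> h)"
proof -
  interpret G: comm_group "hom_group (Dom A f) (Cod A f)"
    using assms by (intro Hom_group) auto
  show ?thesis
    using G.m_assoc[of f g h] assms by auto
qed

lemma Add_commute:
  assumes "f \<in> Arr A" "g \<in> Arr A" "Dom A f = Dom A g" "Cod A f = Cod A g"
  shows "f \<boxplus> g = g \<boxplus> f"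
proof -
  interpret G: comm_group "hom_group (Dom A f) (Cod A f)"
    using assms by (intro Hom_group) auto
  show ?thesis
    using G.m_comm[of f g] assms by auto
qed

lemma Add_left_commute:
  assumes "f \<in> Arr A" "g \<in> Arr A" "h \<in> Arr A" "Dom A f = Dom A g" "Cod A f = Cod A g"
    "Dom A g = Dom A h" "Cod A g = Cod A h"
  shows "f \<boxplus> (g \<boxplus> h) = g \<boxplus> (f \<boxplus> h)"
  using Add_assoc[of f g h] Add_assoc[of g f h] Add_commute[of f g] assms by simp

lemmas Add_ac = Add_assoc Add_commute Add_left_commute

lemma Add_Zero [simp]:
  assumes "f \<in> Arr A" "Dom A f = a" "Cod A f = b"
  shows "f \<boxplus> Zero A a b = f" "Zero A a b \<boxplus> f = f"
proof -
  interpret G: comm_group "hom_group a b"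
    using assms by (intro Hom_group) auto
  show "f \<boxplus> Zero A a b = f" "Zero A a b \<boxplus> f = f"
    using G.r_one[of f] G.l_one[of f] assms by auto
qed

lemma neg_Arr [simp]:
  assumes "f \<in> Arr A"
  shows "neg f \<in> Arr A" "Dom A (neg f) = Dom A f" "Cod A (neg f) = Cod A f"
    "f \<boxplus> neg f = Zero A (Dom A f) (Cod A f)"
proof -
  interpret G: comm_group "hom_group (Dom A f) (Cod A f)"
    using assms by (intro Hom_group) auto
  show "neg f \<in> Arr A" "Dom A (neg f) = Dom A f" "Cod A (neg f) = Cod A f"
    "f \<boxplus> neg f = Zero A (Dom A f) (Cod A f)"
    using G.inv_closed[of f] G.r_inv[of f] assms by (auto simp: neg_def)
qed

lemma Add_right_cancel:
  assumes "f \<in> Arr A" "g \<in> Arr A" "h \<in> Arr A" "Dom A f = Dom A h" "Cod A f = Cod A h"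
    "Dom A g = Dom A h" "Cod A g = Cod A h"
  shows "f \<boxplus> h = g \<boxplus> h \<longleftrightarrow> f = g"
proof -
  interpret G: comm_group "hom_group (Dom A h) (Cod A h)"
    using assms by (intro Hom_group) auto
  show ?thesis
    using G.right_cancel[of h f g] assms by auto
qed

lemma Add_neg_cancel [simp]:
  assumes "f \<in> Arr A" "g \<in> Arr A" "Dom A f = Dom A g" "Cod A f = Cod A g"
  shows "g \<boxplus> (f \<boxplus> neg g) = f" "(f \<boxplus> neg g) \<boxplus> g = f"
proof -
  show "g \<boxplus> (f \<boxplus> neg g) = f"
    using assms by (subst Add_left_commute) auto
  then show "(f \<boxplus> neg g) \<boxplus> g = f"
    using assms by (subst Add_commute) auto
qed

lemma Add_neg_eq_Zero_iff:
  assumes "f \<in> Arr A" "g \<in> Arr A" "Dom A f = Dom A g" "Cod A f = Cod A g"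
  shows "f \<boxplus> neg g = Zero A (Dom A g) (Cod A g) \<longleftrightarrow> f = g"
proof -
  have "f \<boxplus> neg g = g \<boxplus> neg g \<longleftrightarrow> f = g"
    by (rule Add_right_cancel) (use assms in auto)
  then show ?thesis
    using assms by simp
qed

lemma Add_eq_self_iff:
  assumes "f \<in> Arr A" "g \<in> Arr A" "Dom A f = Dom A g" "Cod A f = Cod A g"
  shows "f \<boxplus> g = g \<longleftrightarrow> f = Zero A (Dom A g) (Cod A g)"
proof -
  have "f \<boxplus> g = Zero A (Dom A g) (Cod A g) \<boxplus> g \<longleftrightarrow> f = Zero A (Dom A g) (Cod A g)"
    by (rule Add_right_cancel) (use assms in auto)
  then show ?thesis
    using assms by simp
qed

lemma Cmp_Add_Arr:
  "f \<in> Arr A \<Longrightarrow> g \<in> Arr A \<Longrightarrow> h \<in> Arr A \<Longrightarrow> Dom A f = Dom A g \<Longrightarrow> Cod A f = Cod A g \<Longrightarrow>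
    Cod A g = Dom A h \<Longrightarrow> h \<cdot> (f \<boxplus> g) = h \<cdot> f \<boxplus> h \<cdot> g"
  using Cmp_Add[of f "Dom A f" "Cod A f" g h "Cod A h"] by simp

lemma Add_Cmp_Arr:
  "f \<in> Arr A \<Longrightarrow> g \<in> Arr A \<Longrightarrow> h \<in> Arr A \<Longrightarrow> Dom A g = Dom A h \<Longrightarrow> Cod A g = Cod A h \<Longrightarrow>
    Cod A f = Dom A h \<Longrightarrow> (g \<boxplus> h) \<cdot> f = g \<cdot> f \<boxplus> h \<cdot> f"
  using Add_Cmp[of f "Dom A f" "Cod A f" g "Cod A g" h] by simp

lemma Cmp_Zero [simp]:
  assumes "h \<in> Arr A" "a \<in> Obj A" "Dom A h = b"
  shows "h \<cdot> Zero A a b = Zero A a (Cod A h)"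
proof -
  have b: "b \<in> Obj A" using assms by auto
  have "h \<cdot> Zero A a b \<boxplus> h \<cdot> Zero A a b = h \<cdot> Zero A a b"
    using Cmp_Add_Arr[of "Zero A a b" "Zero A a b" h] assms b by simp
  then show ?thesis
    using Add_eq_self_iff[of "h \<cdot> Zero A a b" "h \<cdot> Zero A a b"] assms b by simp
qed

lemma Zero_Cmp [simp]:
  assumes "f \<in> Arr A" "c \<in> Obj A" "Cod A f = b"
  shows "Zero A b c \<cdot> f = Zero A (Dom A f) c"
proof -
  have b: "b \<in> Obj A" using assms by auto
  have "Zero A b c \<cdot> f \<boxplus> Zero A b c \<cdot> f = Zero A b c \<cdot> f"
    using Add_Cmp_Arr[of f "Zero A b c" "Zero A b c"] assms b by simp
  then show ?thesis
    using Add_eq_self_iff[of "Zero A b c \<cdot> f" "Zero A b c \<cdot> f"] assms b by simp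
qed

lemma Cmp_neg:
  assumes "f \<in> Arr A" "h \<in> Arr A" "Cod A f = Dom A h"
  shows "h \<cdot> neg f = neg (h \<cdot> f)"
proof -
  have "h \<cdot> neg f \<boxplus> h \<cdot> f = neg (h \<cdot> f) \<boxplus> h \<cdot> f"
    using assms Cmp_Add_Arr[of f "neg f" h] neg_Arr(4)[of "h \<cdot> f"]
      Add_commute[of "h \<cdot> f" "h \<cdot> neg f"] Add_commute[of "h \<cdot> f" "neg (h \<cdot> f)"] by simp
  then show ?thesis
    using assms by (subst (asm) Add_right_cancel) auto
qed

lemma neg_Cmp:
  assumes "f \<in> Arr A" "h \<in> Arr A" "Cod A f = Dom A h"
  shows "neg h \<cdot> f = neg (h \<cdot> f)"
proof -
  have "neg h \<cdot> f \<boxplus> h \<cdot> f = neg (h \<cdot> f) \<boxplus> h \<cdot> f"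
    using assms Add_Cmp_Arr[of f h "neg h"] neg_Arr(4)[of "h \<cdot> f"]
      Add_commute[of "h \<cdot> f" "neg h \<cdot> f"] Add_commute[of "h \<cdot> f" "neg (h \<cdot> f)"] by simp
  then show ?thesis
    using assms by (subst (asm) Add_right_cancel) auto
qed

lemma Cmp_diff_eq_Zero_iff:
  assumes "u \<in> Arr A" "f \<in> Arr A" "g \<in> Arr A" "Dom A f = Dom A g" "Cod A f = Cod A g" "Cod A g = Dom A u"
  shows "u \<cdot> (f \<boxplus> neg g) = Zero A (Dom A g) (Cod A u) \<longleftrightarrow> u \<cdot> f = u \<cdot> g"
  using Add_neg_eq_Zero_iff[of "u \<cdot> f" "u \<cdot> g"] assms by (simp add: Cmp_Add_Arr Cmp_neg)

lemma diff_Cmp_eq_Zero_iff: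
  assumes "u \<in> Arr A" "f \<in> Arr A" "g \<in> Arr A" "Dom A f = Dom A g" "Cod A f = Cod A g" "Cod A u = Dom A g"
  shows "(f \<boxplus> neg g) \<cdot> u = Zero A (Dom A u) (Cod A g) \<longleftrightarrow> f \<cdot> u = g \<cdot> u"
  using Add_neg_eq_Zero_iff[of "f \<cdot> u" "g \<cdot> u"] assms by (simp add: Add_Cmp_Arr neg_Cmp)

lemma is_biproductD:
  assumes "is_biproduct A a b x i1 i2 p1 p2"
  shows "x \<in> Obj A" "i1 \<in> Arr A" "Dom A i1 = a" "Cod A i1 = x" "i2 \<in> Arr A" "Dom A i2 = b" "Cod A i2 = x"
    "p1 \<in> Arr A" "Dom A p1 = x" "Cod A p1 = a" "p2 \<in> Arr A" "Dom A p2 = x" "Cod A p2 = b"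
    "p1 \<cdot> i1 = Idn A a" "p2 \<cdot> i2 = Idn A b" "i1 \<cdot> p1 \<boxplus> i2 \<cdot> p2 = Idn A x"
  using assms by (auto simp: is_biproduct_def)

text \<open>
  Composing \<open>i\<^sub>1 p\<^sub>1 + i\<^sub>2 p\<^sub>2 = id\<close> with one injection shows that the summand of the other one
  vanishes, and the corresponding projection recovers the off-diagonal composite from it.
\<close>

lemma biproduct_cross:
  assumes bi: "is_biproduct A a b x i1 i2 p1 p2"
  shows "p1 \<cdot> i2 = Zero A b a" "p2 \<cdot> i1 = Zero A a b"
proof -
  note B = is_biproductD[OF bi]
  have ab: "a \<in> Obj A" "b \<in> Obj A"
    using B by auto
  have "i1 = (i1 \<cdot> p1 \<boxplus> i2 \<cdot> p2) \<cdot> i1"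
    using B by simp
  also have "\<dots> = i1 \<boxplus> i2 \<cdot> (p2 \<cdot> i1)"
    using B(1-15) ab by (subst Add_Cmp_Arr) auto
  finally have "i2 \<cdot> (p2 \<cdot> i1) = Zero A a x"
    using Add_eq_self_iff[of "i2 \<cdot> (p2 \<cdot> i1)" i1] B Add_commute[of "i2 \<cdot> (p2 \<cdot> i1)" i1] by simp
  then have "p2 \<cdot> (i2 \<cdot> (p2 \<cdot> i1)) = Zero A a b"
    using B ab by simp
  moreover have "p2 \<cdot> (i2 \<cdot> (p2 \<cdot> i1)) = (p2 \<cdot> i2) \<cdot> (p2 \<cdot> i1)"
    using B(1-13) by (subst Cmp_assoc_Arr) auto
  ultimately show "p2 \<cdot> i1 = Zero A a b"
    using B by simp
  have "i2 = (i1 \<cdot> p1 \<boxplus> i2 \<cdot> p2) \<cdot> i2"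
    using B by simp
  also have "\<dots> = i1 \<cdot> (p1 \<cdot> i2) \<boxplus> i2"
    using B(1-15) ab by (subst Add_Cmp_Arr) auto
  finally have "i1 \<cdot> (p1 \<cdot> i2) = Zero A b x"
    using Add_eq_self_iff[of "i1 \<cdot> (p1 \<cdot> i2)" i2] B by simp
  then have "p1 \<cdot> (i1 \<cdot> (p1 \<cdot> i2)) = Zero A b a"
    using B ab by simp
  moreover have "p1 \<cdot> (i1 \<cdot> (p1 \<cdot> i2)) = (p1 \<cdot> i1) \<cdot> (p1 \<cdot> i2)"
    using B(1-13) by (subst Cmp_assoc_Arr) auto
  ultimately show "p1 \<cdot> i2 = Zero A b a"
    using B by simp
qed

lemma is_kernelD:
  assumes "is_kernel A f k"
  shows "f \<in> Arr A" "k \<in> Arr A" "Cod A k = Dom A f" "f \<cdot> k = Zero A (Dom A k) (Cod A f)"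
  using assms by (auto simp: is_kernel_def)

lemma kernel_lift:
  assumes "is_kernel A f k" "u \<in> Arr A" "Cod A u = Dom A f" "f \<cdot> u = Zero A (Dom A u) (Cod A f)"
  obtains v where "v \<in> Arr A" "Dom A v = Dom A u" "Cod A v = Dom A k" "k \<cdot> v = u"
proof -
  have "u \<in> Hom A (Dom A u) (Dom A f)"
    using assms by simp
  then have "\<exists>!v. v \<in> Hom A (Dom A u) (Dom A k) \<and> k \<cdot> v = u"
    using assms(1,4) unfolding is_kernel_def by blast
  then show thesis
    using that unfolding Hom_iff by blast
qed

lemma kernel_mono:
  assumes k: "is_kernel A f k" and uv: "u \<in> Arr A" "v \<in> Arr A" "Dom A u = Dom A v" "Cod A u = Dom A k"
    "Cod A v = Dom A k" "k \<cdot> u = k \<cdot> v"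
  shows "u = v"
proof -
  note D = is_kernelD[OF k]
  have "f \<cdot> (k \<cdot> v) = (f \<cdot> k) \<cdot> v"
    using D(1-3) uv by (subst Cmp_assoc_Arr) auto
  also have "\<dots> = Zero A (Dom A v) (Cod A f)"
    using D uv by simp
  finally have "\<exists>!w. w \<in> Hom A (Dom A v) (Dom A k) \<and> k \<cdot> w = k \<cdot> v"
    using k D uv unfolding is_kernel_def by simp
  then show ?thesis
    using uv by (auto elim!: ex1E)
qed

end

context abelian_category
begin

lemma kernel_arr: "f \<in> Arr A \<Longrightarrow> is_kernel A f (kernel_arr A f)"
  unfolding kernel_arr_def by (rule someI_ex[OF kernel_exists])

text \<open>The pullback of \<open>f\<close> and \<open>g\<close> is the kernel of their difference on the biproduct.\<close>

lemma pullback_exists: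
  assumes f: "f \<in> Arr A" and g: "g \<in> Arr A" and fg: "Cod A f = Cod A g"
  shows "\<exists>p q. is_pullback A f g p q"
proof -
  obtain x i1 i2 p1 p2 where bi: "is_biproduct A (Dom A f) (Dom A g) x i1 i2 p1 p2"
    using biproduct_exists f g by (meson Dom_Obj)
  note B = is_biproductD[OF bi] and cr = biproduct_cross[OF bi]
  let ?d = "f \<cdot> p1 \<boxplus> neg (g \<cdot> p2)"
  have d: "?d \<in> Arr A" "Dom A ?d = x" "Cod A ?d = Cod A g"
    using f g fg B by auto
  obtain k where k: "is_kernel A ?d k"
    using kernel_exists d by blast
  note K = is_kernelD(2-4)[OF k]
  have dk: "?d \<cdot> w = Zero A (Dom A w) (Cod A g) \<longleftrightarrow> f \<cdot> (p1 \<cdot> w) = g \<cdot> (p2 \<cdot> w)"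
    if "w \<in> Arr A" "Cod A w = x" for w
    using diff_Cmp_eq_Zero_iff[of w "f \<cdot> p1" "g \<cdot> p2"] that f g fg B by simp
  have "is_pullback A f g (p1 \<cdot> k) (p2 \<cdot> k)"
  proof (rule is_pullbackI)
    show "f \<cdot> (p1 \<cdot> k) = g \<cdot> (p2 \<cdot> k)"
      using dk[of k] K d by simp
    show "\<exists>h \<in> Arr A. Dom A h = Dom A u \<and> Cod A h = Dom A (p1 \<cdot> k) \<and> (p1 \<cdot> k) \<cdot> h = u \<and> (p2 \<cdot> k) \<cdot> h = v"
      if uv: "u \<in> Arr A" "v \<in> Arr A" "Dom A v = Dom A u" "Cod A u = Dom A f" "Cod A v = Dom A g"
        "f \<cdot> u = g \<cdot> v" for u v
    proof -
      let ?w = "i1 \<cdot> u \<boxplus> i2 \<cdot> v"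
      have red: "p1 \<cdot> (i1 \<cdot> u) = (p1 \<cdot> i1) \<cdot> u" "p1 \<cdot> (i2 \<cdot> v) = (p1 \<cdot> i2) \<cdot> v"
        "p2 \<cdot> (i1 \<cdot> u) = (p2 \<cdot> i1) \<cdot> u" "p2 \<cdot> (i2 \<cdot> v) = (p2 \<cdot> i2) \<cdot> v"
        using B(1-13) uv by (subst Cmp_assoc_Arr; simp)+
      have w: "?w \<in> Arr A" "Dom A ?w = Dom A u" "Cod A ?w = x"
        using B uv by auto
      have pw: "p1 \<cdot> ?w = u" "p2 \<cdot> ?w = v"
        using B uv f g cr red by (simp_all add: Cmp_Add_Arr)
      obtain h where h: "h \<in> Arr A" "Dom A h = Dom A u" "Cod A h = Dom A k" "k \<cdot> h = ?w"
        using kernel_lift[OF k, of ?w] w d dk[of ?w] pw uv by metis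
      then show ?thesis
        using B K d pw by (intro bexI[of _ h]) auto
    qed
    show "u = v" if uv: "u \<in> Arr A" "v \<in> Arr A" "Dom A u = Dom A v" "Cod A u = Dom A (p1 \<cdot> k)"
      "Cod A v = Dom A (p1 \<cdot> k)" "(p1 \<cdot> k) \<cdot> u = (p1 \<cdot> k) \<cdot> v" "(p2 \<cdot> k) \<cdot> u = (p2 \<cdot> k) \<cdot> v" for u v
    proof -
      have split: "w = i1 \<cdot> (p1 \<cdot> w) \<boxplus> i2 \<cdot> (p2 \<cdot> w)" if "w \<in> Arr A" "Cod A w = x" for w
      proof -
        have "w = (i1 \<cdot> p1 \<boxplus> i2 \<cdot> p2) \<cdot> w"
          using B that by simp
        also have "\<dots> = i1 \<cdot> (p1 \<cdot> w) \<boxplus> i2 \<cdot> (p2 \<cdot> w)"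
          using B(1-15) that by (subst Add_Cmp_Arr) auto
        finally show ?thesis .
      qed
      have "k \<cdot> u = k \<cdot> v"
        using split[of "k \<cdot> u"] split[of "k \<cdot> v"] uv B K d by simp
      then show ?thesis
        using kernel_mono[OF k] uv B K d by simp
    qed
  qed (use f g fg B K d in auto)
  then show ?thesis
    by blast
qed

text \<open>
  A finite family of parallel pairs can be coequalised one pair at a time, each step being the
  cokernel of a difference.
\<close>

lemma joint_coequalizer_exists:
  assumes "finite S" and c: "c \<in> Obj A" and d: "d \<in> Obj A"
    and fg: "\<And>s. s \<in> S \<Longrightarrow> f s \<in> Hom A c d \<and> g s \<in> Hom A c d"
  shows "\<exists>q \<in> Arr A. Dom A q = d \<and> (\<forall>s \<in> S. q \<cdot> f s = q \<cdot> g s) \<and>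
    (\<forall>y. \<forall>h \<in> Hom A d y. (\<forall>s \<in> S. h \<cdot> f s = h \<cdot> g s) \<longrightarrow> (\<exists>!u. u \<in> Hom A (Cod A q) y \<and> u \<cdot> q = h))"
  using assms(1) fg
proof (induction S rule: finite_induct)
  case empty
  show ?case
    using d by (intro bexI[of _ "Idn A d"]) (auto intro!: ex1I)
next
  case (insert s S)
  then obtain q where q: "q \<in> Arr A" "Dom A q = d" "\<And>s. s \<in> S \<Longrightarrow> q \<cdot> f s = q \<cdot> g s"
    and univ: "\<And>h. h \<in> Arr A \<Longrightarrow> Dom A h = d \<Longrightarrow> (\<And>s. s \<in> S \<Longrightarrow> h \<cdot> f s = h \<cdot> g s) \<Longrightarrow>
      \<exists>!u. u \<in> Hom A (Cod A q) (Cod A h) \<and> u \<cdot> q = h"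
    by (auto simp: Ball_def)
  have fgs: "f r \<in> Arr A" "Dom A (f r) = c" "Cod A (f r) = d" "g r \<in> Arr A" "Dom A (g r) = c" "Cod A (g r) = d"
    if "r \<in> insert s S" for r
    using insert.prems that by auto
  let ?d = "q \<cdot> f s \<boxplus> neg (q \<cdot> g s)"
  have dd: "?d \<in> Arr A" "Dom A ?d = c" "Cod A ?d = Cod A q"
    using q fgs[of s] by auto
  obtain k where k: "is_cokernel A ?d k"
    using cokernel_exists dd by blast
  have K: "k \<in> Arr A" "Dom A k = Cod A q" "k \<cdot> ?d = Zero A c (Cod A k)"
    using k dd by (auto simp: is_cokernel_def)
  have z: "u \<cdot> ?d = Zero A c (Cod A u) \<longleftrightarrow> u \<cdot> (q \<cdot> f s) = u \<cdot> (q \<cdot> g s)"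
    if "u \<in> Arr A" "Dom A u = Cod A q" for u
    using Cmp_diff_eq_Zero_iff[of u "q \<cdot> f s" "q \<cdot> g s"] that q fgs[of s] by simp
  show ?case
  proof (intro bexI[of _ "k \<cdot> q"] conjI ballI allI impI)
    show "(k \<cdot> q) \<cdot> f r = (k \<cdot> q) \<cdot> g r" if "r \<in> insert s S" for r
    proof (cases "r = s")
      case True
      then show ?thesis
        using z[of k] K q fgs[OF that] by simp
    next
      case False
      then show ?thesis
        using q fgs[OF that] K that by simp
    qed
    show "k \<cdot> q \<in> Arr A" "Dom A (k \<cdot> q) = d"
      using K q by auto
  next
    fix y h assume h: "h \<in> Hom A d y" "\<forall>r \<in> insert s S. h \<cdot> f r = h \<cdot> g r"
    have y: "Cod A h = y"
      using h by simp
    have "\<exists>!u. u \<in> Hom A (Cod A q) (Cod A h) \<and> u \<cdot> q = h"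
      by (rule univ) (use h in auto)
    then obtain u where "u \<in> Hom A (Cod A q) y \<and> u \<cdot> q = h"
      and "\<forall>u'. u' \<in> Hom A (Cod A q) y \<and> u' \<cdot> q = h \<longrightarrow> u' = u"
      unfolding y by (rule ex1E)
    then have u: "u \<in> Arr A" "Dom A u = Cod A q" "Cod A u = y" "u \<cdot> q = h"
      and uu: "\<And>u'. u' \<in> Arr A \<Longrightarrow> Dom A u' = Cod A q \<Longrightarrow> Cod A u' = y \<Longrightarrow> u' \<cdot> q = h \<Longrightarrow> u' = u"
      unfolding Hom_iff by blast+
    have "u \<cdot> (q \<cdot> f s) = (u \<cdot> q) \<cdot> f s" "u \<cdot> (q \<cdot> g s) = (u \<cdot> q) \<cdot> g s"
      using u(1-3) q fgs[of s] by (subst Cmp_assoc_Arr; simp)+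
    then have "u \<cdot> ?d = Zero A c y"
      using z[of u] u h by simp
    then have "\<exists>!v. v \<in> Hom A (Cod A k) y \<and> v \<cdot> k = u"
      using k u(1-3) dd unfolding is_cokernel_def by simp
    then obtain v where "v \<in> Hom A (Cod A k) y \<and> v \<cdot> k = u"
      and "\<forall>v'. v' \<in> Hom A (Cod A k) y \<and> v' \<cdot> k = u \<longrightarrow> v' = v"
      by (rule ex1E)
    then have v: "v \<in> Arr A" "Dom A v = Cod A k" "Cod A v = y" "v \<cdot> k = u"
      and vu: "\<And>v'. v' \<in> Arr A \<Longrightarrow> Dom A v' = Cod A k \<Longrightarrow> Cod A v' = y \<Longrightarrow> v' \<cdot> k = u \<Longrightarrow> v' = v"
      unfolding Hom_iff by blast+
    show "\<exists>!w. w \<in> Hom A (Cod A (k \<cdot> q)) y \<and> w \<cdot> (k \<cdot> q) = h"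
    proof (rule ex1I[of _ v])
      have "v \<cdot> (k \<cdot> q) = (v \<cdot> k) \<cdot> q"
        using v(1-3) K q by (subst Cmp_assoc_Arr) auto
      then show "v \<in> Hom A (Cod A (k \<cdot> q)) y \<and> v \<cdot> (k \<cdot> q) = h"
        using v u K q by simp
      fix w assume w: "w \<in> Hom A (Cod A (k \<cdot> q)) y \<and> w \<cdot> (k \<cdot> q) = h"
      then have w': "w \<in> Arr A" "Dom A w = Cod A k" "Cod A w = y" "w \<cdot> (k \<cdot> q) = h"
        using K q by auto
      have "w \<cdot> k = u"
        by (rule uu) (use w' K(1,2) q(1,2) in auto)
      then show "w = v"
        by (rule vu[OF w'(1-3)])
    qed
  qed
qed

end

section \<open>Naturality squares\<close>

text \<open>
  All coherence maps that occur below are built from a few natural ones by composing, tensoring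
  and inverting. A commuting square \<open>\<alpha>' f = g \<alpha>\<close>, packaged with the typing of its sides, is stable
  under these operations, so that naturality and typing of a composite coherence map follow from
  its definition by introduction rules.
\<close>

context category
begin

definition natsq :: "'m \<Rightarrow> 'm \<Rightarrow> 'm \<Rightarrow> 'm \<Rightarrow> bool" where
  "natsq \<alpha> \<alpha>' f g \<longleftrightarrow> \<alpha> \<in> Hom C (Dom C f) (Dom C g) \<and> \<alpha>' \<in> Hom C (Cod C f) (Cod C g) \<and>
     f \<in> Arr C \<and> g \<in> Arr C \<and> \<alpha>' \<cdot> f = g \<cdot> \<alpha>"

lemma natsqD:
  assumes "natsq \<alpha> \<alpha>' f g"
  shows "\<alpha> \<in> Arr C" "Dom C \<alpha> = Dom C f" "Cod C \<alpha> = Dom C g"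
    "\<alpha>' \<in> Arr C" "Dom C \<alpha>' = Cod C f" "Cod C \<alpha>' = Cod C g" "f \<in> Arr C" "g \<in> Arr C" "\<alpha>' \<cdot> f = g \<cdot> \<alpha>"
  using assms by (auto simp: natsq_def)

lemma natsq_Idn: "f \<in> Arr C \<Longrightarrow> Dom C f = a \<Longrightarrow> Cod C f = b \<Longrightarrow> natsq (Idn C a) (Idn C b) f f"
  by (auto simp: natsq_def)

lemma natsq_Cmp:
  assumes "natsq \<beta> \<beta>' g h" "natsq \<alpha> \<alpha>' f g"
  shows "natsq (\<beta> \<cdot> \<alpha>) (\<beta>' \<cdot> \<alpha>') f h"
proof -
  note a = natsqD[OF assms(2)] and b = natsqD[OF assms(1)]
  have "\<beta>' \<cdot> (\<alpha>' \<cdot> f) = \<beta>' \<cdot> (g \<cdot> \<alpha>)"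
    using a by simp
  also have "\<dots> = h \<cdot> (\<beta> \<cdot> \<alpha>)"
    by (rule Cmp_reassoc[OF b(9)]) (use a b in auto)
  finally show ?thesis
    using a b by (auto simp: natsq_def)
qed

lemma natsq_inverse:
  assumes "natsq \<alpha> \<alpha>' f g" "is_iso C \<alpha>" "is_iso C \<alpha>'"
  shows "natsq (inverse_arr C \<alpha>) (inverse_arr C \<alpha>') g f"
proof -
  note a = natsqD[OF assms(1)]
  have "inverse_arr C \<alpha>' \<cdot> g = f \<cdot> inverse_arr C \<alpha>"
    by (rule inverse_arr_natural) (use assms a in auto)
  then show ?thesis
    using a assms by (auto simp: natsq_def)
qed

end

section \<open>Tensor products\<close>

lemma set_replicate_subset [simp]: "x \<in> S \<Longrightarrow> set (replicate n x) \<subseteq> S"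
  by auto

context monoidal_category
begin

lemma TensO_Obj [simp]: "a \<in> Obj A \<Longrightarrow> b \<in> Obj A \<Longrightarrow> a \<odot> b \<in> Obj A"
  by (rule TensO_in)

lemma Unit_Obj [simp]: "Unit A \<in> Obj A"
  by (rule Unit_in)

lemma TensA_Arr [simp]:
  assumes "f \<in> Arr A" "g \<in> Arr A"
  shows "f \<boxtimes> g \<in> Arr A" "Dom A (f \<boxtimes> g) = Dom A f \<odot> Dom A g" "Cod A (f \<boxtimes> g) = Cod A f \<odot> Cod A g"
  using TensA_in[of f "Dom A f" "Cod A f" g "Dom A g" "Cod A g"] assms by auto

declare TensA_Idn [simp]

lemma TensA_Cmp_Arr [simp]:
  assumes "f \<in> Arr A" "g \<in> Arr A" "f' \<in> Arr A" "g' \<in> Arr A" "Cod A f = Dom A g" "Cod A f' = Dom A g'"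
  shows "(g \<boxtimes> g') \<cdot> (f \<boxtimes> f') = (g \<cdot> f) \<boxtimes> (g' \<cdot> f')"
  using assms by (intro TensA_Cmp[symmetric]) auto

lemma natsq_TensA:
  assumes "natsq \<alpha> \<alpha>' f g" "natsq \<beta> \<beta>' h k"
  shows "natsq (\<alpha> \<boxtimes> \<beta>) (\<alpha>' \<boxtimes> \<beta>') (f \<boxtimes> h) (g \<boxtimes> k)"
  using natsqD[OF assms(1)] natsqD[OF assms(2)] by (simp add: natsq_def)

lemma Assoc_Arr [simp]:
  assumes "a \<in> Obj A" "b \<in> Obj A" "c \<in> Obj A"
  shows "Assoc A a b c \<in> Arr A" "Dom A (Assoc A a b c) = (a \<odot> b) \<odot> c" "Cod A (Assoc A a b c) = a \<odot> b \<odot> c"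
    "is_iso A (Assoc A a b c)"
  using Assoc_in[OF assms] Assoc_iso[OF assms] by auto

lemma LUnit_Arr [simp]:
  assumes "a \<in> Obj A"
  shows "LUnit A a \<in> Arr A" "Dom A (LUnit A a) = Unit A \<odot> a" "Cod A (LUnit A a) = a" "is_iso A (LUnit A a)"
  using LUnit_in[OF assms] LUnit_iso[OF assms] by auto

lemma RUnit_Arr [simp]:
  assumes "a \<in> Obj A"
  shows "RUnit A a \<in> Arr A" "Dom A (RUnit A a) = a \<odot> Unit A" "Cod A (RUnit A a) = a" "is_iso A (RUnit A a)"
  using RUnit_in[OF assms] RUnit_iso[OF assms] by auto

lemma natsq_Assoc:
  assumes "f \<in> Arr A" "g \<in> Arr A" "h \<in> Arr A" "Dom A f = a" "Dom A g = b" "Dom A h = c"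
    "Cod A f = a'" "Cod A g = b'" "Cod A h = c'"
  shows "natsq (Assoc A a b c) (Assoc A a' b' c') ((f \<boxtimes> g) \<boxtimes> h) (f \<boxtimes> g \<boxtimes> h)"
  using assms Assoc_natural[of f a a' g b b' h c c'] by (auto simp: natsq_def)

lemma natsq_inverse_Assoc:
  assumes "f \<in> Arr A" "g \<in> Arr A" "h \<in> Arr A" "Dom A f = a" "Dom A g = b" "Dom A h = c"
    "Cod A f = a'" "Cod A g = b'" "Cod A h = c'"
  shows "natsq (inverse_arr A (Assoc A a b c)) (inverse_arr A (Assoc A a' b' c'))
    (f \<boxtimes> g \<boxtimes> h) ((f \<boxtimes> g) \<boxtimes> h)"
  by (rule natsq_inverse[OF natsq_Assoc[OF assms]]) (use assms in auto)

lemma natsq_LUnit: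
  "f \<in> Arr A \<Longrightarrow> Dom A f = a \<Longrightarrow> Cod A f = b \<Longrightarrow> natsq (LUnit A a) (LUnit A b) (Idn A (Unit A) \<boxtimes> f) f"
  using LUnit_natural[of f a b] by (auto simp: natsq_def)

lemma natsq_RUnit:
  "f \<in> Arr A \<Longrightarrow> Dom A f = a \<Longrightarrow> Cod A f = b \<Longrightarrow> natsq (RUnit A a) (RUnit A b) (f \<boxtimes> Idn A (Unit A)) f"
  using RUnit_natural[of f a b] by (auto simp: natsq_def)

lemma image_Dom_Cod_Obj [simp]:
  assumes "set fs \<subseteq> Arr A"
  shows "Dom A ` set fs \<subseteq> Obj A" "Cod A ` set fs \<subseteq> Obj A"
  using assms by auto

lemma tensor_Obj [simp]: "set xs \<subseteq> Obj A \<Longrightarrow> tensor A xs \<in> Obj A"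
  by (induction xs) auto

lemma tensor_arr_Arr [simp]:
  assumes "set fs \<subseteq> Arr A"
  shows "tensor_arr A fs \<in> Arr A"
    "Dom A (tensor_arr A fs) = tensor A (map (Dom A) fs)"
    "Cod A (tensor_arr A fs) = tensor A (map (Cod A) fs)"
  using assms by (induction fs) auto

lemma tensor_arr_Idn [simp]: "set xs \<subseteq> Obj A \<Longrightarrow> tensor_arr A (map (Idn A) xs) = Idn A (tensor A xs)"
  by (induction xs) auto

lemma tensor_arr_replicate_Idn [simp]:
  "x \<in> Obj A \<Longrightarrow> tensor_arr A (replicate n (Idn A x)) = Idn A (tensor A (replicate n x))"
  by (induction n) auto

lemma tensor_arr_Cmp:
  assumes "list_all2 (\<lambda>g f. g \<in> Arr A \<and> f \<in> Arr A \<and> Cod A f = Dom A g) gs fs"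
  shows "tensor_arr A gs \<cdot> tensor_arr A fs = tensor_arr A (map2 (Cmp A) gs fs)"
  using assms
proof (induction rule: list_all2_induct)
  case (Cons g gs f fs)
  have "set gs \<subseteq> Arr A" "set fs \<subseteq> Arr A" "map (Cod A) fs = map (Dom A) gs"
    using Cons(2) by (induction rule: list_all2_induct) auto
  then show ?case
    using Cons by simp
qed simp

lemma tensor_arr_replicate_Cmp:
  "g \<in> Arr A \<Longrightarrow> f \<in> Arr A \<Longrightarrow> Cod A f = Dom A g \<Longrightarrow>
    tensor_arr A (replicate n g) \<cdot> tensor_arr A (replicate n f) = tensor_arr A (replicate n (g \<cdot> f))"
  by (subst tensor_arr_Cmp) (auto simp: list_all2_conv_all_nth zip_replicate)

lemma natsq_tensor_append:
  assumes "set fs \<subseteq> Arr A" "set gs \<subseteq> Arr A" "map (Dom A) fs = xs" "map (Cod A) fs = xs'"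
    "map (Dom A) gs = ys" "map (Cod A) gs = ys'"
  shows "natsq (tensor_append A xs ys) (tensor_append A xs' ys')
    (tensor_arr A fs \<boxtimes> tensor_arr A gs) (tensor_arr A (fs @ gs))"
  using assms
proof (induction fs arbitrary: xs xs')
  case Nil
  then show ?case
    by (auto intro!: natsq_LUnit)
next
  case (Cons f fs)
  let ?d = "map (Dom A) fs" and ?c = "map (Cod A) fs"
  have IH: "natsq (tensor_append A ?d ys) (tensor_append A ?c ys')
      (tensor_arr A fs \<boxtimes> tensor_arr A gs) (tensor_arr A (fs @ gs))"
    using Cons.prems by (intro Cons.IH) auto
  have "natsq ((Idn A (Dom A f) \<boxtimes> tensor_append A ?d ys) \<cdot> Assoc A (Dom A f) (tensor A ?d) (tensor A ys))
      ((Idn A (Cod A f) \<boxtimes> tensor_append A ?c ys') \<cdot> Assoc A (Cod A f) (tensor A ?c) (tensor A ys'))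
      ((f \<boxtimes> tensor_arr A fs) \<boxtimes> tensor_arr A gs) (f \<boxtimes> tensor_arr A (fs @ gs))"
    by (rule natsq_Cmp[OF natsq_TensA[OF natsq_Idn IH] natsq_Assoc]) (use Cons.prems in auto)
  then show ?case
    using Cons.prems by auto
qed

end

context symmetric_monoidal_category
begin

lemma Braid_Arr [simp]:
  assumes "a \<in> Obj A" "b \<in> Obj A"
  shows "Braid A a b \<in> Arr A" "Dom A (Braid A a b) = a \<odot> b" "Cod A (Braid A a b) = b \<odot> a"
  using Braid_in[OF assms] by auto

lemma natsq_Braid:
  "f \<in> Arr A \<Longrightarrow> g \<in> Arr A \<Longrightarrow> Dom A f = a \<Longrightarrow> Dom A g = b \<Longrightarrow> Cod A f = a' \<Longrightarrow> Cod A g = b' \<Longrightarrow>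
    natsq (Braid A a b) (Braid A a' b') (f \<boxtimes> g) (g \<boxtimes> f)"
  using Braid_natural[of f a a' g b b'] by (auto simp: natsq_def)

lemma natsq_swap_front:
  assumes "f \<in> Arr A" "g \<in> Arr A" "h \<in> Arr A" "Dom A f = x" "Dom A g = y" "Dom A h = z"
    "Cod A f = x'" "Cod A g = y'" "Cod A h = z'"
  shows "natsq (swap_front A x y z) (swap_front A x' y' z') (f \<boxtimes> g \<boxtimes> h) (g \<boxtimes> f \<boxtimes> h)"
  unfolding swap_front_def
  by (rule natsq_Cmp[OF natsq_Cmp[OF natsq_Assoc natsq_TensA[OF natsq_Braid natsq_Idn]] natsq_inverse_Assoc])
    (use assms in auto)

lemma natsq_interchange:
  assumes "f \<in> Arr A" "g \<in> Arr A" "h \<in> Arr A" "k \<in> Arr A"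
    "Dom A f = a" "Dom A g = x" "Dom A h = b" "Dom A k = y"
    "Cod A f = a'" "Cod A g = x'" "Cod A h = b'" "Cod A k = y'"
  shows "natsq (interchange A a x b y) (interchange A a' x' b' y')
    ((f \<boxtimes> g) \<boxtimes> h \<boxtimes> k) ((f \<boxtimes> h) \<boxtimes> g \<boxtimes> k)"
  unfolding interchange_def
  by (rule natsq_Cmp[OF natsq_Cmp[OF natsq_inverse_Assoc natsq_TensA[OF natsq_Idn natsq_swap_front]] natsq_Assoc])
    (use assms in auto)

text \<open>
  The \<open>j\<close>-th entry of \<open>zs\<close> is the pair of an arrow between the objects \<open>a\<^sub>j\<close> and of a list of arrows
  between the entries of \<open>xs\<^sub>j\<close>.
\<close>

lemma natsq_unshuffle:
  assumes "\<And>z. z \<in> set zs \<Longrightarrow> fst z \<in> Arr A \<and> set (snd z) \<subseteq> Arr A"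
  shows "natsq (unshuffle A (map (\<lambda>z. (Dom A (fst z), map (Dom A) (snd z))) zs))
     (unshuffle A (map (\<lambda>z. (Cod A (fst z), map (Cod A) (snd z))) zs))
     (tensor_arr A (map (\<lambda>z. fst z \<boxtimes> tensor_arr A (snd z)) zs))
     (tensor_arr A (map fst zs) \<boxtimes> tensor_arr A (concat (map snd zs)))"
  using assms
proof (induction zs)
  case Nil
  have "natsq (inverse_arr A (LUnit A (Unit A))) (inverse_arr A (LUnit A (Unit A)))
     (Idn A (Unit A)) (Idn A (Unit A) \<boxtimes> Idn A (Unit A))"
    by (rule natsq_inverse[OF natsq_LUnit]) auto
  then show ?case
    by simp
next
  case (Cons z zs)
  have IH: "natsq (unshuffle A (map (\<lambda>z. (Dom A (fst z), map (Dom A) (snd z))) zs))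
     (unshuffle A (map (\<lambda>z. (Cod A (fst z), map (Cod A) (snd z))) zs))
     (tensor_arr A (map (\<lambda>z. fst z \<boxtimes> tensor_arr A (snd z)) zs))
     (tensor_arr A (map fst zs) \<boxtimes> tensor_arr A (concat (map snd zs)))"
    using Cons by auto
  have arr: "fst z \<in> Arr A" "set (snd z) \<subseteq> Arr A" "set (map fst zs) \<subseteq> Arr A"
    "set (concat (map snd zs)) \<subseteq> Arr A"
    using Cons.prems by fastforce+
  show ?case
    unfolding list.map unshuffle.simps Let_def concat.simps tensor_arr.simps
    by (rule natsq_Cmp[OF natsq_Cmp[OF natsq_TensA[OF natsq_Idn natsq_tensor_append] natsq_interchange]
          natsq_TensA[OF natsq_Idn IH]])
      (use arr in \<open>simp_all add: map_concat comp_def\<close>)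
qed

lemma map_remove_nth: "map f (remove_nth j xs) = remove_nth j (map f xs)"
  by (simp add: remove_nth_def take_map drop_map)

lemma natsq_pull_front:
  assumes "j < length fs" "set fs \<subseteq> Arr A" "map (Dom A) fs = xs" "map (Cod A) fs = xs'"
  shows "natsq (pull_front A j xs) (pull_front A j xs') (tensor_arr A fs)
    ((fs ! j) \<boxtimes> tensor_arr A (remove_nth j fs))"
  using assms
proof (induction fs arbitrary: j xs xs')
  case (Cons f fs)
  show ?case
  proof (cases j)
    case 0
    then show ?thesis
      using Cons.prems by (auto simp: remove_nth_def intro!: natsq_Idn)
  next
    case (Suc i)
    let ?r = "remove_nth i fs"
    have i: "i < length fs" "fs ! i \<in> Arr A" "set ?r \<subseteq> Arr A" "f \<in> Arr A"
      using Suc Cons.prems by (auto simp: remove_nth_def dest!: in_set_takeD in_set_dropD)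
    have IH: "natsq (pull_front A i (map (Dom A) fs)) (pull_front A i (map (Cod A) fs)) (tensor_arr A fs)
      ((fs ! i) \<boxtimes> tensor_arr A ?r)"
      using Cons i by auto
    have "natsq (swap_front A (Dom A f) (map (Dom A) fs ! i) (tensor A (remove_nth i (map (Dom A) fs)))
        \<cdot> (Idn A (Dom A f) \<boxtimes> pull_front A i (map (Dom A) fs)))
      (swap_front A (Cod A f) (map (Cod A) fs ! i) (tensor A (remove_nth i (map (Cod A) fs)))
        \<cdot> (Idn A (Cod A f) \<boxtimes> pull_front A i (map (Cod A) fs)))
      (f \<boxtimes> tensor_arr A fs) ((fs ! i) \<boxtimes> f \<boxtimes> tensor_arr A ?r)"
      by (rule natsq_Cmp[OF natsq_swap_front natsq_TensA[OF natsq_Idn IH]])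
        (use i in \<open>auto simp: map_remove_nth\<close>)
    then show ?thesis
      using Suc Cons.prems by (auto simp: remove_nth_def)
  qed
qed simp

text \<open>
  By induction on the arrangement \<open>js\<close>: its head is pulled to the front, and its tail, renumbered,
  arranges the remaining factors.
\<close>

lemma natsq_rearrange:
  assumes "distinct js" "\<And>j. j \<in> set js \<Longrightarrow> j < length fs" "length js = length fs"
    "set fs \<subseteq> Arr A" "map (Dom A) fs = xs" "map (Cod A) fs = xs'"
  shows "natsq (rearrange A js xs) (rearrange A js xs') (tensor_arr A fs) (tensor_arr A (map (\<lambda>j. fs ! j) js))"
  using assms
proof (induction "length js" arbitrary: js fs xs xs')
  case 0
  then show ?case
    by (auto intro!: natsq_Idn)
next
  case (Suc n)
  then obtain j ks where js: "js = j # ks"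
    by (cases js) auto
  let ?d = "\<lambda>i. if j < i then i - 1 else i" and ?r = "remove_nth j fs"
  have j: "j < length fs" "j \<notin> set ks" "distinct ks" "\<And>i. i \<in> set ks \<Longrightarrow> i < length fs"
    and len: "Suc (length ks) = length fs"
    using Suc.prems js by auto
  have r: "length ?r = length ks" "set ?r \<subseteq> Arr A" "fs ! j \<in> Arr A"
    using j len Suc.prems by (auto simp: remove_nth_def dest!: in_set_takeD in_set_dropD)
  \<comment> \<open>\<open>?d\<close> renumbers the positions other than \<open>j\<close> once the factor \<open>j\<close> has been removed\<close>
  have nth: "?r ! ?d i = fs ! i" if "i \<in> set ks" for i
  proof (cases "j < i")
    case True
    then show ?thesis
      using j(1) j(4)[OF that] by (cases i) (auto simp: remove_nth_def nth_append min_def)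
  next
    case False
    moreover have "i \<noteq> j"
      using that j by auto
    ultimately show ?thesis
      using j(1) by (simp add: remove_nth_def nth_append min_def)
  qed
  have "inj_on ?d (set ks)"
    using j(2) by (auto simp: inj_on_def split: if_splits) (metis Suc_pred gr_implies_not0 linorder_neqE_nat not_less_eq)+
  then have dist: "distinct (map ?d ks)"
    using j(3) by (simp add: distinct_map)
  have bound: "i < length ?r" if i: "i \<in> set (map ?d ks)" for i
  proof -
    obtain k where k: "k \<in> set ks" "i = ?d k"
      using i unfolding set_map by blast
    have "k < length fs" "k \<noteq> j"
      using k j by auto
    then show ?thesis
      using k(2) j(1) r(1) len by (simp split: if_splits)
  qed
  have IH: "natsq (rearrange A (map ?d ks) (remove_nth j xs)) (rearrange A (map ?d ks) (remove_nth j xs'))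
      (tensor_arr A ?r) (tensor_arr A (map (\<lambda>i. ?r ! i) (map ?d ks)))"
    by (rule Suc.hyps(1)[OF _ dist bound])
      (use Suc.hyps(2) Suc.prems(5,6) js r in \<open>simp_all add: map_remove_nth\<close>)
  have "map (\<lambda>i. ?r ! i) (map ?d ks) = map (\<lambda>i. fs ! i) ks"
    using nth by simp
  note IH = IH[unfolded this]
  have "natsq ((Idn A (xs ! j) \<boxtimes> rearrange A (map ?d ks) (remove_nth j xs)) \<cdot> pull_front A j xs)
     ((Idn A (xs' ! j) \<boxtimes> rearrange A (map ?d ks) (remove_nth j xs')) \<cdot> pull_front A j xs')
     (tensor_arr A fs) (fs ! j \<boxtimes> tensor_arr A (map (\<lambda>i. fs ! i) ks))"
    by (rule natsq_Cmp[OF natsq_TensA[OF natsq_Idn IH] natsq_pull_front])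
      (use j r Suc.prems in \<open>auto\<close>)
  then show ?case
    unfolding js by simp
qed

lemma natsq_perm_tensor:
  assumes \<sigma>: "\<sigma> permutes {..<length fs}" and "set fs \<subseteq> Arr A" "map (Dom A) fs = xs" "map (Cod A) fs = xs'"
  shows "natsq (perm_tensor A \<sigma> xs) (perm_tensor A \<sigma> xs') (tensor_arr A fs) (tensor_arr A (perm_list \<sigma> fs))"
proof -
  let ?js = "perm_list \<sigma> [0..<length fs]"
  have inv: "inv_into UNIV \<sigma> permutes {..<length fs}"
    by (rule permutes_inv[OF \<sigma>])
  have mset: "mset ?js = mset [0..<length fs]"
    unfolding perm_list_def using inv by (intro mset_permute_list) simp
  have "natsq (rearrange A ?js xs) (rearrange A ?js xs') (tensor_arr A fs) (tensor_arr A (map (\<lambda>j. fs ! j) ?js))"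
  proof (rule natsq_rearrange)
    show "distinct ?js"
      using mset by (metis distinct_upt mset_eq_imp_distinct_iff)
    show "length ?js = length fs"
      by (simp add: perm_list_def)
    show "j < length fs" if "j \<in> set ?js" for j
      using that mset by (metis atLeastLessThan_iff atLeastLessThan_upt mset_eq_setD)
  qed (use assms in auto)
  moreover have "map (\<lambda>j. fs ! j) ?js = perm_list \<sigma> fs"
    using permutes_in_image[OF inv] by (auto simp: perm_list_def permute_list_def)
  ultimately show ?thesis
    using assms by (auto simp: perm_tensor_def)
qed

end

section \<open>Additivity of the tensor product\<close>

locale abelian_closed_monoidal_category =
  abelian_category A + closed_symmetric_monoidal_category A
  for A :: "('o, 'm, 'z) monoidal_scheme" (structure)
begin

lemma internal_hom_Arr:
  assumes "x \<in> Obj A" "y \<in> Obj A"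
  obtains h ev where "h \<in> Obj A" "ev \<in> Arr A" "Dom A ev = h \<odot> x" "Cod A ev = y"
    "\<forall>z \<in> Obj A. \<forall>f \<in> Arr A. Dom A f = z \<odot> x \<longrightarrow> Cod A f = y \<longrightarrow>
      (\<exists>g \<in> Arr A. Dom A g = z \<and> Cod A g = h \<and> ev \<cdot> (g \<boxtimes> Idn A x) = f)"
    "\<forall>g \<in> Arr A. \<forall>g' \<in> Arr A. Dom A g = Dom A g' \<longrightarrow> Cod A g = h \<longrightarrow> Cod A g' = h \<longrightarrow>
      ev \<cdot> (g \<boxtimes> Idn A x) = ev \<cdot> (g' \<boxtimes> Idn A x) \<longrightarrow> g = g'"
proof -
  obtain h ev where h: "h \<in> Obj A" "ev \<in> Hom A (h \<odot> x) y"
    and u: "\<forall>z \<in> Obj A. \<forall>f \<in> Hom A (z \<odot> x) y. \<exists>!g. g \<in> Hom A z h \<and> ev \<cdot> (g \<boxtimes> Idn A x) = f"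
    using internal_hom[OF assms] by blast
  show thesis
  proof (rule that[of h ev]; (intro ballI impI)?)
    show "\<exists>g \<in> Arr A. Dom A g = z \<and> Cod A g = h \<and> ev \<cdot> (g \<boxtimes> Idn A x) = f"
      if "z \<in> Obj A" "f \<in> Arr A" "Dom A f = z \<odot> x" "Cod A f = y" for z f
    proof -
      have "f \<in> Hom A (z \<odot> x) y"
        using that by simp
      then show ?thesis
        using u that(1) unfolding Hom_iff[symmetric] by (metis Hom_iff)
    qed
    show "g = g'" if g: "g \<in> Arr A" "g' \<in> Arr A" "Dom A g = Dom A g'" "Cod A g = h" "Cod A g' = h"
      "ev \<cdot> (g \<boxtimes> Idn A x) = ev \<cdot> (g' \<boxtimes> Idn A x)" for g g'
    proof -
      have "ev \<cdot> (g' \<boxtimes> Idn A x) \<in> Hom A (Dom A g' \<odot> x) y" "g \<in> Hom A (Dom A g') h" "g' \<in> Hom A (Dom A g') h"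
        "Dom A g' \<in> Obj A"
        using g h assms by auto
      then show ?thesis
        using u g(6) by blast
    qed
  qed (use h in auto)
qed

text \<open>
  The functor \<open>- \<odot> x\<close> is a left adjoint, so it preserves the zero object and the coproduct
  \<open>a \<oplus> a\<close>, and a functor with these two properties is additive.
\<close>

lemma Zero_TensA_Idn:
  assumes "a \<in> Obj A" "b \<in> Obj A" "x \<in> Obj A"
  shows "Zero A a b \<boxtimes> Idn A x = Zero A (a \<odot> x) (b \<odot> x)"
proof -
  obtain z where z: "zero_object A z"
    using zero_object_exists by blast
  then have zo: "z \<in> Obj A"
    by (simp add: zero_object_def)
  obtain h ev where h: "h \<in> Obj A" "ev \<in> Arr A" "Dom A ev = h \<odot> x" "Cod A ev = z \<odot> x"
    and ex: "\<forall>c \<in> Obj A. \<forall>f \<in> Arr A. Dom A f = c \<odot> x \<longrightarrow> Cod A f = z \<odot> x \<longrightarrow>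
      (\<exists>g \<in> Arr A. Dom A g = c \<and> Cod A g = h \<and> ev \<cdot> (g \<boxtimes> Idn A x) = f)"
    and "\<forall>g \<in> Arr A. \<forall>g' \<in> Arr A. Dom A g = Dom A g' \<longrightarrow> Cod A g = h \<longrightarrow> Cod A g' = h \<longrightarrow>
      ev \<cdot> (g \<boxtimes> Idn A x) = ev \<cdot> (g' \<boxtimes> Idn A x) \<longrightarrow> g = g'"
    by (rule internal_hom_Arr[OF assms(3) TensO_Obj[OF zo assms(3)]])
  have "\<exists>!f. f \<in> Hom A z h"
    using z h by (simp add: zero_object_def)
  then have uniq: "f = g" if "f \<in> Hom A z h" "g \<in> Hom A z h" for f g
    using that by blast
  have "Idn A (z \<odot> x) = Zero A (z \<odot> x) (z \<odot> x)"
  proof -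
    obtain f where "f \<in> Hom A z h" "ev \<cdot> (f \<boxtimes> Idn A x) = Idn A (z \<odot> x)"
      using ex[rule_format, of z "Idn A (z \<odot> x)"] zo assms by auto
    moreover obtain g where "g \<in> Hom A z h" "ev \<cdot> (g \<boxtimes> Idn A x) = Zero A (z \<odot> x) (z \<odot> x)"
      using ex[rule_format, of z "Zero A (z \<odot> x) (z \<odot> x)"] zo assms by auto
    ultimately show ?thesis
      using uniq by metis
  qed
  then have "(Zero A z b \<boxtimes> Idn A x) \<cdot> (Zero A a z \<boxtimes> Idn A x)
      = (Zero A z b \<boxtimes> Idn A x) \<cdot> (Zero A (z \<odot> x) (z \<odot> x) \<cdot> (Zero A a z \<boxtimes> Idn A x))"
    using zo assms by (metis Idn_Cmp_Arr TensA_Arr(1,3) Zero_Arr(1,3) Idn_Arr(1,3))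
  also have "\<dots> = Zero A (a \<odot> x) (b \<odot> x)"
    using zo assms by (simp del: TensA_Cmp_Arr)
  finally show ?thesis
    using zo assms by simp
qed

text \<open>
  Arrows out of \<open>c \<odot> x\<close> correspond to arrows out of \<open>c\<close>, so the coproduct injections remain
  jointly epic after tensoring with \<open>x\<close>.
\<close>

lemma TensA_Idn_joint_epi:
  assumes bi: "is_biproduct A a b c i1 i2 p1 p2" and x: "x \<in> Obj A"
    and uv: "u \<in> Arr A" "v \<in> Arr A" "Dom A u = c \<odot> x" "Dom A v = c \<odot> x" "Cod A u = Cod A v"
    and eq: "u \<cdot> (i1 \<boxtimes> Idn A x) = v \<cdot> (i1 \<boxtimes> Idn A x)" "u \<cdot> (i2 \<boxtimes> Idn A x) = v \<cdot> (i2 \<boxtimes> Idn A x)"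
  shows "u = v"
proof -
  note B = is_biproductD[OF bi]
  obtain h ev where h: "h \<in> Obj A" "ev \<in> Arr A" "Dom A ev = h \<odot> x" "Cod A ev = Cod A v"
    and ex: "\<forall>c \<in> Obj A. \<forall>f \<in> Arr A. Dom A f = c \<odot> x \<longrightarrow> Cod A f = Cod A v \<longrightarrow>
      (\<exists>g \<in> Arr A. Dom A g = c \<and> Cod A g = h \<and> ev \<cdot> (g \<boxtimes> Idn A x) = f)"
    and un: "\<forall>g \<in> Arr A. \<forall>g' \<in> Arr A. Dom A g = Dom A g' \<longrightarrow> Cod A g = h \<longrightarrow> Cod A g' = h \<longrightarrow>
      ev \<cdot> (g \<boxtimes> Idn A x) = ev \<cdot> (g' \<boxtimes> Idn A x) \<longrightarrow> g = g'"
    by (rule internal_hom_Arr[OF x Cod_Obj[OF uv(2)]])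
  obtain u' where u': "u' \<in> Arr A" "Dom A u' = c" "Cod A u' = h" "ev \<cdot> (u' \<boxtimes> Idn A x) = u"
    using ex[rule_format, of c u] uv B(1) by blast
  obtain v' where v': "v' \<in> Arr A" "Dom A v' = c" "Cod A v' = h" "ev \<cdot> (v' \<boxtimes> Idn A x) = v"
    using ex[rule_format, of c v] uv B(1) by blast
  have key: "u' \<cdot> i = v' \<cdot> i" if i: "i \<in> Arr A" "Cod A i = c" "u \<cdot> (i \<boxtimes> Idn A x) = v \<cdot> (i \<boxtimes> Idn A x)" for i
  proof -
    have "(ev \<cdot> (u' \<boxtimes> Idn A x)) \<cdot> (i \<boxtimes> Idn A x) = (ev \<cdot> (v' \<boxtimes> Idn A x)) \<cdot> (i \<boxtimes> Idn A x)"
      using u'(4) v'(4) i(3) by simp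
    then have eq: "ev \<cdot> ((u' \<cdot> i) \<boxtimes> Idn A x) = ev \<cdot> ((v' \<cdot> i) \<boxtimes> Idn A x)"
      using u'(1-3) v'(1-3) i(1,2) h x by simp
    show ?thesis
      by (rule un[rule_format]) (use u'(1-3) v'(1-3) i(1,2) eq in simp_all)
  qed
  have split: "w = w \<cdot> i1 \<cdot> p1 \<boxplus> w \<cdot> i2 \<cdot> p2" if "w \<in> Arr A" "Dom A w = c" for w
  proof -
    have "w = w \<cdot> (i1 \<cdot> p1 \<boxplus> i2 \<cdot> p2)"
      using B that by simp
    also have "\<dots> = w \<cdot> i1 \<cdot> p1 \<boxplus> w \<cdot> i2 \<cdot> p2"
      using B(1-13) that by (subst Cmp_Add_Arr) auto
    finally show ?thesis .
  qed
  have "u' = u' \<cdot> i1 \<cdot> p1 \<boxplus> u' \<cdot> i2 \<cdot> p2"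
    by (rule split[OF u'(1,2)])
  also have "\<dots> = v' \<cdot> i1 \<cdot> p1 \<boxplus> v' \<cdot> i2 \<cdot> p2"
    unfolding key[OF B(2,4) eq(1)] key[OF B(5,7) eq(2)] ..
  also have "\<dots> = v'"
    by (rule split[OF v'(1,2), symmetric])
  finally have "u' = v'" .
  then show ?thesis
    using u' v' by simp
qed

lemma Add_TensA_Idn:
  assumes f: "f \<in> Arr A" and g: "g \<in> Arr A" and fg: "Dom A f = Dom A g" "Cod A f = Cod A g" and x: "x \<in> Obj A"
  shows "(f \<boxplus> g) \<boxtimes> Idn A x = (f \<boxtimes> Idn A x) \<boxplus> (g \<boxtimes> Idn A x)"
proof -
  define a where "a = Dom A g"
  have a: "a \<in> Obj A" "Dom A f = a" "Dom A g = a"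
    using fg g by (auto simp: a_def)
  obtain c i1 i2 p1 p2 where bi: "is_biproduct A a a c i1 i2 p1 p2"
    using biproduct_exists[OF a(1) a(1)] by blast
  note B = is_biproductD[OF bi] and cr = biproduct_cross[OF bi]
  let ?F = "\<lambda>w. w \<boxtimes> Idn A x"
  let ?k = "f \<cdot> p1 \<boxplus> g \<cdot> p2" and ?\<Delta> = "i1 \<boxplus> i2"
  have p: "p1 \<cdot> ?\<Delta> = Idn A a" "p2 \<cdot> ?\<Delta> = Idn A a"
    using B a cr by (simp_all add: Cmp_Add_Arr)
  have ki: "?k \<cdot> i1 = f" "?k \<cdot> i2 = g"
    using B a cr f g fg by (simp_all add: Add_Cmp_Arr)
  have kd: "?k \<cdot> ?\<Delta> = f \<boxplus> g"
    using B(1-13) a f g fg ki by (subst Cmp_Add_Arr) auto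
  \<comment> \<open>the image of a biproduct is a biproduct; then \<open>f + g\<close> factors through the diagonal \<open>?\<Delta>\<close>\<close>
  have id: "?F i1 \<cdot> ?F p1 \<boxplus> ?F i2 \<cdot> ?F p2 = Idn A (c \<odot> x)"
  proof (rule TensA_Idn_joint_epi[OF bi x])
    have "(?F i1 \<cdot> ?F p1 \<boxplus> ?F i2 \<cdot> ?F p2) \<cdot> ?F i1 = (?F i1 \<cdot> ?F p1) \<cdot> ?F i1 \<boxplus> (?F i2 \<cdot> ?F p2) \<cdot> ?F i1"
      using B(1-13) x by (subst Add_Cmp_Arr) auto
    also have "\<dots> = ?F i1"
      using B a cr x Zero_TensA_Idn[OF a(1) B(1) x] by simp
    finally show "(?F i1 \<cdot> ?F p1 \<boxplus> ?F i2 \<cdot> ?F p2) \<cdot> ?F i1 = Idn A (c \<odot> x) \<cdot> ?F i1"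
      using B(1-13) x by simp
    have "(?F i1 \<cdot> ?F p1 \<boxplus> ?F i2 \<cdot> ?F p2) \<cdot> ?F i2 = (?F i1 \<cdot> ?F p1) \<cdot> ?F i2 \<boxplus> (?F i2 \<cdot> ?F p2) \<cdot> ?F i2"
      using B(1-13) x by (subst Add_Cmp_Arr) auto
    also have "\<dots> = ?F i2"
      using B a cr x Zero_TensA_Idn[OF a(1) B(1) x] by simp
    finally show "(?F i1 \<cdot> ?F p1 \<boxplus> ?F i2 \<cdot> ?F p2) \<cdot> ?F i2 = Idn A (c \<odot> x) \<cdot> ?F i2"
      using B(1-13) x by simp
  qed (use B(1-13) x in auto)
  have "?F (f \<boxplus> g) = ?F ?k \<cdot> ?F ?\<Delta>"
    using kd B(1-13) a f g fg x by simp
  also have "?F ?\<Delta> = (?F i1 \<cdot> ?F p1 \<boxplus> ?F i2 \<cdot> ?F p2) \<cdot> ?F ?\<Delta>"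
    unfolding id using B(1-13) x by simp
  also have "\<dots> = ?F i1 \<boxplus> ?F i2"
    using B(1-13) a x p by (subst Add_Cmp_Arr) auto
  also have "?F ?k \<cdot> (?F i1 \<boxplus> ?F i2) = ?F f \<boxplus> ?F g"
    using B(1-13) a f g fg x ki by (subst Cmp_Add_Arr) auto
  finally show ?thesis .
qed

lemma TensA_split: "f \<in> Arr A \<Longrightarrow> g \<in> Arr A \<Longrightarrow>
    f \<boxtimes> g = (f \<boxtimes> Idn A (Cod A g)) \<cdot> (Idn A (Dom A f) \<boxtimes> g)"
  by simp

text \<open>The symmetry carries additivity from the first variable to the second.\<close>

lemma TensA_flip:
  assumes "f \<in> Arr A" "g \<in> Arr A"
  shows "f \<boxtimes> g = Braid A (Cod A g) (Cod A f) \<cdot> ((g \<boxtimes> f) \<cdot> Braid A (Dom A f) (Dom A g))"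
proof -
  have "Braid A (Cod A g) (Cod A f) \<cdot> ((g \<boxtimes> f) \<cdot> Braid A (Dom A f) (Dom A g))
      = Braid A (Cod A g) (Cod A f) \<cdot> (Braid A (Cod A f) (Cod A g) \<cdot> (f \<boxtimes> g))"
    using Braid_natural[of f "Dom A f" "Cod A f" g "Dom A g" "Cod A g"] assms by simp
  also have "\<dots> = (Braid A (Cod A g) (Cod A f) \<cdot> Braid A (Cod A f) (Cod A g)) \<cdot> (f \<boxtimes> g)"
    using assms by (subst Cmp_assoc_Arr) auto
  finally show ?thesis
    using assms by (simp add: Braid_symmetric)
qed

lemma Add_TensA:
  assumes "f \<in> Arr A" "f' \<in> Arr A" "g \<in> Arr A" "Dom A f = Dom A f'" "Cod A f = Cod A f'"
  shows "(f \<boxplus> f') \<boxtimes> g = f \<boxtimes> g \<boxplus> f' \<boxtimes> g"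
proof -
  have "(f \<boxplus> f') \<boxtimes> g
      = ((f \<boxtimes> Idn A (Cod A g)) \<boxplus> (f' \<boxtimes> Idn A (Cod A g))) \<cdot> (Idn A (Dom A f) \<boxtimes> g)"
    using TensA_split[of "f \<boxplus> f'" g] assms Add_TensA_Idn[of f f' "Cod A g"] by (simp del: TensA_Cmp_Arr)
  also have "\<dots> = f \<boxtimes> g \<boxplus> f' \<boxtimes> g"
    using assms by (subst Add_Cmp_Arr) auto
  finally show ?thesis .
qed

lemma Zero_TensA:
  assumes "a \<in> Obj A" "b \<in> Obj A" "g \<in> Arr A"
  shows "Zero A a b \<boxtimes> g = Zero A (a \<odot> Dom A g) (b \<odot> Cod A g)"
proof -
  have "Zero A a b \<boxtimes> g = (Zero A a b \<boxtimes> Idn A (Cod A g)) \<cdot> (Idn A a \<boxtimes> g)"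
    using assms by simp
  also have "\<dots> = Zero A (a \<odot> Dom A g) (b \<odot> Cod A g)"
    using assms Zero_TensA_Idn[of a b "Cod A g"] by (simp del: TensA_Cmp_Arr)
  finally show ?thesis .
qed

lemma TensA_Add:
  assumes "f \<in> Arr A" "g \<in> Arr A" "g' \<in> Arr A" "Dom A g = Dom A g'" "Cod A g = Cod A g'"
  shows "f \<boxtimes> (g \<boxplus> g') = f \<boxtimes> g \<boxplus> f \<boxtimes> g'"
proof -
  let ?b = "Braid A (Cod A g) (Cod A f)" and ?c = "Braid A (Dom A f) (Dom A g)"
  have "f \<boxtimes> (g \<boxplus> g') = ?b \<cdot> ((g \<boxtimes> f \<boxplus> g' \<boxtimes> f) \<cdot> ?c)"
    using TensA_flip[of f "g \<boxplus> g'"] Add_TensA[of g g' f] assms by simp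
  also have "\<dots> = ?b \<cdot> ((g \<boxtimes> f) \<cdot> ?c \<boxplus> (g' \<boxtimes> f) \<cdot> ?c)"
    using assms by (subst Add_Cmp_Arr) auto
  also have "\<dots> = ?b \<cdot> ((g \<boxtimes> f) \<cdot> ?c) \<boxplus> ?b \<cdot> ((g' \<boxtimes> f) \<cdot> ?c)"
    using assms by (subst Cmp_Add_Arr) auto
  also have "\<dots> = f \<boxtimes> g \<boxplus> f \<boxtimes> g'"
    using TensA_flip[of f g] TensA_flip[of f g'] assms by simp
  finally show ?thesis .
qed

lemma TensA_Zero:
  assumes "a \<in> Obj A" "b \<in> Obj A" "f \<in> Arr A"
  shows "f \<boxtimes> Zero A a b = Zero A (Dom A f \<odot> a) (Cod A f \<odot> b)"
  using TensA_flip[of f "Zero A a b"] Zero_TensA[of a b f] assms by simp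

lemma tensor_arr_Add:
  assumes "set us \<subseteq> Arr A" "set vs \<subseteq> Arr A" "f \<in> Arr A" "g \<in> Arr A" "Dom A f = Dom A g" "Cod A f = Cod A g"
  shows "tensor_arr A (us @ (f \<boxplus> g) # vs) = tensor_arr A (us @ f # vs) \<boxplus> tensor_arr A (us @ g # vs)"
  using assms by (induction us) (simp_all add: Add_TensA TensA_Add)

lemma tensor_arr_Zero:
  assumes "set us \<subseteq> Arr A" "set vs \<subseteq> Arr A" "a \<in> Obj A" "b \<in> Obj A"
  shows "tensor_arr A (us @ Zero A a b # vs)
    = Zero A (tensor A (map (Dom A) us @ a # map (Dom A) vs)) (tensor A (map (Cod A) us @ b # map (Cod A) vs))"
  using assms by (induction us) (simp_all add: Zero_TensA TensA_Zero)

end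

section \<open>The Schur functor\<close>

lemma perm_list_replicate [simp]:
  assumes "\<sigma> permutes {..<n}"
  shows "perm_list \<sigma> (replicate n x) = replicate n x"
proof -
  have "inv_into UNIV \<sigma> i < n" if "i < n" for i
    using permutes_in_image[OF permutes_inv[OF assms], of i] that by simp
  then show ?thesis
    by (intro nth_equalityI) (auto simp: perm_list_def permute_list_def)
qed

lemma concat_replicate_sum_list: "concat (map (\<lambda>k. replicate k x) ks) = replicate (sum_list ks) x"
  by (induction ks) (auto simp: replicate_add)

context monoidal_category
begin

lemma natsq_tensor_arr:
  assumes "\<And>k. k \<in> set ks \<Longrightarrow> natsq (\<alpha> k) (\<alpha>' k) (f k) (g k)"
  shows "natsq (tensor_arr A (map \<alpha> ks)) (tensor_arr A (map \<alpha>' ks)) (tensor_arr A (map f ks)) (tensor_arr A (map g ks))"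
  using assms by (induction ks) (auto intro!: natsq_TensA natsq_Idn)

end

text \<open>
  The Schur functor needs two kinds of colimits: coinvariants under finite groups, which exist in
  every abelian category, and coproducts of sequences of objects.
\<close>

locale operadic_category = abelian_closed_monoidal_category A + symmetric_operad A P
  for A :: "('o, 'm, 'z) monoidal_scheme" (structure) and P :: "('o, 'm) operad" +
  assumes sequential_coproducts: "(\<And>n. a n \<in> Obj A) \<Longrightarrow> \<exists>x \<iota>. is_coproduct A a x \<iota>"
begin

declare OObj_in [simp]

lemma OAct_Arr [simp]:
  assumes "\<sigma> permutes {..<n}"
  shows "OAct P n \<sigma> \<in> Arr A" "Dom A (OAct P n \<sigma>) = OObj P n" "Cod A (OAct P n \<sigma>) = OObj P n"
  using OAct_in[OF assms] by auto

lemma OUnit_Arr [simp]: "OUnit P \<in> Arr A" "Dom A (OUnit P) = Unit A" "Cod A (OUnit P) = OObj P 1"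
  using OUnit_in by auto

lemma OCmp_Arr [simp]:
  "OCmp P ks \<in> Arr A" "Dom A (OCmp P ks) = OObj P (length ks) \<odot> tensor A (map (OObj P) ks)"
  "Cod A (OCmp P ks) = OObj P (sum_list ks)"
  using OCmp_in by auto

lemma tensor_map_OObj [simp]: "tensor A (map (OObj P) ks) \<in> Obj A"
  by (rule tensor_Obj) auto

text \<open>The arrow that an \<open>n\<close>-fold power of \<open>f\<close> induces between the domains of \<open>n\<close>-ary operations.\<close>

definition op_power :: "nat \<Rightarrow> 'm \<Rightarrow> 'm" where
  "op_power n f = Idn A (OObj P n) \<boxtimes> tensor_arr A (replicate n f)"

lemma op_power_Arr [simp]:
  assumes "f \<in> Arr A"
  shows "op_power n f \<in> Arr A" "Dom A (op_power n f) = OObj P n \<odot> tensor A (replicate n (Dom A f))"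
    "Cod A (op_power n f) = OObj P n \<odot> tensor A (replicate n (Cod A f))"
  using assms by (simp_all add: op_power_def)

lemma op_power_Cmp:
  "f \<in> Arr A \<Longrightarrow> g \<in> Arr A \<Longrightarrow> Cod A f = Dom A g \<Longrightarrow> op_power n (g \<cdot> f) = op_power n g \<cdot> op_power n f"
  by (simp add: op_power_def tensor_arr_replicate_Cmp)

lemma op_power_Idn [simp]: "x \<in> Obj A \<Longrightarrow> op_power n (Idn A x) = Idn A (OObj P n \<odot> tensor A (replicate n x))"
  by (simp add: op_power_def)

lemma natsq_perm_power:
  assumes "f \<in> Arr A" "\<sigma> permutes {..<n}" "Dom A f = x" "Cod A f = y"
  shows "natsq (perm_tensor A \<sigma> (replicate n x)) (perm_tensor A \<sigma> (replicate n y))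
    (tensor_arr A (replicate n f)) (tensor_arr A (replicate n f))"
  using natsq_perm_tensor[of \<sigma> "replicate n f" "replicate n x" "replicate n y"] assms by simp

lemma perm_power_Arr [simp]:
  assumes "x \<in> Obj A" "\<sigma> permutes {..<n}"
  shows "perm_tensor A \<sigma> (replicate n x) \<in> Arr A"
    "Dom A (perm_tensor A \<sigma> (replicate n x)) = tensor A (replicate n x)"
    "Cod A (perm_tensor A \<sigma> (replicate n x)) = tensor A (replicate n x)"
  using natsqD(1-3)[OF natsq_perm_power[of "Idn A x" \<sigma> n x x]] assms by simp_all

text \<open>An arrow out of \<open>P\<^sub>n \<odot> x\<^sup>n\<close> that descends to the \<open>\<Sigma>\<^sub>n\<close>-coinvariants.\<close>

definition equivariant :: "nat \<Rightarrow> 'o \<Rightarrow> 'm \<Rightarrow> bool" where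
  "equivariant n x f \<longleftrightarrow> (\<forall>\<sigma>. \<sigma> permutes {..<n} \<longrightarrow>
     f \<cdot> (OAct P n \<sigma> \<boxtimes> Idn A (tensor A (replicate n x)))
     = f \<cdot> (Idn A (OObj P n) \<boxtimes> perm_tensor A \<sigma> (replicate n x)))"

text \<open>The coinvariants are the joint coequaliser of the two actions of the finitely many permutations.\<close>

lemma sym_quotient:
  assumes x: "x \<in> Obj A"
  shows "is_sym_quotient A P n x (sym_quotient A P n x)"
proof -
  let ?S = "{\<sigma>. \<sigma> permutes {..<n}}" and ?d = "OObj P n \<odot> tensor A (replicate n x)"
  let ?f = "\<lambda>\<sigma>. OAct P n \<sigma> \<boxtimes> Idn A (tensor A (replicate n x))"
  let ?g = "\<lambda>\<sigma>. Idn A (OObj P n) \<boxtimes> perm_tensor A \<sigma> (replicate n x)"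
  have fin: "finite ?S"
    by (rule finite_permutations) simp
  have hom: "?f \<sigma> \<in> Hom A ?d ?d \<and> ?g \<sigma> \<in> Hom A ?d ?d" if "\<sigma> \<in> ?S" for \<sigma>
    using that x by simp
  have d: "?d \<in> Obj A"
    using x by simp
  from joint_coequalizer_exists[OF fin d d hom]
  obtain q where q: "q \<in> Arr A" "Dom A q = ?d \<and> (\<forall>\<sigma> \<in> ?S. q \<cdot> ?f \<sigma> = q \<cdot> ?g \<sigma>) \<and>
    (\<forall>y. \<forall>h \<in> Hom A ?d y. (\<forall>\<sigma> \<in> ?S. h \<cdot> ?f \<sigma> = h \<cdot> ?g \<sigma>) \<longrightarrow>
      (\<exists>!u. u \<in> Hom A (Cod A q) y \<and> u \<cdot> q = h))"
    by (rule bexE)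
  then have "is_sym_quotient A P n x q"
    unfolding is_sym_quotient_def Ball_def mem_Collect_eq by (elim conjE, intro conjI) assumption+
  then show ?thesis
    unfolding sym_quotient_def by (rule someI)
qed

lemma sym_quotient_Arr [simp]:
  assumes "x \<in> Obj A"
  shows "sym_quotient A P n x \<in> Arr A"
    "Dom A (sym_quotient A P n x) = OObj P n \<odot> tensor A (replicate n x)"
  using sym_quotient[OF assms, of n] by (auto simp: is_sym_quotient_def)

lemma sym_quotient_equivariant: "x \<in> Obj A \<Longrightarrow> equivariant n x (sym_quotient A P n x)"
  using sym_quotient[of x n] by (simp add: is_sym_quotient_def equivariant_def)

lemma sym_quotient_univ:
  assumes "x \<in> Obj A" "f \<in> Arr A" "Dom A f = OObj P n \<odot> tensor A (replicate n x)" "equivariant n x f"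
  shows "\<exists>!h. h \<in> Hom A (Cod A (sym_quotient A P n x)) (Cod A f) \<and> h \<cdot> sym_quotient A P n x = f"
proof -
  have "f \<in> Hom A (OObj P n \<odot> tensor A (replicate n x)) (Cod A f)"
    using assms by simp
  then show ?thesis
    by (rule sym_quotient[OF assms(1), of n, unfolded is_sym_quotient_def,
          THEN conjunct2, THEN conjunct2, THEN conjunct2, rule_format])
      (use assms(4) in \<open>simp add: equivariant_def\<close>)
qed

lemma equivariant_Cmp:
  assumes "equivariant n x f" "f \<in> Arr A" "g \<in> Arr A" "x \<in> Obj A"
    "Dom A f = OObj P n \<odot> tensor A (replicate n x)" "Cod A f = Dom A g"
  shows "equivariant n x (g \<cdot> f)"
  using assms by (simp add: equivariant_def)

lemma sym_quotient_epi:
  assumes x: "x \<in> Obj A" and uv: "u \<in> Arr A" "v \<in> Arr A" "Dom A u = Cod A (sym_quotient A P n x)"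
    "Dom A v = Cod A (sym_quotient A P n x)" "Cod A u = Cod A v"
    and eq: "u \<cdot> sym_quotient A P n x = v \<cdot> sym_quotient A P n x"
  shows "u = v"
proof -
  let ?q = "sym_quotient A P n x"
  have "equivariant n x (v \<cdot> ?q)"
    using sym_quotient_equivariant[OF x] uv x by (intro equivariant_Cmp) auto
  then have "\<exists>!h. h \<in> Hom A (Cod A ?q) (Cod A (v \<cdot> ?q)) \<and> h \<cdot> ?q = v \<cdot> ?q"
    using x uv by (intro sym_quotient_univ) auto
  moreover have "u \<in> Hom A (Cod A ?q) (Cod A (v \<cdot> ?q))" "v \<in> Hom A (Cod A ?q) (Cod A (v \<cdot> ?q))"
    using x uv by auto
  ultimately show ?thesis
    using eq by blast
qed

lemma schur_cocone:
  assumes "x \<in> Obj A"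
  shows "is_coproduct A (\<lambda>n. Cod A (sym_quotient A P n x)) (schur A P x) (snd (schur_cocone A P x))"
proof -
  have "\<exists>y \<iota>. is_coproduct A (\<lambda>n. Cod A (sym_quotient A P n x)) y \<iota>"
    using assms by (intro sequential_coproducts) simp
  then have "\<exists>X. is_coproduct A (\<lambda>n. Cod A (sym_quotient A P n x)) (fst X) (snd X)"
    by simp
  then show ?thesis
    unfolding schur_def schur_cocone_def by (rule someI_ex)
qed

lemma schur_Obj [simp]: "x \<in> Obj A \<Longrightarrow> schur A P x \<in> Obj A"
  using schur_cocone[of x] by (simp add: is_coproduct_def)

lemma schur_cocone_Arr:
  assumes "x \<in> Obj A"
  shows "snd (schur_cocone A P x) n \<in> Arr A"
    "Dom A (snd (schur_cocone A P x) n) = Cod A (sym_quotient A P n x)"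
    "Cod A (snd (schur_cocone A P x) n) = schur A P x"
  using schur_cocone[OF assms] by (auto simp: is_coproduct_def)

lemma schur_in_Arr [simp]:
  assumes "x \<in> Obj A"
  shows "schur_in A P n x \<in> Arr A" "Dom A (schur_in A P n x) = OObj P n \<odot> tensor A (replicate n x)"
    "Cod A (schur_in A P n x) = schur A P x"
  using assms schur_cocone_Arr[OF assms] by (auto simp: schur_in_def)

lemma schur_in_equivariant: "x \<in> Obj A \<Longrightarrow> equivariant n x (schur_in A P n x)"
  unfolding schur_in_def using schur_cocone_Arr[of x n]
  by (intro equivariant_Cmp sym_quotient_equivariant) auto

lemma schur_cocone_univ:
  assumes "x \<in> Obj A" "y \<in> Obj A"
    and "\<And>n. f n \<in> Hom A (Cod A (sym_quotient A P n x)) y"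
  shows "\<exists>!h. h \<in> Hom A (schur A P x) y \<and> (\<forall>n. h \<cdot> snd (schur_cocone A P x) n = f n)"
  by (rule schur_cocone[OF assms(1), unfolded is_coproduct_def, THEN conjunct2, THEN conjunct2, rule_format, OF assms(2,3)])

lemma schur_ext:
  assumes x: "x \<in> Obj A" and uv: "u \<in> Arr A" "v \<in> Arr A" "Dom A u = schur A P x" "Dom A v = schur A P x"
    "Cod A u = Cod A v" and eq: "\<And>n. u \<cdot> schur_in A P n x = v \<cdot> schur_in A P n x"
  shows "u = v"
proof -
  let ?i = "snd (schur_cocone A P x)"
  note I = schur_cocone_Arr[OF x]
  have i: "u \<cdot> ?i n = v \<cdot> ?i n" for n
    by (rule sym_quotient_epi[OF x, of _ _ n]) (use uv I x eq[of n] in \<open>auto simp: schur_in_def\<close>)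
  have "\<exists>!h. h \<in> Hom A (schur A P x) (Cod A v) \<and> (\<forall>n. h \<cdot> ?i n = v \<cdot> ?i n)"
    by (rule schur_cocone_univ) (use x uv I in auto)
  moreover have "u \<in> Hom A (schur A P x) (Cod A v)" "v \<in> Hom A (schur A P x) (Cod A v)"
    using uv by auto
  ultimately show ?thesis
    using i by blast
qed

lemma schur_desc:
  assumes x: "x \<in> Obj A" and y: "y \<in> Obj A"
    and F: "\<And>n. F n \<in> Arr A" "\<And>n. Dom A (F n) = OObj P n \<odot> tensor A (replicate n x)" "\<And>n. Cod A (F n) = y"
    and eq: "\<And>n. equivariant n x (F n)"
  obtains h where "h \<in> Arr A" "Dom A h = schur A P x" "Cod A h = y" "\<And>n. h \<cdot> schur_in A P n x = F n"
proof -
  let ?q = "\<lambda>n. sym_quotient A P n x" and ?i = "snd (schur_cocone A P x)"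
  note I = schur_cocone_Arr[OF x]
  have "\<exists>g. g \<in> Hom A (Cod A (?q n)) y \<and> g \<cdot> ?q n = F n" for n
    using sym_quotient_univ[OF x F(1) F(2) eq, of n] F(3)[of n] by (auto elim: ex1E)
  then obtain g where g: "\<And>n. g n \<in> Hom A (Cod A (?q n)) y" "\<And>n. g n \<cdot> ?q n = F n"
    by metis
  obtain h where h: "h \<in> Hom A (schur A P x) y" "\<And>n. h \<cdot> ?i n = g n"
    using schur_cocone_univ[OF x y g(1)] by blast
  have "h \<cdot> schur_in A P n x = F n" for n
  proof -
    have "h \<cdot> schur_in A P n x = (h \<cdot> ?i n) \<cdot> ?q n"
      unfolding schur_in_def by (rule Cmp_assoc_Arr[symmetric]) (use h(1) I x in auto)
    then show ?thesis
      using h(2) g(2) by simp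
  qed
  then show ?thesis
    using h(1) by (intro that[of h]) auto
qed

lemma schur_map:
  assumes f: "f \<in> Arr A"
  shows "schur_map A P f \<in> Arr A" "Dom A (schur_map A P f) = schur A P (Dom A f)"
    "Cod A (schur_map A P f) = schur A P (Cod A f)"
    "schur_map A P f \<cdot> schur_in A P n (Dom A f) = schur_in A P n (Cod A f) \<cdot> op_power n f"
proof -
  let ?x = "Dom A f" and ?y = "Cod A f"
  let ?F = "\<lambda>n. schur_in A P n ?y \<cdot> op_power n f"
  have xy: "?x \<in> Obj A" "?y \<in> Obj A"
    using f by auto
  have "equivariant n ?x (?F n)" for n
    unfolding equivariant_def
  proof (intro allI impI)
    fix \<sigma> assume \<sigma>: "\<sigma> permutes {..<n}"
    let ?t = "tensor_arr A (replicate n f)"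
    let ?s = "\<lambda>x. perm_tensor A \<sigma> (replicate n x)"
    have nat: "?s ?y \<cdot> ?t = ?t \<cdot> ?s ?x"
      by (rule natsqD(9)[OF natsq_perm_power]) (use f \<sigma> in auto)
    have inv: "schur_in A P n ?y \<cdot> (OAct P n \<sigma> \<boxtimes> Idn A (tensor A (replicate n ?y)))
        = schur_in A P n ?y \<cdot> (Idn A (OObj P n) \<boxtimes> ?s ?y)"
      using schur_in_equivariant[OF xy(2), of n] \<sigma> by (simp add: equivariant_def)
    have "?F n \<cdot> (OAct P n \<sigma> \<boxtimes> Idn A (tensor A (replicate n ?x)))
        = schur_in A P n ?y \<cdot> ((OAct P n \<sigma> \<boxtimes> Idn A (tensor A (replicate n ?y))) \<cdot> op_power n f)"
      using f \<sigma> xy by (simp add: op_power_def)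
    also have "\<dots> = schur_in A P n ?y \<cdot> ((Idn A (OObj P n) \<boxtimes> ?s ?y) \<cdot> op_power n f)"
      by (rule Cmp_reassoc[OF inv]) (use f \<sigma> xy in auto)
    also have "\<dots> = ?F n \<cdot> (Idn A (OObj P n) \<boxtimes> ?s ?x)"
      using f \<sigma> xy nat by (simp add: op_power_def)
    finally show "?F n \<cdot> (OAct P n \<sigma> \<boxtimes> Idn A (tensor A (replicate n ?x))) = ?F n \<cdot> (Idn A (OObj P n) \<boxtimes> ?s ?x)" .
  qed
  then obtain g where g: "g \<in> Arr A" "Dom A g = schur A P ?x" "Cod A g = schur A P ?y"
    "\<And>n. g \<cdot> schur_in A P n ?x = ?F n"
    using xy f by (elim schur_desc[OF xy(1) schur_Obj[OF xy(2)], of ?F, rotated 3]) auto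
  let ?Q = "\<lambda>g. g \<in> Hom A (schur A P ?x) (schur A P ?y) \<and>
    (\<forall>n. g \<cdot> schur_in A P n ?x
      = schur_in A P n ?y \<cdot> (Idn A (OObj P n) \<boxtimes> tensor_arr A (replicate n f)))"
  have "?Q g"
    using g by (simp add: op_power_def)
  moreover have "h = g" if "?Q h" for h
    by (rule schur_ext[OF xy(1)]) (use that g in \<open>auto simp: op_power_def\<close>)
  ultimately have "?Q (schur_map A P f)"
    unfolding schur_map_def by (rule theI)
  then show "schur_map A P f \<in> Arr A" "Dom A (schur_map A P f) = schur A P (Dom A f)"
    "Cod A (schur_map A P f) = schur A P (Cod A f)"
    "schur_map A P f \<cdot> schur_in A P n (Dom A f) = schur_in A P n (Cod A f) \<cdot> op_power n f"
    by (simp_all add: op_power_def)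
qed

lemmas schur_map_Arr [simp] = schur_map(1-3)

section \<open>Algebras over an operad\<close>

lemma alg_component_Arr [simp]:
  assumes "fst X \<in> Obj A" "snd X \<in> Arr A" "Dom A (snd X) = schur A P (fst X)" "Cod A (snd X) = fst X"
  shows "alg_component A P X n \<in> Arr A"
    "Dom A (alg_component A P X n) = OObj P n \<odot> tensor A (replicate n (fst X))"
    "Cod A (alg_component A P X n) = fst X"
  using assms by (auto simp: alg_component_def)

lemma is_algebraD:
  assumes "is_algebra A P X"
  shows "fst X \<in> Obj A" "snd X \<in> Arr A" "Dom A (snd X) = schur A P (fst X)" "Cod A (snd X) = fst X"
  using assms by (auto simp: is_algebra_def)

text \<open>
  Because an arrow out of \<open>P(E)\<close> is determined by its components, an arrow is compatible with two
  structure maps as soon as it is compatible with all their components.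
\<close>

lemma structure_arr_iff:
  assumes X: "fst X \<in> Obj A" "snd X \<in> Arr A" "Dom A (snd X) = schur A P (fst X)" "Cod A (snd X) = fst X"
    and Y: "fst Y \<in> Obj A" "snd Y \<in> Arr A" "Dom A (snd Y) = schur A P (fst Y)" "Cod A (snd Y) = fst Y"
    and f: "f \<in> Arr A" "Dom A f = fst X" "Cod A f = fst Y"
  shows "f \<cdot> snd X = snd Y \<cdot> schur_map A P f
    \<longleftrightarrow> (\<forall>n. f \<cdot> alg_component A P X n = alg_component A P Y n \<cdot> op_power n f)" (is "?L \<longleftrightarrow> ?R")
proof -
  have l: "(f \<cdot> snd X) \<cdot> schur_in A P n (fst X) = f \<cdot> alg_component A P X n" for n
    using X f by (simp add: alg_component_def)
  have r: "(snd Y \<cdot> schur_map A P f) \<cdot> schur_in A P n (fst X) = alg_component A P Y n \<cdot> op_power n f" for n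
    using X Y f schur_map(4)[OF f(1), of n] by (simp add: alg_component_def)
  show ?thesis
  proof
    assume ?L
    then show ?R
      using l r by simp
  next
    assume R: ?R
    show ?L
      by (rule schur_ext[OF X(1)]) (use X Y f l r R in auto)
  qed
qed

lemma is_algebra_arr_iff:
  "is_algebra_arr A P X f Y \<longleftrightarrow> is_algebra A P X \<and> is_algebra A P Y \<and>
     f \<in> Arr A \<and> Dom A f = fst X \<and> Cod A f = fst Y \<and>
     (\<forall>n. f \<cdot> alg_component A P X n = alg_component A P Y n \<cdot> op_power n f)"
  using structure_arr_iff[of X Y f] is_algebraD[of X] is_algebraD[of Y]
  by (auto simp: is_algebra_arr_def)

lemma is_algebra_arr_algebras: "is_algebra_arr A P X f Y \<Longrightarrow> is_algebra A P X \<and> is_algebra A P Y"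
  by (simp add: is_algebra_arr_def)

lemma is_algebra_arr_Idn: "is_algebra A P X \<Longrightarrow> is_algebra_arr A P X (Idn A (fst X)) X"
  using is_algebraD[of X] by (simp add: is_algebra_arr_iff)

lemma is_algebra_arr_Cmp:
  assumes "is_algebra_arr A P X f Y" "is_algebra_arr A P Y g Z"
  shows "is_algebra_arr A P X (g \<cdot> f) Z"
proof -
  have f: "f \<in> Arr A" "Dom A f = fst X" "Cod A f = fst Y" "\<And>n. f \<cdot> alg_component A P X n = alg_component A P Y n \<cdot> op_power n f"
    and g: "g \<in> Arr A" "Dom A g = fst Y" "Cod A g = fst Z" "\<And>n. g \<cdot> alg_component A P Y n = alg_component A P Z n \<cdot> op_power n g"
    and alg: "is_algebra A P X" "is_algebra A P Y" "is_algebra A P Z"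
    using assms by (auto simp: is_algebra_arr_iff)
  note D = is_algebraD[OF alg(1)] is_algebraD[OF alg(2)] is_algebraD[OF alg(3)]
  have "(g \<cdot> f) \<cdot> alg_component A P X n = alg_component A P Z n \<cdot> op_power n (g \<cdot> f)" for n
  proof -
    have "(g \<cdot> f) \<cdot> alg_component A P X n = g \<cdot> (alg_component A P Y n \<cdot> op_power n f)"
      using f g D by simp
    also have "\<dots> = alg_component A P Z n \<cdot> (op_power n g \<cdot> op_power n f)"
      by (rule Cmp_reassoc[OF g(4)]) (use f g D in auto)
    finally show ?thesis
      using f g by (simp add: op_power_Cmp)
  qed
  then show ?thesis
    using f g alg by (simp add: is_algebra_arr_iff)
qed

lemma algebras_simps [simp]:
  "Obj (algebras A P) = {X. is_algebra A P X}"
  "Arr (algebras A P) = {(X, f, Y). is_algebra_arr A P X f Y}"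
  "Dom (algebras A P) F = fst F" "Cod (algebras A P) F = snd (snd F)"
  "Idn (algebras A P) X = (X, Idn A (fst X), X)"
  "G \<cdot>\<^bsub>algebras A P\<^esub> F = (fst F, fst (snd G) \<cdot> fst (snd F), snd (snd G))"
  by (simp_all add: algebras_def)

lemma category_algebras: "category (algebras A P)"
proof
  fix f g h a b c d
  assume f: "f \<in> Hom (algebras A P) a b"
  then have f': "is_algebra_arr A P a (fst (snd f)) b"
    by auto
  then have ff: "fst (snd f) \<in> Arr A" "Dom A (fst (snd f)) = fst a" "Cod A (fst (snd f)) = fst b"
    by (auto simp: is_algebra_arr_iff)
  show "f \<cdot>\<^bsub>algebras A P\<^esub> Idn (algebras A P) a = f"
    using f ff by auto
  show "Idn (algebras A P) b \<cdot>\<^bsub>algebras A P\<^esub> f = f"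
    using f ff by auto
  assume g: "g \<in> Hom (algebras A P) b c"
  then have g': "is_algebra_arr A P b (fst (snd g)) c"
    by auto
  then have gg: "fst (snd g) \<in> Arr A" "Dom A (fst (snd g)) = fst b" "Cod A (fst (snd g)) = fst c"
    by (auto simp: is_algebra_arr_iff)
  show "g \<cdot>\<^bsub>algebras A P\<^esub> f \<in> Hom (algebras A P) a c"
    using f g is_algebra_arr_Cmp[OF f' g'] by auto
  assume h: "h \<in> Hom (algebras A P) c d"
  then have hh: "fst (snd h) \<in> Arr A" "Dom A (fst (snd h)) = fst c" "Cod A (fst (snd h)) = fst d"
    by (auto simp: is_algebra_arr_iff)
  show "h \<cdot>\<^bsub>algebras A P\<^esub> (g \<cdot>\<^bsub>algebras A P\<^esub> f) = h \<cdot>\<^bsub>algebras A P\<^esub> g \<cdot>\<^bsub>algebras A P\<^esub> f"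
    using ff gg hh by simp
qed (auto simp: is_algebra_arr_Idn dest: is_algebra_arr_algebras)

text \<open>
  The associativity law equates the nested application \<open>\<mu>\<^sub>n (\<mu>\<^sub>k, \<dots>, \<mu>\<^sub>l)\<close> of operations with
  the application of their composite in the operad.
\<close>

abbreviation "unit_action X \<equiv>
  alg_component A P X 1 \<cdot> (OUnit P \<boxtimes> tensor_arr A [Idn A (fst X)])"

abbreviation "unit_iso X \<equiv> RUnit A (fst X) \<cdot> LUnit A (fst X \<odot> Unit A)"

abbreviation "nested_operation X ks \<equiv>
  alg_component A P X (length ks)
    \<cdot> (Idn A (OObj P (length ks)) \<boxtimes> tensor_arr A (map (alg_component A P X) ks))"

abbreviation "composed_operation X ks \<equiv>
  alg_component A P X (sum_list ks)
    \<cdot> (OCmp P ks \<boxtimes> Idn A (tensor A (replicate (sum_list ks) (fst X))))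
    \<cdot> inverse_arr A (Assoc A (OObj P (length ks)) (tensor A (map (OObj P) ks))
        (tensor A (replicate (sum_list ks) (fst X))))
    \<cdot> (Idn A (OObj P (length ks)) \<boxtimes> unshuffle A (map (\<lambda>k. (OObj P k, replicate k (fst X))) ks))"

text \<open>
  Both sides of each algebra law are natural in every arrow that is compatible with the structure
  maps. Hence a structure map satisfies the laws as soon as there is a jointly monic pair of
  compatible arrows to algebras.
\<close>

lemma unit_law_natural:
  assumes X: "fst X \<in> Obj A" and Y: "fst Y \<in> Obj A"
    and f: "natsq (alg_component A P X 1) (alg_component A P Y 1) (op_power 1 f) f" "Dom A f = fst X" "Cod A f = fst Y"
  shows "natsq (unit_action X) (unit_action Y)
      (Idn A (Unit A) \<boxtimes> f \<boxtimes> Idn A (Unit A)) f"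
    "natsq (unit_iso X) (unit_iso Y)
      (Idn A (Unit A) \<boxtimes> f \<boxtimes> Idn A (Unit A)) f"
proof -
  have fa: "f \<in> Arr A"
    using f(1) by (rule natsqD(8))
  have "natsq (OUnit P) (OUnit P) (Idn A (Unit A)) (Idn A (OObj P 1))"
    using natsq_def by auto
  then have u: "natsq (OUnit P \<boxtimes> tensor_arr A [Idn A (fst X)]) (OUnit P \<boxtimes> tensor_arr A [Idn A (fst Y)])
      (Idn A (Unit A) \<boxtimes> f \<boxtimes> Idn A (Unit A)) (op_power 1 f)"
    unfolding op_power_def tensor_arr.simps One_nat_def replicate_Suc replicate_0
    by (intro natsq_TensA natsq_Idn) (use f fa in auto)
  show "natsq (unit_action X) (unit_action Y)
      (Idn A (Unit A) \<boxtimes> f \<boxtimes> Idn A (Unit A)) f"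
    by (rule natsq_Cmp[OF f(1) u])
  show "natsq (unit_iso X) (unit_iso Y)
      (Idn A (Unit A) \<boxtimes> f \<boxtimes> Idn A (Unit A)) f"
    by (rule natsq_Cmp[OF natsq_RUnit natsq_LUnit]) (use f fa in auto)
qed

lemma assoc_law_natural:
  assumes X: "fst X \<in> Obj A" and Y: "fst Y \<in> Obj A"
    and f: "\<And>n. natsq (alg_component A P X n) (alg_component A P Y n) (op_power n f) f" "Dom A f = fst X" "Cod A f = fst Y"
  shows "natsq (nested_operation X ks) (nested_operation Y ks)
      (Idn A (OObj P (length ks)) \<boxtimes> tensor_arr A (map (\<lambda>k. op_power k f) ks)) f"
    "natsq (composed_operation X ks) (composed_operation Y ks)
      (Idn A (OObj P (length ks)) \<boxtimes> tensor_arr A (map (\<lambda>k. op_power k f) ks)) f"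
proof -
  let ?n = "length ks" and ?s = "sum_list ks"
  let ?I = "Idn A (OObj P (length ks))" and ?T = "tensor_arr A (replicate (sum_list ks) f)"
  have fa: "f \<in> Arr A"
    using f(1) by (rule natsqD(8))
  have "natsq (?I \<boxtimes> tensor_arr A (map (alg_component A P X) ks)) (?I \<boxtimes> tensor_arr A (map (alg_component A P Y) ks))
      (?I \<boxtimes> tensor_arr A (map (\<lambda>k. op_power k f) ks)) (?I \<boxtimes> tensor_arr A (map (\<lambda>k. f) ks))"
    by (intro natsq_TensA natsq_Idn natsq_tensor_arr f) auto
  then have "natsq (?I \<boxtimes> tensor_arr A (map (alg_component A P X) ks)) (?I \<boxtimes> tensor_arr A (map (alg_component A P Y) ks))
      (?I \<boxtimes> tensor_arr A (map (\<lambda>k. op_power k f) ks)) (op_power ?n f)"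
    by (simp add: op_power_def map_replicate_const)
  from natsq_Cmp[OF f(1) this]
  show "natsq (nested_operation X ks) (nested_operation Y ks)
      (?I \<boxtimes> tensor_arr A (map (\<lambda>k. op_power k f) ks)) f" .
  let ?zs = "map (\<lambda>k. (Idn A (OObj P k), replicate k f)) ks"
  have "natsq (unshuffle A (map (\<lambda>k. (OObj P k, replicate k (fst X))) ks))
      (unshuffle A (map (\<lambda>k. (OObj P k, replicate k (fst Y))) ks))
      (tensor_arr A (map (\<lambda>k. op_power k f) ks)) (Idn A (tensor A (map (OObj P) ks)) \<boxtimes> ?T)"
  proof -
    have "tensor_arr A (map (\<lambda>k. Idn A (OObj P k)) ks) = Idn A (tensor A (map (OObj P) ks))"
      using tensor_arr_Idn[of "map (OObj P) ks"] by (simp add: comp_def image_subset_iff)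
    moreover have "natsq (unshuffle A (map (\<lambda>z. (Dom A (fst z), map (Dom A) (snd z))) ?zs))
      (unshuffle A (map (\<lambda>z. (Cod A (fst z), map (Cod A) (snd z))) ?zs))
      (tensor_arr A (map (\<lambda>z. fst z \<boxtimes> tensor_arr A (snd z)) ?zs))
      (tensor_arr A (map fst ?zs) \<boxtimes> tensor_arr A (concat (map snd ?zs)))"
      by (rule natsq_unshuffle) (use fa in auto)
    ultimately show ?thesis
      using fa f(2,3) by (simp add: comp_def op_power_def concat_replicate_sum_list)
  qed
  then have 1: "natsq (?I \<boxtimes> unshuffle A (map (\<lambda>k. (OObj P k, replicate k (fst X))) ks))
      (?I \<boxtimes> unshuffle A (map (\<lambda>k. (OObj P k, replicate k (fst Y))) ks))
      (?I \<boxtimes> tensor_arr A (map (\<lambda>k. op_power k f) ks)) (?I \<boxtimes> Idn A (tensor A (map (OObj P) ks)) \<boxtimes> ?T)"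
    by (intro natsq_TensA natsq_Idn) auto
  have 2: "natsq (inverse_arr A (Assoc A (OObj P ?n) (tensor A (map (OObj P) ks)) (tensor A (replicate ?s (fst X)))))
      (inverse_arr A (Assoc A (OObj P ?n) (tensor A (map (OObj P) ks)) (tensor A (replicate ?s (fst Y)))))
      (?I \<boxtimes> Idn A (tensor A (map (OObj P) ks)) \<boxtimes> ?T) ((?I \<boxtimes> Idn A (tensor A (map (OObj P) ks))) \<boxtimes> ?T)"
    by (rule natsq_inverse_Assoc) (use fa f(2,3) in auto)
  have "natsq (OCmp P ks) (OCmp P ks) (?I \<boxtimes> Idn A (tensor A (map (OObj P) ks))) (Idn A (OObj P ?s))"
    by (simp add: natsq_def)
  then have 3: "natsq (OCmp P ks \<boxtimes> Idn A (tensor A (replicate ?s (fst X))))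
      (OCmp P ks \<boxtimes> Idn A (tensor A (replicate ?s (fst Y))))
      ((?I \<boxtimes> Idn A (tensor A (map (OObj P) ks))) \<boxtimes> ?T) (op_power ?s f)"
    unfolding op_power_def by (intro natsq_TensA natsq_Idn) (use fa f(2,3) in auto)
  show "natsq (composed_operation X ks) (composed_operation Y ks)
      (Idn A (OObj P (length ks)) \<boxtimes> tensor_arr A (map (\<lambda>k. op_power k f) ks)) f"
    by (rule natsq_Cmp[OF natsq_Cmp[OF natsq_Cmp[OF f(1) 3] 2] 1])
qed

lemma is_algebra_joint_mono:
  assumes X: "fst X \<in> Obj A" "snd X \<in> Arr A" "Dom A (snd X) = schur A P (fst X)" "Cod A (snd X) = fst X"
    and Y: "is_algebra A P Y" and Z: "is_algebra A P Z"
    and f: "f \<in> Arr A" "Dom A f = fst X" "Cod A f = fst Y" "f \<cdot> snd X = snd Y \<cdot> schur_map A P f"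
    and g: "g \<in> Arr A" "Dom A g = fst X" "Cod A g = fst Z" "g \<cdot> snd X = snd Z \<cdot> schur_map A P g"
    and mono: "\<And>u v. u \<in> Arr A \<Longrightarrow> v \<in> Arr A \<Longrightarrow> Dom A u = Dom A v \<Longrightarrow> Cod A u = fst X \<Longrightarrow>
      Cod A v = fst X \<Longrightarrow> f \<cdot> u = f \<cdot> v \<Longrightarrow> g \<cdot> u = g \<cdot> v \<Longrightarrow> u = v"
  shows "is_algebra A P X"
proof -
  note D = is_algebraD[OF Y] and E = is_algebraD[OF Z]
  have nf: "natsq (alg_component A P X n) (alg_component A P Y n) (op_power n f) f" for n
    using structure_arr_iff[OF X D f(1-3)] f X D by (simp add: natsq_def)
  have ng: "natsq (alg_component A P X n) (alg_component A P Z n) (op_power n g) g" for n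
    using structure_arr_iff[OF X E g(1-3)] g X E by (simp add: natsq_def)
  have eq: "\<alpha> = \<beta>"
    if "natsq \<alpha> \<alpha>' h f" "natsq \<beta> \<alpha>' h f" "natsq \<alpha> \<alpha>'' k g" "natsq \<beta> \<alpha>'' k g" for \<alpha> \<beta> \<alpha>' \<alpha>'' h k
  proof (rule mono)
    show "f \<cdot> \<alpha> = f \<cdot> \<beta>" "g \<cdot> \<alpha> = g \<cdot> \<beta>"
      using natsqD(9)[OF that(1)] natsqD(9)[OF that(2)] natsqD(9)[OF that(3)] natsqD(9)[OF that(4)] by simp_all
  qed (use natsqD(1-3)[OF that(1)] natsqD(1-3)[OF that(2)] f(2) in simp_all)
  have "unit_action X = unit_iso X"
  proof (rule eq)
    note F = unit_law_natural[OF X(1) D(1) nf f(2,3)] and G = unit_law_natural[OF X(1) E(1) ng g(2,3)]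
    have "unit_action Y = unit_iso Y"
      "unit_action Z = unit_iso Z"
      using Y Z by (simp_all only: is_algebra_def)
    note e = this
    show "natsq (unit_action X) (unit_iso Y) (Idn A (Unit A) \<boxtimes> f \<boxtimes> Idn A (Unit A)) f"
      using F(1) unfolding e .
    show "natsq (unit_action X) (unit_iso Z) (Idn A (Unit A) \<boxtimes> g \<boxtimes> Idn A (Unit A)) g"
      using G(1) unfolding e .
  qed (fact unit_law_natural(2)[OF X(1) D(1) nf f(2,3)] unit_law_natural(2)[OF X(1) E(1) ng g(2,3)])+
  moreover have "nested_operation X ks = composed_operation X ks" for ks
  proof -
    note F = assoc_law_natural[OF X(1) D(1) nf f(2,3), of ks] and G = assoc_law_natural[OF X(1) E(1) ng g(2,3), of ks]
    have e: "nested_operation Y ks = composed_operation Y ks"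
      "nested_operation Z ks = composed_operation Z ks"
      using Y Z unfolding is_algebra_def by blast+
    show ?thesis
      by (rule eq[OF F(1)[unfolded e] F(2) G(1)[unfolded e] G(2)])
  qed
  ultimately show ?thesis
    using X by (simp only: is_algebra_def Hom_iff) simp
qed

section \<open>Pullbacks of algebras\<close>

definition underlying :: "('o \<times> 'm) \<times> 'm \<times> ('o \<times> 'm) \<Rightarrow> 'm" where
  "underlying F = fst (snd F)"

lemma underlying_Arr [simp]:
  assumes "F \<in> Arr (algebras A P)"
  shows "underlying F \<in> Arr A" "Dom A (underlying F) = fst (fst F)" "Cod A (underlying F) = fst (snd (snd F))"
  using assms by (auto simp: underlying_def is_algebra_arr_iff)

lemma algebra_arr_eqI:
  "fst F = fst G \<Longrightarrow> snd (snd F) = snd (snd G) \<Longrightarrow> underlying F = underlying G \<Longrightarrow> F = G"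
  by (simp add: prod_eq_iff underlying_def)

text \<open>
  The apex of an underlying pullback carries the structure map induced by those of the two corners;
  its projections are then algebra arrows and jointly monic, which yields the algebra laws.
\<close>

lemma algebra_pullback_structure:
  assumes f: "is_algebra_arr A P X f Z" and g: "is_algebra_arr A P Y g Z" and pb: "is_pullback A f g p q"
  obtains \<mu> where "is_algebra_arr A P (Dom A p, \<mu>) p X" "is_algebra_arr A P (Dom A p, \<mu>) q Y"
proof -
  have alg: "is_algebra A P X" "is_algebra A P Y" "is_algebra A P Z"
    and fg: "f \<in> Arr A" "Dom A f = fst X" "Cod A f = fst Z" "g \<in> Arr A" "Dom A g = fst Y" "Cod A g = fst Z"
    using f g by (auto simp: is_algebra_arr_iff)
  have com: "f \<cdot> snd X = snd Z \<cdot> schur_map A P f" "g \<cdot> snd Y = snd Z \<cdot> schur_map A P g"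
    using f g by (auto simp: is_algebra_arr_def)
  note D = is_algebraD[OF alg(1)] is_algebraD[OF alg(2)] is_algebraD[OF alg(3)]
  note B = is_pullbackD[OF pb]
  have pq: "p \<in> Arr A" "Cod A p = fst X" "q \<in> Arr A" "Dom A q = Dom A p" "Cod A q = fst Y"
    using B fg by auto
  have "f \<cdot> (snd X \<cdot> schur_map A P p) = snd Z \<cdot> (schur_map A P f \<cdot> schur_map A P p)"
    by (rule Cmp_reassoc[OF com(1)]) (use D fg pq in auto)
  also have "schur_map A P f \<cdot> schur_map A P p = schur_map A P g \<cdot> schur_map A P q"
  proof (rule schur_ext[of "Dom A p"])
    fix n
    have "schur_map A P f \<cdot> (schur_in A P n (Dom A f) \<cdot> op_power n p) = schur_in A P n (fst Z) \<cdot> (op_power n f \<cdot> op_power n p)"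
      by (rule Cmp_reassoc) (use schur_map(4)[OF fg(1), of n] fg pq D in auto)
    moreover have "schur_map A P g \<cdot> (schur_in A P n (Dom A g) \<cdot> op_power n q) = schur_in A P n (fst Z) \<cdot> (op_power n g \<cdot> op_power n q)"
      by (rule Cmp_reassoc) (use schur_map(4)[OF fg(4), of n] fg pq D in auto)
    moreover have "op_power n f \<cdot> op_power n p = op_power n g \<cdot> op_power n q"
      using op_power_Cmp[of p f n] op_power_Cmp[of q g n] B by simp
    ultimately show "(schur_map A P f \<cdot> schur_map A P p) \<cdot> schur_in A P n (Dom A p)
        = (schur_map A P g \<cdot> schur_map A P q) \<cdot> schur_in A P n (Dom A p)"
      using schur_map(4)[OF pq(1), of n] schur_map(4)[OF pq(3), of n] pq fg by simp
  qed (use pq fg in auto)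
  also have "snd Z \<cdot> (schur_map A P g \<cdot> schur_map A P q) = g \<cdot> (snd Y \<cdot> schur_map A P q)"
    by (rule Cmp_reassoc[OF com(2)[symmetric]]) (use D fg pq in auto)
  finally obtain \<mu> where \<mu>: "\<mu> \<in> Arr A" "Dom A \<mu> = schur A P (Dom A p)" "Cod A \<mu> = Dom A p"
    "p \<cdot> \<mu> = snd X \<cdot> schur_map A P p" "q \<cdot> \<mu> = snd Y \<cdot> schur_map A P q"
    using pullback_lift[OF pb, of "snd X \<cdot> schur_map A P p" "snd Y \<cdot> schur_map A P q" thesis] D pq fg that
    by auto
  have V: "is_algebra A P (Dom A p, \<mu>)"
  proof (rule is_algebra_joint_mono[OF _ _ _ _ alg(1,2)])
    show "u = v" if "u \<in> Arr A" "v \<in> Arr A" "Dom A u = Dom A v" "Cod A u = fst (Dom A p, \<mu>)"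
      "Cod A v = fst (Dom A p, \<mu>)" "p \<cdot> u = p \<cdot> v" "q \<cdot> u = q \<cdot> v" for u v
      using pullback_joint_mono[OF pb that(1-3)] that by simp
  qed (use \<mu> pq in auto)
  show thesis
    by (rule that[of \<mu>]) (use V alg \<mu> pq in \<open>auto simp: is_algebra_arr_def\<close>)
qed

text \<open>
  An arrow into the apex whose components are algebra arrows is one itself, since the projections
  are jointly monic.
\<close>

lemma is_pullback_algebras:
  assumes f: "is_algebra_arr A P X f Z" and g: "is_algebra_arr A P Y g Z" and pb: "is_pullback A f g p q"
    and p: "is_algebra_arr A P V p X" and q: "is_algebra_arr A P V q Y"
  shows "is_pullback (algebras A P) (X, f, Z) (Y, g, Z) (V, p, X) (V, q, Y)"
proof -
  interpret Alg: category "algebras A P"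
    by (rule category_algebras)
  note B = is_pullbackD[OF pb]
  have pq: "p \<in> Arr A" "Dom A p = fst V" "Cod A p = fst X" "q \<in> Arr A" "Dom A q = fst V" "Cod A q = fst Y"
    "is_algebra A P V"
    "p \<cdot> snd V = snd X \<cdot> schur_map A P p" "q \<cdot> snd V = snd Y \<cdot> schur_map A P q"
    using p q by (auto simp: is_algebra_arr_def)
  note DV = is_algebraD[OF pq(7)]
  show ?thesis
  proof (rule Alg.is_pullbackI)
    fix u v
    assume uv: "u \<in> Arr (algebras A P)" "v \<in> Arr (algebras A P)" "Dom (algebras A P) v = Dom (algebras A P) u"
      "Cod (algebras A P) u = Dom (algebras A P) (X, f, Z)" "Cod (algebras A P) v = Dom (algebras A P) (Y, g, Z)"
      "(X, f, Z) \<cdot>\<^bsub>algebras A P\<^esub> u = (Y, g, Z) \<cdot>\<^bsub>algebras A P\<^esub> v"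
    obtain W u0 v0 where u: "u = (W, u0, X)" and v: "v = (W, v0, Y)"
      using uv by (cases u; cases v) auto
    have u0: "is_algebra_arr A P W u0 X" and v0: "is_algebra_arr A P W v0 Y"
      using uv u v by auto
    then have uv0: "u0 \<in> Arr A" "Dom A u0 = fst W" "Cod A u0 = fst X" "v0 \<in> Arr A" "Dom A v0 = fst W" "Cod A v0 = fst Y"
      "\<And>n. u0 \<cdot> alg_component A P W n = alg_component A P X n \<cdot> op_power n u0"
      "\<And>n. v0 \<cdot> alg_component A P W n = alg_component A P Y n \<cdot> op_power n v0" "is_algebra A P W"
      "is_algebra A P X" "is_algebra A P Y"
      by (auto simp: is_algebra_arr_iff)
    note DW = is_algebraD[OF uv0(9)] and DX = is_algebraD[OF uv0(10)] and DY = is_algebraD[OF uv0(11)]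
    have "f \<cdot> u0 = g \<cdot> v0"
      using uv(6) u v by simp
    then obtain h where h: "h \<in> Arr A" "Dom A h = fst W" "Cod A h = fst V" "p \<cdot> h = u0" "q \<cdot> h = v0"
      using pullback_lift[OF pb, of u0 v0 thesis] uv0 pq B that by auto
    have "h \<cdot> alg_component A P W n = alg_component A P V n \<cdot> op_power n h" for n
    proof (rule pullback_joint_mono[OF pb])
      have cp: "p \<cdot> alg_component A P V n = alg_component A P X n \<cdot> op_power n p"
        "q \<cdot> alg_component A P V n = alg_component A P Y n \<cdot> op_power n q"
        using p q by (auto simp: is_algebra_arr_iff)
      have "p \<cdot> (h \<cdot> alg_component A P W n) = (p \<cdot> h) \<cdot> alg_component A P W n"
        by (rule Cmp_assoc_Arr[symmetric]) (use h pq DW in auto)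
      also have "\<dots> = alg_component A P X n \<cdot> (op_power n p \<cdot> op_power n h)"
        using h(4) op_power_Cmp[of h p n] h(1-3) pq uv0 by simp
      also have "\<dots> = p \<cdot> (alg_component A P V n \<cdot> op_power n h)"
        by (rule Cmp_reassoc[OF cp(1)[symmetric]]) (use h pq DV DX in auto)
      finally show "p \<cdot> (h \<cdot> alg_component A P W n) = p \<cdot> (alg_component A P V n \<cdot> op_power n h)" .
      have "q \<cdot> (h \<cdot> alg_component A P W n) = (q \<cdot> h) \<cdot> alg_component A P W n"
        by (rule Cmp_assoc_Arr[symmetric]) (use h pq DW in auto)
      also have "\<dots> = alg_component A P Y n \<cdot> (op_power n q \<cdot> op_power n h)"
        using h(5) op_power_Cmp[of h q n] h(1-3) pq uv0 by simp
      also have "\<dots> = q \<cdot> (alg_component A P V n \<cdot> op_power n h)"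
        by (rule Cmp_reassoc[OF cp(2)[symmetric]]) (use h pq DV DY in auto)
      finally show "q \<cdot> (h \<cdot> alg_component A P W n) = q \<cdot> (alg_component A P V n \<cdot> op_power n h)" .
    qed (use h pq DV DW in auto)
    then have "is_algebra_arr A P W h V"
      using uv0 pq h by (simp add: is_algebra_arr_iff)
    then show "\<exists>h \<in> Arr (algebras A P). Dom (algebras A P) h = Dom (algebras A P) u \<and>
        Cod (algebras A P) h = Dom (algebras A P) (V, p, X) \<and>
        (V, p, X) \<cdot>\<^bsub>algebras A P\<^esub> h = u \<and> (V, q, Y) \<cdot>\<^bsub>algebras A P\<^esub> h = v"
      using h u v by (intro bexI[of _ "(W, h, V)"]) auto
  next
    fix u v
    assume uv: "u \<in> Arr (algebras A P)" "v \<in> Arr (algebras A P)" "Dom (algebras A P) u = Dom (algebras A P) v"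
      "Cod (algebras A P) u = Dom (algebras A P) (V, p, X)" "Cod (algebras A P) v = Dom (algebras A P) (V, p, X)"
      "(V, p, X) \<cdot>\<^bsub>algebras A P\<^esub> u = (V, p, X) \<cdot>\<^bsub>algebras A P\<^esub> v"
      "(V, q, Y) \<cdot>\<^bsub>algebras A P\<^esub> u = (V, q, Y) \<cdot>\<^bsub>algebras A P\<^esub> v"
    have "underlying u = underlying v"
      by (rule pullback_joint_mono[OF pb])
        (use uv pq underlying_Arr[OF uv(1)] underlying_Arr[OF uv(2)] in \<open>auto simp: underlying_def\<close>)
    then show "u = v"
      using uv by (intro algebra_arr_eqI) auto
  qed (use f g p q B in auto)
qed

lemma pullback_algebras_exists:
  assumes "F \<in> Arr (algebras A P)" "G \<in> Arr (algebras A P)" "snd (snd F) = snd (snd G)"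
  obtains p q where "is_pullback (algebras A P) F G p q" "is_pullback A (underlying F) (underlying G) (underlying p) (underlying q)"
proof -
  obtain X f Z Y g where F: "F = (X, f, Z)" and G: "G = (Y, g, Z)"
    using assms by (cases F; cases G) auto
  have f: "is_algebra_arr A P X f Z" and g: "is_algebra_arr A P Y g Z"
    using assms F G by auto
  then have "f \<in> Arr A" "g \<in> Arr A" "Cod A f = Cod A g"
    by (auto simp: is_algebra_arr_iff)
  from pullback_exists[OF this] obtain p q where pb: "is_pullback A f g p q"
    by blast
  obtain \<mu> where \<mu>: "is_algebra_arr A P (Dom A p, \<mu>) p X" "is_algebra_arr A P (Dom A p, \<mu>) q Y"
    by (rule algebra_pullback_structure[OF f g pb])
  show thesis
    using that[OF is_pullback_algebras[OF f g pb \<mu>, folded F G]] pb F G by (simp add: underlying_def)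
qed

text \<open>
  The forgetful functor preserves all pullbacks: it preserves the one constructed above, and any
  other one is isomorphic to it.
\<close>

lemma pullback_underlying:
  assumes pb: "is_pullback (algebras A P) F G p q"
  shows "is_pullback A (underlying F) (underlying G) (underlying p) (underlying q)"
proof -
  interpret Alg: category "algebras A P"
    by (rule category_algebras)
  note D = Alg.is_pullbackD[OF pb]
  have "snd (snd F) = snd (snd G)"
    using D(3) by simp
  then obtain p' q' where pb': "is_pullback (algebras A P) F G p' q'"
    "is_pullback A (underlying F) (underlying G) (underlying p') (underlying q')"
    by (rule pullback_algebras_exists[OF D(1,2)])
  obtain h k where hk: "h \<in> Arr (algebras A P)" "Dom (algebras A P) h = Dom (algebras A P) p"
    "Cod (algebras A P) h = Dom (algebras A P) p'" "p' \<cdot>\<^bsub>algebras A P\<^esub> h = p" "q' \<cdot>\<^bsub>algebras A P\<^esub> h = q"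
    "k \<in> Arr (algebras A P)" "Dom (algebras A P) k = Dom (algebras A P) p'" "Cod (algebras A P) k = Dom (algebras A P) p"
    "h \<cdot>\<^bsub>algebras A P\<^esub> k = Idn (algebras A P) (Dom (algebras A P) p')"
    "k \<cdot>\<^bsub>algebras A P\<^esub> h = Idn (algebras A P) (Dom (algebras A P) p)"
    by (rule Alg.pullback_comparison[OF pb'(1) pb])
  note D' = Alg.is_pullbackD[OF pb'(1)]
  have u: "underlying h \<in> Arr A" "Dom A (underlying h) = fst (fst p)" "Cod A (underlying h) = fst (fst p')"
    "underlying k \<in> Arr A" "Dom A (underlying k) = fst (fst p')" "Cod A (underlying k) = fst (fst p)"
    "Dom A (underlying p') = fst (fst p')"
    using underlying_Arr[OF hk(1)] underlying_Arr[OF hk(6)] hk(2,3,7,8) underlying_Arr[OF D'(4)] by simp_all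
  have "underlying p = underlying p' \<cdot> underlying h" "underlying q = underlying q' \<cdot> underlying h"
    using hk(4,5)[symmetric] by (auto simp: underlying_def)
  moreover have "underlying h \<cdot> underlying k = Idn A (fst (fst p'))" "underlying k \<cdot> underlying h = Idn A (fst (fst p))"
    using hk(9,10) by (simp_all add: underlying_def)
  ultimately show ?thesis
    using pullback_transport[OF pb'(2), of "underlying h" "underlying k"] u by simp
qed

end

section \<open>Compositions on a reflexive graph\<close>

text \<open>
  \<open>s\<close> and \<open>t\<close> with common section \<open>i\<close>, and a pullback with projections \<open>p (g, f) = g\<close> and
  \<open>q (g, f) = f\<close>.
\<close>

locale composable_graph = preadditive_category A
  for A :: "('o, 'm, 'z) preadditive_scheme" (structure) +
  fixes s t i p q :: 'm
  assumes pb: "is_pullback A s t p q"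
    and i_Arr: "i \<in> Arr A" "Dom A i = Cod A s" "Cod A i = Dom A s"
    and Dom_t: "Dom A t = Dom A s"
    and si: "s \<cdot> i = Idn A (Cod A s)" and ti: "t \<cdot> i = Idn A (Cod A s)"
begin

lemma graph_Arr [simp]:
  "s \<in> Arr A" "t \<in> Arr A" "Cod A t = Cod A s" "Dom A t = Dom A s"
  "p \<in> Arr A" "q \<in> Arr A" "Dom A q = Dom A p" "Cod A p = Dom A s" "Cod A q = Dom A s"
  "i \<in> Arr A" "Dom A i = Cod A s" "Cod A i = Dom A s"
  using is_pullbackD[OF pb] i_Arr Dom_t by auto

lemma tq: "t \<cdot> q = s \<cdot> p"
  using is_pullbackD(9)[OF pb] by simp

lemma Cmp_section [simp]:
  "x \<in> Arr A \<Longrightarrow> Cod A x = Cod A s \<Longrightarrow> s \<cdot> (i \<cdot> x) = x"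
  "x \<in> Arr A \<Longrightarrow> Cod A x = Cod A s \<Longrightarrow> t \<cdot> (i \<cdot> x) = x"
  using Cmp_assoc_Arr[of x i s] Cmp_assoc_Arr[of x i t] si ti by simp_all

lemma tq_Cmp: "x \<in> Arr A \<Longrightarrow> Cod A x = Dom A p \<Longrightarrow> t \<cdot> (q \<cdot> x) = s \<cdot> (p \<cdot> x)"
  by (rule Cmp_reassoc[OF tq]) auto

text \<open>The identity \<open>i s g = i t f\<close> at the object where \<open>g\<close> and \<open>f\<close> meet.\<close>

definition mid :: 'm where
  "mid = i \<cdot> (s \<cdot> p)"

lemma mid_Arr [simp]: "mid \<in> Arr A" "Dom A mid = Dom A p" "Cod A mid = Dom A s"
  by (simp_all add: mid_def)

lemma s_mid: "s \<cdot> mid = s \<cdot> p" and t_mid: "t \<cdot> mid = s \<cdot> p"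
  by (simp_all add: mid_def)

text \<open>
  The formula \<open>c (g, f) = g + f - i s g\<close>. With the negative term on the left, each of its
  consequences follows by composing and cancelling.
\<close>

definition composition :: "'m \<Rightarrow> bool" where
  "composition c \<longleftrightarrow> c \<in> Hom A (Dom A p) (Dom A s) \<and> c \<boxplus> mid = p \<boxplus> q"

lemma compositionD:
  assumes "composition c"
  shows "c \<in> Arr A" "Dom A c = Dom A p" "Cod A c = Dom A s" "c \<boxplus> mid = p \<boxplus> q"
  using assms by (auto simp: composition_def)

lemma composition_unique:
  assumes "composition c" "composition d"
  shows "c = d"
  using Add_right_cancel[of c d mid] compositionD[OF assms(1)] compositionD[OF assms(2)] by simp

lemma composition_Cmp:
  assumes c: "composition c" and x: "x \<in> Arr A" "Cod A x = Dom A p"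
  shows "c \<cdot> x \<boxplus> mid \<cdot> x = p \<cdot> x \<boxplus> q \<cdot> x"
proof -
  have "c \<cdot> x \<boxplus> mid \<cdot> x = (c \<boxplus> mid) \<cdot> x"
    using compositionD(1-3)[OF c] x by (subst Add_Cmp_Arr) auto
  also have "\<dots> = p \<cdot> x \<boxplus> q \<cdot> x"
    unfolding compositionD(4)[OF c] using x by (subst Add_Cmp_Arr) auto
  finally show ?thesis .
qed

lemma composition_Cmp_left:
  assumes c: "composition c" and x: "x \<in> Arr A" "Dom A x = Dom A s"
  shows "x \<cdot> c \<boxplus> x \<cdot> mid = x \<cdot> p \<boxplus> x \<cdot> q"
proof -
  have "x \<cdot> c \<boxplus> x \<cdot> mid = x \<cdot> (c \<boxplus> mid)"
    using compositionD(1-3)[OF c] x by (subst Cmp_Add_Arr) auto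
  also have "\<dots> = x \<cdot> p \<boxplus> x \<cdot> q"
    unfolding compositionD(4)[OF c] using x by (subst Cmp_Add_Arr) auto
  finally show ?thesis .
qed

text \<open>
  A composable pair is a sum \<open>(g, f) = (g, i s g) + (i t f, f) - (i s g, i s g)\<close>, so the unit laws
  leave \<open>g + f - i s g\<close> as the only possible composite.
\<close>

lemma composition_of_units:
  assumes c: "c \<in> Arr A" "Dom A c = Dom A p" "Cod A c = Dom A s"
    and u: "u \<in> Arr A" "Dom A u = Dom A s" "Cod A u = Dom A p" "p \<cdot> u = Idn A (Dom A s)" "q \<cdot> u = i \<cdot> s"
    and v: "v \<in> Arr A" "Dom A v = Dom A s" "Cod A v = Dom A p" "p \<cdot> v = i \<cdot> t" "q \<cdot> v = Idn A (Dom A s)"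
    and cu: "c \<cdot> u = Idn A (Dom A s)" and cv: "c \<cdot> v = Idn A (Dom A s)"
  shows "composition c"
proof -
  let ?d = "u \<cdot> mid"
  have red: "x \<cdot> (u \<cdot> y) = (x \<cdot> u) \<cdot> y" "x \<cdot> (v \<cdot> y) = (x \<cdot> v) \<cdot> y"
    if "x \<in> Arr A" "Dom A x = Dom A p" "y \<in> Arr A" "Cod A y = Dom A s" for x y
    using u(1-3) v(1-3) that by simp_all
  \<comment> \<open>\<open>u\<close> and \<open>v\<close> are the elements \<open>(g, i s g)\<close> and \<open>(i t f, f)\<close>\<close>
  have pu: "p \<cdot> (u \<cdot> y) = y" "q \<cdot> (u \<cdot> y) = i \<cdot> (s \<cdot> y)" "c \<cdot> (u \<cdot> y) = y"
    "p \<cdot> (v \<cdot> y) = i \<cdot> (t \<cdot> y)" "q \<cdot> (v \<cdot> y) = y" "c \<cdot> (v \<cdot> y) = y"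
    if "y \<in> Arr A" "Cod A y = Dom A s" for y
    using that red(1)[of p y] red(1)[of q y] red(1)[of c y] red(2)[of p y] red(2)[of q y] red(2)[of c y]
      u(4,5) v(4,5) cu cv c by (simp_all del: Cmp_assoc_Arr) (simp_all)
  have "u \<cdot> p \<boxplus> v \<cdot> q = Idn A (Dom A p) \<boxplus> ?d"
  proof (rule pullback_joint_mono[OF pb])
    show "p \<cdot> (u \<cdot> p \<boxplus> v \<cdot> q) = p \<cdot> (Idn A (Dom A p) \<boxplus> ?d)"
      using u(1-3) v(1-3) by (simp add: Cmp_Add_Arr pu tq mid_def[symmetric])
    show "q \<cdot> (u \<cdot> p \<boxplus> v \<cdot> q) = q \<cdot> (Idn A (Dom A p) \<boxplus> ?d)"
      using u(1-3) v(1-3) by (simp add: Cmp_Add_Arr pu s_mid mid_def[symmetric] Add_commute[of mid q])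
  qed (use u(1-3) v(1-3) in auto)
  then have "c \<cdot> (u \<cdot> p \<boxplus> v \<cdot> q) = c \<cdot> (Idn A (Dom A p) \<boxplus> ?d)"
    by simp
  then have "p \<boxplus> q = c \<boxplus> mid"
    using u(1-3) v(1-3) c by (simp add: Cmp_Add_Arr pu)
  then show ?thesis
    using c by (simp add: composition_def)
qed

lemma composition_source: "composition c \<Longrightarrow> s \<cdot> c = s \<cdot> q"
  and composition_target: "composition c \<Longrightarrow> t \<cdot> c = t \<cdot> p"
proof -
  assume c: "composition c"
  note C = compositionD(1-3)[OF c]
  have "s \<cdot> c \<boxplus> s \<cdot> p = s \<cdot> q \<boxplus> s \<cdot> p"
    using composition_Cmp_left[OF c, of s] Add_commute[of "s \<cdot> p" "s \<cdot> q"] by (simp add: s_mid)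
  then show "s \<cdot> c = s \<cdot> q"
    by (subst (asm) Add_right_cancel) (use C in auto)
  have "t \<cdot> c \<boxplus> s \<cdot> p = t \<cdot> p \<boxplus> s \<cdot> p"
    using composition_Cmp_left[OF c, of t] by (simp add: t_mid tq)
  then show "t \<cdot> c = t \<cdot> p"
    by (subst (asm) Add_right_cancel) (use C in auto)
qed

lemma mid_Cmp: "x \<in> Arr A \<Longrightarrow> Cod A x = Dom A p \<Longrightarrow> mid \<cdot> x = i \<cdot> (s \<cdot> (p \<cdot> x))"
  by (simp add: mid_def)

lemma composition_right_unit:
  assumes c: "composition c" and u: "u \<in> Arr A" "Cod A u = Dom A p" "Dom A u = Dom A s"
    "p \<cdot> u = Idn A (Dom A s)" "q \<cdot> u = i \<cdot> s"
  shows "c \<cdot> u = Idn A (Dom A s)"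
proof -
  have "c \<cdot> u \<boxplus> i \<cdot> s = Idn A (Dom A s) \<boxplus> i \<cdot> s"
    using composition_Cmp[OF c u(1,2)] mid_Cmp[OF u(1,2)] u by simp
  then show ?thesis
    by (subst (asm) Add_right_cancel) (use u compositionD(1-3)[OF c] in auto)
qed

lemma composition_left_unit:
  assumes c: "composition c" and v: "v \<in> Arr A" "Cod A v = Dom A p" "Dom A v = Dom A s"
    "p \<cdot> v = i \<cdot> t" "q \<cdot> v = Idn A (Dom A s)"
  shows "c \<cdot> v = Idn A (Dom A s)"
proof -
  have "c \<cdot> v \<boxplus> i \<cdot> t = Idn A (Dom A s) \<boxplus> i \<cdot> t"
    using composition_Cmp[OF c v(1,2)] mid_Cmp[OF v(1,2)] v Add_commute[of "Idn A (Dom A s)" "i \<cdot> t"] by simp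
  then show ?thesis
    by (subst (asm) Add_right_cancel) (use v compositionD(1-3)[OF c] in auto)
qed

text \<open>Both iterated composites of \<open>(h, g, f)\<close> are \<open>h + g + f - i s h - i s g\<close>.\<close>

lemma composition_assoc:
  assumes c: "composition c"
    and a: "a \<in> Arr A" "Cod A a = Dom A p" and b: "b \<in> Arr A" "Cod A b = Dom A p" "Dom A b = Dom A a"
    and ab: "q \<cdot> a = p \<cdot> b"
    and x: "x \<in> Arr A" "Dom A x = Dom A a" "Cod A x = Dom A p" "p \<cdot> x = c \<cdot> a" "q \<cdot> x = q \<cdot> b"
    and y: "y \<in> Arr A" "Dom A y = Dom A a" "Cod A y = Dom A p" "p \<cdot> y = p \<cdot> a" "q \<cdot> y = c \<cdot> b"
  shows "c \<cdot> x = c \<cdot> y"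
proof -
  note C = compositionD(1-3)[OF c]
  have sc: "s \<cdot> (c \<cdot> a) = s \<cdot> (q \<cdot> a)"
    by (rule Cmp_reassoc[OF composition_source[OF c]]) (use C a in auto)
  have 1: "c \<cdot> x \<boxplus> mid \<cdot> b = c \<cdot> a \<boxplus> q \<cdot> b"
    using composition_Cmp[OF c x(1,3)] x by (simp add: mid_Cmp a b sc ab)
  have 2: "c \<cdot> a \<boxplus> mid \<cdot> a = p \<cdot> a \<boxplus> q \<cdot> a"
    by (rule composition_Cmp[OF c a])
  have 3: "c \<cdot> y \<boxplus> mid \<cdot> a = p \<cdot> a \<boxplus> c \<cdot> b"
    using composition_Cmp[OF c y(1,3)] y by (simp add: mid_Cmp a)
  have 4: "c \<cdot> b \<boxplus> mid \<cdot> b = q \<cdot> a \<boxplus> q \<cdot> b"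
    using composition_Cmp[OF c b(1,2)] ab by simp
  have "(c \<cdot> x \<boxplus> mid \<cdot> b) \<boxplus> mid \<cdot> a = (c \<cdot> a \<boxplus> mid \<cdot> a) \<boxplus> q \<cdot> b"
    unfolding 1 using C a b by (simp add: Add_ac)
  also have "\<dots> = p \<cdot> a \<boxplus> (c \<cdot> b \<boxplus> mid \<cdot> b)"
    unfolding 2 4 using C a b by (subst Add_assoc) auto
  also have "\<dots> = (c \<cdot> y \<boxplus> mid \<cdot> a) \<boxplus> mid \<cdot> b"
    unfolding 3 using C a b by (subst Add_assoc) auto
  also have "\<dots> = (c \<cdot> y \<boxplus> mid \<cdot> b) \<boxplus> mid \<cdot> a"
    using C a b y by (simp add: Add_ac)
  finally have "c \<cdot> x \<boxplus> mid \<cdot> b = c \<cdot> y \<boxplus> mid \<cdot> b"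
    by (subst (asm) Add_right_cancel) (use C a b x y in auto)
  then show ?thesis
    by (subst (asm) Add_right_cancel) (use C a b x y in auto)
qed

lemma composition_split:
  assumes c: "composition c"
  shows "c = p \<boxplus> (q \<boxplus> neg mid)" "c = q \<boxplus> (p \<boxplus> neg mid)"
proof -
  have "composition (p \<boxplus> (q \<boxplus> neg mid))" "composition (q \<boxplus> (p \<boxplus> neg mid))"
    by (simp_all add: composition_def Add_assoc Add_commute[of q p] Add_commute[of "neg mid" mid])
  then show "c = p \<boxplus> (q \<boxplus> neg mid)" "c = q \<boxplus> (p \<boxplus> neg mid)"
    using composition_unique[OF c] by blast+
qed

lemma composition_exists: "\<exists>c. composition c"
  by (rule exI[of _ "p \<boxplus> (q \<boxplus> neg mid)"]) (simp add: composition_def Add_assoc Add_commute[of "neg mid" mid])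

end

section \<open>Multilinear maps and their vanishing\<close>

context preadditive_category
begin

context
  fixes T :: "'m list \<Rightarrow> 'm" and n :: nat and v x y :: 'o and E :: 'o and k l :: 'm
  assumes T_Arr: "\<And>w. set w \<subseteq> Hom A v E \<Longrightarrow> length w = n \<Longrightarrow> T w \<in> Hom A x y"
    and T_Add: "\<And>us vs f g. set us \<subseteq> Hom A v E \<Longrightarrow> set vs \<subseteq> Hom A v E \<Longrightarrow> f \<in> Hom A v E \<Longrightarrow> g \<in> Hom A v E \<Longrightarrow>
      length us + Suc (length vs) = n \<Longrightarrow> T (us @ (f \<boxplus> g) # vs) = T (us @ f # vs) \<boxplus> T (us @ g # vs)"
    and k: "k \<in> Hom A v E" and l: "l \<in> Hom A v E"
    and vanish: "\<And>us vs. set us \<subseteq> Hom A v E \<Longrightarrow> set vs \<subseteq> Hom A v E \<Longrightarrow> length us + Suc (length vs) = n \<Longrightarrow>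
      l \<in> set us \<union> set vs \<Longrightarrow> T (us @ k # vs) = Zero A x y"
begin

text \<open>In a word that contains \<open>l\<close>, summands \<open>k\<close> may be dropped from other letters.\<close>

lemma multilinear_drop:
  assumes "list_all2 (\<lambda>a b. b \<in> Hom A v E \<and> a = b \<boxplus> k) as bs"
    and "set us \<subseteq> Hom A v E" "set vs \<subseteq> Hom A v E" "length us + length as + length vs = n" "l \<in> set us \<union> set vs"
  shows "T (us @ as @ vs) = T (us @ bs @ vs)"
  using assms
proof (induction arbitrary: us rule: list_all2_induct)
  case (Cons a as b bs)
  have as: "set as \<subseteq> Hom A v E" "set bs \<subseteq> Hom A v E"
    using Cons.hyps(2) k by (induction rule: list_all2_induct) auto
  have b: "b \<in> Hom A v E" "a = b \<boxplus> k"
    using Cons.hyps by auto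
  have set: "set (as @ vs) \<subseteq> Hom A v E" and len: "length us + Suc (length (as @ vs)) = n"
    using as Cons.prems by auto
  have "T (us @ b # as @ vs) \<in> Hom A x y"
    using T_Arr[of "us @ b # as @ vs"] b Cons.prems as by auto
  then have "T (us @ (a # as) @ vs) = T ((us @ [b]) @ as @ vs)"
    using T_Add[OF Cons.prems(1) set b(1) k len] vanish[OF Cons.prems(1) set len] Cons.prems(4) b by auto
  also have "\<dots> = T ((us @ [b]) @ bs @ vs)"
    by (rule Cons.IH) (use Cons.prems b in auto)
  finally show ?case
    by simp
qed simp

text \<open>
  With \<open>g = e + k\<close>, \<open>f = e + l\<close> and \<open>c = e + k + l\<close>, expanding \<open>T\<close> shows that
  \<open>T c\<^sup>n - T g\<^sup>n - T f\<^sup>n + T e\<^sup>n\<close> is the sum of the values on the words in \<open>e\<close>, \<open>k\<close>, \<open>l\<close> in which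
  both \<open>k\<close> and \<open>l\<close> occur. The expansion is organised as a telescope, one position at a time.
\<close>

lemma multilinear_telescope:
  assumes e: "e \<in> Hom A v E" and g: "g = e \<boxplus> k" and f: "f = e \<boxplus> l" and c: "c = g \<boxplus> l" "c = f \<boxplus> k"
    and "j + m = n"
  shows "T (replicate j g @ replicate m c) \<boxplus> T (replicate n e) = T (replicate n g) \<boxplus> T (replicate j e @ replicate m f)"
  using \<open>j + m = n\<close>
proof (induction m arbitrary: j)
  case 0
  then show ?case
    by simp
next
  case (Suc m)
  have H: "g \<in> Hom A v E" "f \<in> Hom A v E" "c \<in> Hom A v E"
    using e k l g f c(1) by auto
  have t: "T w \<in> Arr A" "Dom A (T w) = x" "Cod A (T w) = y" if "set w \<subseteq> Hom A v E" "length w = n" for w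
    using T_Arr[OF that] by auto
  note R = set_replicate_subset
  have n: "length (replicate j a) + Suc (length (replicate m b)) = n" for a b :: 'm
    using Suc.prems by simp
  let ?g = "replicate j g" and ?e = "replicate j e" and ?c = "replicate m c" and ?f = "replicate m f"
  have "T (?g @ l # ?c) = T ([] @ ?g @ (l # ?c))"
    by simp
  also have "\<dots> = T ([] @ ?e @ (l # ?c))"
    by (rule multilinear_drop) (use e g H l Suc.prems in \<open>auto simp: list_all2_conv_all_nth\<close>)
  also have "\<dots> = T ((?e @ [l]) @ ?c @ [])"
    by simp
  also have "\<dots> = T ((?e @ [l]) @ ?f @ [])"
    by (rule multilinear_drop) (use e c(2) H l Suc.prems in \<open>auto simp: list_all2_conv_all_nth\<close>)
  finally have drop: "T (?g @ l # ?c) = T (?e @ l # ?f)"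
    by simp
  have IH: "T (?g @ g # ?c) \<boxplus> T (replicate n e) = T (replicate n g) \<boxplus> T (?e @ e # ?f)"
    using Suc.IH[of "Suc j"] Suc.prems by (simp add: replicate_app_Cons_same)
  have ty: "T (?g @ g # ?c) \<in> Hom A x y" "T (?e @ l # ?f) \<in> Hom A x y" "T (replicate n e) \<in> Hom A x y"
    "T (replicate n g) \<in> Hom A x y" "T (?e @ e # ?f) \<in> Hom A x y"
    using H e l Suc.prems by (intro T_Arr; auto)+
  have 1: "T (?g @ c # ?c) = T (?g @ g # ?c) \<boxplus> T (?e @ l # ?f)"
    using T_Add[OF R[OF H(1)] R[OF H(3)] H(1) l n] drop c(1) by simp
  have 2: "T (?e @ f # ?f) = T (?e @ e # ?f) \<boxplus> T (?e @ l # ?f)"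
    using T_Add[OF R[OF e] R[OF H(2)] e l n] f by simp
  have "T (replicate j g @ replicate (Suc m) c) \<boxplus> T (replicate n e)
      = (T (?g @ g # ?c) \<boxplus> T (replicate n e)) \<boxplus> T (?e @ l # ?f)"
    unfolding replicate_Suc 1 using ty by (simp add: Add_ac)
  also have "\<dots> = T (replicate n g) \<boxplus> T (replicate j e @ replicate (Suc m) f)"
    unfolding replicate_Suc 2 IH using ty by (simp add: Add_assoc)
  finally show ?case .
qed

end

end

text \<open>
  \<open>\<sigma>\<close> is the inverse of \<open>(0 a) (1 b')\<close>, where \<open>b'\<close> is chosen so that \<open>(0 a)\<close> sends it to \<open>b\<close>.
\<close>

lemma perm_list_front:
  assumes a: "a < length xs" and b: "b < length xs" and "a \<noteq> b"
  obtains \<sigma> zs where "\<sigma> permutes {..<length xs}" "perm_list \<sigma> xs = xs ! a # xs ! b # zs" "set zs \<subseteq> set xs"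
    "length xs = Suc (Suc (length zs))"
proof -
  have n: "2 \<le> length xs"
    using assms by auto
  define b' where "b' = transpose 0 a b"
  define \<tau> where "\<tau> = transpose 0 a \<circ> transpose 1 b'"
  have b': "b' < length xs" "b' \<noteq> 0"
    using assms n by (auto simp: b'_def transpose_def)
  have \<tau>: "\<tau> permutes {..<length xs}"
    unfolding \<tau>_def by (intro permutes_compose permutes_swap_id) (use a b' n in auto)
  have val: "\<tau> 0 = a" "\<tau> 1 = b"
    using b' \<open>a \<noteq> b\<close> by (auto simp: \<tau>_def b'_def transpose_def)
  let ?\<sigma> = "inv_into UNIV \<tau>"
  have inv: "inv_into UNIV ?\<sigma> = \<tau>"
    using permutes_bij[OF \<tau>] by (rule inv_inv_eq)
  have "[0..<length xs] = 0 # 1 # [2..<length xs]"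
    using n upt_conv_Cons[of 0 "length xs"] upt_conv_Cons[of 1 "length xs"]
    by (cases "xs = []") (auto simp: numeral_2_eq_2)
  then have "perm_list ?\<sigma> xs = xs ! a # xs ! b # map (\<lambda>i. xs ! \<tau> i) [2..<length xs]"
    by (simp add: perm_list_def inv permute_list_def val[unfolded One_nat_def])
  moreover have "set (map (\<lambda>i. xs ! \<tau> i) [2..<length xs]) \<subseteq> set xs"
  proof -
    have "\<tau> j < length xs" if "j < length xs" for j
      using permutes_in_image[OF \<tau>, of j] that by simp
    then show ?thesis
      by auto
  qed
  moreover have "length xs = Suc (Suc (length (map (\<lambda>i. xs ! \<tau> i) [2..<length xs])))"
    using n by simp
  ultimately show thesis
    using that permutes_inv[OF \<tau>] by blast
qed

context operadic_category
begin

text \<open>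
  For generalised elements \<open>w\<^sub>j : v\<^sub>j \<rightarrow> E\<close>, the arrow \<open>\<mu>\<^sub>n(-; w\<^sub>1, \<dots>, w\<^sub>n)\<close> from
  \<open>P\<^sub>n \<odot> (v\<^sub>1 \<odot> \<dots> \<odot> v\<^sub>n)\<close> to \<open>E\<close>: the operation remains a variable.
\<close>

definition word_value :: "'o \<times> 'm \<Rightarrow> 'm list \<Rightarrow> 'm" where
  "word_value X w = alg_component A P X (length w) \<cdot> (Idn A (OObj P (length w)) \<boxtimes> tensor_arr A w)"

lemma map_Dom_Cod_Hom:
  "set w \<subseteq> Hom A v E \<Longrightarrow> map (Dom A) w = replicate (length w) v \<and> map (Cod A) w = replicate (length w) E"
  by (induction w) auto

lemma Hom_subset_Arr: "set w \<subseteq> Hom A v E \<Longrightarrow> set w \<subseteq> Arr A"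
  by auto

lemma word_value_replicate: "word_value X (replicate n f) = alg_component A P X n \<cdot> op_power n f"
  by (simp add: word_value_def op_power_def)

lemma word_value_Arr:
  assumes X: "is_algebra A P X" and w: "set w \<subseteq> Arr A" "map (Cod A) w = replicate (length w) (fst X)"
  shows "word_value X w \<in> Arr A" "Dom A (word_value X w) = OObj P (length w) \<odot> tensor A (map (Dom A) w)"
    "Cod A (word_value X w) = fst X"
  using is_algebraD[OF X] w by (simp_all add: word_value_def)

lemma word_value_Add:
  assumes X: "is_algebra A P X" and w: "set us \<subseteq> Hom A v (fst X)" "set vs \<subseteq> Hom A v (fst X)"
    "f \<in> Hom A v (fst X)" "g \<in> Hom A v (fst X)"
  shows "word_value X (us @ (f \<boxplus> g) # vs) = word_value X (us @ f # vs) \<boxplus> word_value X (us @ g # vs)"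
proof -
  let ?n = "Suc (length us + length vs)"
  note A = Hom_subset_Arr[OF w(1)] Hom_subset_Arr[OF w(2)]
  note M = map_Dom_Cod_Hom[OF w(1)] map_Dom_Cod_Hom[OF w(2)]
  have ty: "tensor_arr A (us @ h # vs) \<in> Arr A" "Dom A (tensor_arr A (us @ h # vs)) = tensor A (replicate ?n v)"
    "Cod A (tensor_arr A (us @ h # vs)) = tensor A (replicate ?n (fst X))" if "h \<in> Hom A v (fst X)" for h
  proof -
    have "set (us @ h # vs) \<subseteq> Hom A v (fst X)" "length (us @ h # vs) = ?n"
      using w that by auto
    then show "tensor_arr A (us @ h # vs) \<in> Arr A" "Dom A (tensor_arr A (us @ h # vs)) = tensor A (replicate ?n v)"
      "Cod A (tensor_arr A (us @ h # vs)) = tensor A (replicate ?n (fst X))"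
      using map_Dom_Cod_Hom[of "us @ h # vs" v "fst X"] Hom_subset_Arr by (metis tensor_arr_Arr)+
  qed
  have "tensor_arr A (us @ (f \<boxplus> g) # vs) = tensor_arr A (us @ f # vs) \<boxplus> tensor_arr A (us @ g # vs)"
    by (rule tensor_arr_Add) (use A w in auto)
  then have "word_value X (us @ (f \<boxplus> g) # vs)
      = alg_component A P X ?n \<cdot> (Idn A (OObj P ?n) \<boxtimes> (tensor_arr A (us @ f # vs) \<boxplus> tensor_arr A (us @ g # vs)))"
    by (simp add: word_value_def)
  also have "\<dots> = alg_component A P X ?n \<cdot> ((Idn A (OObj P ?n) \<boxtimes> tensor_arr A (us @ f # vs))
      \<boxplus> (Idn A (OObj P ?n) \<boxtimes> tensor_arr A (us @ g # vs)))"
    using ty[OF w(3)] ty[OF w(4)] by (subst TensA_Add) auto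
  also have "\<dots> = word_value X (us @ f # vs) \<boxplus> word_value X (us @ g # vs)"
    using ty[OF w(3)] ty[OF w(4)] is_algebraD[OF X] by (subst Cmp_Add_Arr) (auto simp: word_value_def)
  finally show ?thesis .
qed

lemma word_value_Zero:
  assumes X: "is_algebra A P X" and w: "set us \<subseteq> Arr A" "set vs \<subseteq> Arr A" "a \<in> Obj A"
    "map (Cod A) us = replicate (length us) (fst X)" "map (Cod A) vs = replicate (length vs) (fst X)"
  shows "word_value X (us @ Zero A a (fst X) # vs)
    = Zero A (OObj P (Suc (length us + length vs)) \<odot> tensor A (map (Dom A) us @ a # map (Dom A) vs)) (fst X)"
proof -
  note D = is_algebraD[OF X]
  have o: "tensor A (map (Dom A) us @ a # map (Dom A) vs) \<in> Obj A"
    using w by (intro tensor_Obj) auto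
  have "replicate (length us) (fst X) @ fst X # replicate (length vs) (fst X) = replicate (Suc (length us + length vs)) (fst X)"
    by (simp add: replicate_add[symmetric] replicate_app_Cons_same)
  then show ?thesis
    using D w o unfolding word_value_def by (subst tensor_arr_Zero) (simp_all add: TensA_Zero)
qed

lemma word_value_Cmp:
  assumes X: "is_algebra A P X" and w: "list_all2 (\<lambda>g f. g \<in> Arr A \<and> f \<in> Arr A \<and> Cod A f = Dom A g) w w'"
    "map (Cod A) w = replicate (length w) (fst X)"
  shows "word_value X (map2 (Cmp A) w w') = word_value X w \<cdot> (Idn A (OObj P (length w)) \<boxtimes> tensor_arr A w')"
proof -
  have len: "length w' = length w"
    using w(1) list_all2_lengthD by fastforce
  have A: "set w \<subseteq> Arr A" "set w' \<subseteq> Arr A" "map (Cod A) w' = map (Dom A) w"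
    using w(1) by (induction rule: list_all2_induct) auto
  show ?thesis
    using is_algebraD[OF X] A w(2) len tensor_arr_Cmp[OF w(1)] by (simp add: word_value_def)
qed

lemma word_value_algebra_arr:
  assumes f: "is_algebra_arr A P X f Y" and w: "set w \<subseteq> Arr A" "map (Cod A) w = replicate (length w) (fst X)"
  shows "f \<cdot> word_value X w = word_value Y (map (Cmp A f) w)"
proof -
  have X: "is_algebra A P X" and Y: "is_algebra A P Y" and ff: "f \<in> Arr A" "Dom A f = fst X" "Cod A f = fst Y"
    and com: "f \<cdot> alg_component A P X (length w) = alg_component A P Y (length w) \<cdot> op_power (length w) f"
    using f by (auto simp: is_algebra_arr_iff)
  have cod: "Cod A x = fst X" if "x \<in> set w" for x
    using w(2) that by (metis in_set_replicate list.set_map rev_image_eqI)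
  have "f \<cdot> word_value X w = alg_component A P Y (length w) \<cdot> (op_power (length w) f
      \<cdot> (Idn A (OObj P (length w)) \<boxtimes> tensor_arr A w))"
    unfolding word_value_def
    by (rule Cmp_reassoc[OF com]) (use ff w is_algebraD[OF X] is_algebraD[OF Y] in auto)
  also have "\<dots> = word_value Y (replicate (length w) f) \<cdot> (Idn A (OObj P (length w)) \<boxtimes> tensor_arr A w)"
    using ff w is_algebraD[OF Y] by (simp add: word_value_replicate)
  also have "\<dots> = word_value Y (map2 (Cmp A) (replicate (length w) f) w)"
    by (subst word_value_Cmp[OF Y]) (use ff w cod in \<open>auto simp: list_all2_conv_all_nth\<close>)
  also have "map2 (Cmp A) (replicate (length w) f) w = map (Cmp A f) w"
    by (rule nth_equalityI) auto
  finally show ?thesis .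
qed

text \<open>
  Permuting the arguments of an algebra operation amounts to letting the permutation act on
  \<open>P\<^sub>n\<close>, which is invertible.
\<close>

lemma word_value_perm:
  assumes X: "is_algebra A P X" and w: "set w \<subseteq> Hom A v (fst X)" and \<sigma>: "\<sigma> permutes {..<length w}"
    and z: "word_value X (perm_list \<sigma> w) = Zero A (OObj P (length w) \<odot> tensor A (replicate (length w) v)) (fst X)"
    and v: "v \<in> Obj A"
  shows "word_value X w = Zero A (OObj P (length w) \<odot> tensor A (replicate (length w) v)) (fst X)"
proof -
  let ?n = "length w" and ?\<tau> = "inv_into UNIV \<sigma>" and ?x = "fst X"
  let ?I = "Idn A (OObj P (length w))" and ?m = "alg_component A P X (length w)"
  let ?s = "\<lambda>y. perm_tensor A \<sigma> (replicate (length w) y)"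
  note D = is_algebraD[OF X]
  have \<tau>: "?\<tau> permutes {..<?n}"
    by (rule permutes_inv[OF \<sigma>])
  have len: "length (perm_list \<sigma> w) = ?n"
    by (simp add: perm_list_def)
  have wA: "set w \<subseteq> Arr A" "map (Dom A) w = replicate ?n v" "map (Cod A) w = replicate ?n ?x"
    using Hom_subset_Arr[OF w] map_Dom_Cod_Hom[OF w] by auto
  note N = natsqD[OF natsq_perm_tensor[OF \<sigma> wA]]
  have "OAct P ?n \<sigma> \<cdot> OAct P ?n ?\<tau> = ?I"
    using OAct_comp[OF \<tau> \<sigma>] permutes_inv_o(2)[OF \<sigma>] OAct_id by simp
  then have "?I \<boxtimes> tensor_arr A w
      = (OAct P ?n \<sigma> \<boxtimes> Idn A (tensor A (replicate ?n ?x))) \<cdot> (OAct P ?n ?\<tau> \<boxtimes> tensor_arr A w)"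
    using \<sigma> \<tau> wA D by simp
  then have "word_value X w
      = ?m \<cdot> ((OAct P ?n \<sigma> \<boxtimes> Idn A (tensor A (replicate ?n ?x))) \<cdot> (OAct P ?n ?\<tau> \<boxtimes> tensor_arr A w))"
    by (simp add: word_value_def)
  also have "\<dots> = ?m \<cdot> ((?I \<boxtimes> ?s ?x) \<cdot> (OAct P ?n ?\<tau> \<boxtimes> tensor_arr A w))"
  proof (rule Cmp_reassoc)
    have "equivariant ?n ?x ?m"
      unfolding alg_component_def by (intro equivariant_Cmp schur_in_equivariant) (use D in auto)
    then show "?m \<cdot> (OAct P ?n \<sigma> \<boxtimes> Idn A (tensor A (replicate ?n ?x))) = ?m \<cdot> (?I \<boxtimes> ?s ?x)"
      using \<sigma> by (simp add: equivariant_def)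
  qed (use D \<sigma> \<tau> wA in auto)
  also have "(?I \<boxtimes> ?s ?x) \<cdot> (OAct P ?n ?\<tau> \<boxtimes> tensor_arr A w)
      = (?I \<boxtimes> tensor_arr A (perm_list \<sigma> w)) \<cdot> (OAct P ?n ?\<tau> \<boxtimes> ?s v)"
    using D \<sigma> \<tau> wA N v by simp
  also have "?m \<cdot> \<dots> = word_value X (perm_list \<sigma> w) \<cdot> (OAct P ?n ?\<tau> \<boxtimes> ?s v)"
    unfolding word_value_def len
    by (rule Cmp_assoc_Arr[symmetric]) (use D \<sigma> \<tau> wA N v in auto)
  also have "\<dots> = Zero A (OObj P ?n \<odot> tensor A (replicate ?n v)) ?x"
    unfolding z using D \<sigma> \<tau> v by simp
  finally show ?thesis .
qed

end

section \<open>Reflexive graphs of algebras\<close>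

context operadic_category
begin

lemma underlying_triple [simp]: "underlying (X, f, Y) = f"
  by (simp add: underlying_def)

lemma fst_snd_underlying [simp]: "fst (snd F) = underlying F"
  by (simp add: underlying_def)

lemma algebra_arr_of_Arr: "F \<in> Arr (algebras A P) \<Longrightarrow> is_algebra_arr A P (fst F) (underlying F) (snd (snd F))"
  by (cases F) simp

end

locale algebra_graph = operadic_category A P
  for A :: "('o, 'm, 'z) monoidal_scheme" (structure) and P :: "('o, 'm) operad" +
  fixes G :: "('o, 'm) algebra_graph"
  assumes G: "is_reflexive_graph (algebras A P) G"
begin

abbreviation "s \<equiv> underlying (Gs G)"
abbreviation "t \<equiv> underlying (Gt G)"
abbreviation "i \<equiv> underlying (Gi G)"
abbreviation "pairs \<equiv> composable_pairs (algebras A P) G"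
abbreviation "triples \<equiv> composable_triples (algebras A P) G"
abbreviation "p \<equiv> underlying (fst pairs)"
abbreviation "q \<equiv> underlying (snd pairs)"
abbreviation "V \<equiv> fst (fst pairs)"

sublocale Alg: category "algebras A P"
  by (rule category_algebras)

lemma graph_arrs:
  "Gs G \<in> Arr (algebras A P)" "fst (Gs G) = GE G" "snd (snd (Gs G)) = GB G"
  "Gt G \<in> Arr (algebras A P)" "fst (Gt G) = GE G" "snd (snd (Gt G)) = GB G"
  "Gi G \<in> Arr (algebras A P)" "fst (Gi G) = GB G" "snd (snd (Gi G)) = GE G"
  "Gs G \<cdot>\<^bsub>algebras A P\<^esub> Gi G = Idn (algebras A P) (GB G)" "Gt G \<cdot>\<^bsub>algebras A P\<^esub> Gi G = Idn (algebras A P) (GB G)"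
  "is_algebra A P (GE G)" "is_algebra A P (GB G)"
  using G unfolding is_reflexive_graph_def Hom_iff by (auto simp del: algebras_simps(2,5,6))

lemma graph_algebra_arrs:
  "is_algebra_arr A P (GE G) s (GB G)" "is_algebra_arr A P (GE G) t (GB G)" "is_algebra_arr A P (GB G) i (GE G)"
  using algebra_arr_of_Arr[OF graph_arrs(1)] algebra_arr_of_Arr[OF graph_arrs(4)] algebra_arr_of_Arr[OF graph_arrs(7)]
  by (simp_all add: graph_arrs)

lemma pairs_pullback: "is_pullback (algebras A P) (Gs G) (Gt G) (fst pairs) (snd pairs)"
proof -
  obtain p' q' where "is_pullback (algebras A P) (Gs G) (Gt G) p' q'"
    using pullback_algebras_exists[OF graph_arrs(1,4)] by (metis graph_arrs(3,6))
  then show ?thesis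
    unfolding composable_pairs_def by (rule Alg.pullback_chosen)
qed

lemma pairs_arrs:
  "fst pairs \<in> Arr (algebras A P)" "snd pairs \<in> Arr (algebras A P)" "fst (snd pairs) = V"
  "snd (snd (fst pairs)) = GE G" "snd (snd (snd pairs)) = GE G"
  using Alg.is_pullbackD[OF pairs_pullback] by (simp_all add: graph_arrs del: algebras_simps(2,5,6))

lemma pairs_algebra_arrs: "is_algebra_arr A P V p (GE G)" "is_algebra_arr A P V q (GE G)"
  using algebra_arr_of_Arr[OF pairs_arrs(1)] algebra_arr_of_Arr[OF pairs_arrs(2)] by (simp_all add: pairs_arrs)

lemma triples_pullback:
  "is_pullback (algebras A P) (snd pairs) (fst pairs) (fst triples) (snd triples)"
proof -
  obtain p' q' where "is_pullback (algebras A P) (snd pairs) (fst pairs) p' q'"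
    using pullback_algebras_exists[OF pairs_arrs(2,1)] by (metis pairs_arrs(4,5))
  then show ?thesis
    unfolding composable_triples_def by (rule Alg.pullback_chosen)
qed

lemma carriers [simp]:
  "Dom A s = fst (GE G)" "Cod A s = fst (GB G)" "Dom A p = fst V" "is_algebra A P (GE G)"
  "is_algebra A P (GB G)" "is_algebra A P V"
  using graph_algebra_arrs pairs_algebra_arrs by (auto simp: is_algebra_arr_iff)

sublocale composable_graph A s t i p q
proof
  show "is_pullback A s t p q"
    by (rule pullback_underlying[OF pairs_pullback])
  show "s \<cdot> i = Idn A (Cod A s)" "t \<cdot> i = Idn A (Cod A s)"
    using graph_arrs(10,11) by (auto dest: arg_cong[of _ _ underlying])
qed (use graph_algebra_arrs in \<open>auto simp: is_algebra_arr_iff\<close>)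

lemma mid_algebra_arr: "is_algebra_arr A P V mid (GE G)"
  unfolding mid_def
  by (intro is_algebra_arr_Cmp[OF _ graph_algebra_arrs(3)] is_algebra_arr_Cmp[OF _ graph_algebra_arrs(1)] pairs_algebra_arrs)

text \<open>The generalised elements \<open>(g, i s g)\<close> and \<open>(i t f, f)\<close> of the object of composable pairs.\<close>

abbreviation "right_unit_pair \<equiv> pb_pair (algebras A P) pairs (Idn (algebras A P) (GE G)) (Gi G \<cdot>\<^bsub>algebras A P\<^esub> Gs G)"
abbreviation "left_unit_pair \<equiv> pb_pair (algebras A P) pairs (Gi G \<cdot>\<^bsub>algebras A P\<^esub> Gt G) (Idn (algebras A P) (GE G))"

lemma unit_pairs:
  "right_unit_pair \<in> Arr (algebras A P)" "fst right_unit_pair = GE G" "snd (snd right_unit_pair) = V"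
  "fst pairs \<cdot>\<^bsub>algebras A P\<^esub> right_unit_pair = Idn (algebras A P) (GE G)"
  "snd pairs \<cdot>\<^bsub>algebras A P\<^esub> right_unit_pair = Gi G \<cdot>\<^bsub>algebras A P\<^esub> Gs G"
  "left_unit_pair \<in> Arr (algebras A P)" "fst left_unit_pair = GE G" "snd (snd left_unit_pair) = V"
  "fst pairs \<cdot>\<^bsub>algebras A P\<^esub> left_unit_pair = Gi G \<cdot>\<^bsub>algebras A P\<^esub> Gt G"
  "snd pairs \<cdot>\<^bsub>algebras A P\<^esub> left_unit_pair = Idn (algebras A P) (GE G)"
proof -
  let ?I = "Idn (algebras A P) (GE G)" and ?s = "Gi G \<cdot>\<^bsub>algebras A P\<^esub> Gs G" and ?t = "Gi G \<cdot>\<^bsub>algebras A P\<^esub> Gt G"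
  have ty: "?I \<in> Arr (algebras A P)" "?s \<in> Arr (algebras A P)" "?t \<in> Arr (algebras A P)"
    using graph_arrs by (auto intro!: Alg.Cmp_Arr(1) Alg.Idn_Arr(1) simp del: algebras_simps(2,5,6))
  have fst: "fst ?I = GE G" "snd (snd ?I) = GE G" "fst ?s = GE G" "snd (snd ?s) = GE G" "fst ?t = GE G" "snd (snd ?t) = GE G"
    using graph_arrs by simp_all
  have eq: "Gs G \<cdot>\<^bsub>algebras A P\<^esub> ?I = Gt G \<cdot>\<^bsub>algebras A P\<^esub> ?s"
    "Gs G \<cdot>\<^bsub>algebras A P\<^esub> ?t = Gt G \<cdot>\<^bsub>algebras A P\<^esub> ?I"
    by (rule algebra_arr_eqI; simp add: graph_arrs)+
  note R = Alg.pb_pair_props[OF pairs_pullback ty(1,2) _ _ _ eq(1)]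
  note L = Alg.pb_pair_props[OF pairs_pullback ty(3,1) _ _ _ eq(2)]
  show "right_unit_pair \<in> Arr (algebras A P)" "fst right_unit_pair = GE G" "snd (snd right_unit_pair) = V"
    "fst pairs \<cdot>\<^bsub>algebras A P\<^esub> right_unit_pair = ?I" "snd pairs \<cdot>\<^bsub>algebras A P\<^esub> right_unit_pair = ?s"
    using R fst graph_arrs by (simp_all del: algebras_simps(2,5,6))
  show "left_unit_pair \<in> Arr (algebras A P)" "fst left_unit_pair = GE G" "snd (snd left_unit_pair) = V"
    "fst pairs \<cdot>\<^bsub>algebras A P\<^esub> left_unit_pair = ?t" "snd pairs \<cdot>\<^bsub>algebras A P\<^esub> left_unit_pair = ?I"
    using L fst graph_arrs by (simp_all del: algebras_simps(2,5,6))
qed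

lemma unit_pairs_underlying:
  "underlying right_unit_pair \<in> Arr A" "Dom A (underlying right_unit_pair) = fst (GE G)"
  "Cod A (underlying right_unit_pair) = fst V" "p \<cdot> underlying right_unit_pair = Idn A (fst (GE G))"
  "q \<cdot> underlying right_unit_pair = i \<cdot> s"
  "underlying left_unit_pair \<in> Arr A" "Dom A (underlying left_unit_pair) = fst (GE G)"
  "Cod A (underlying left_unit_pair) = fst V" "p \<cdot> underlying left_unit_pair = i \<cdot> t"
  "q \<cdot> underlying left_unit_pair = Idn A (fst (GE G))"
  using underlying_Arr[OF unit_pairs(1)] underlying_Arr[OF unit_pairs(6)] unit_pairs(2,3,7,8)
    arg_cong[OF unit_pairs(4), of underlying] arg_cong[OF unit_pairs(5), of underlying]
    arg_cong[OF unit_pairs(9), of underlying] arg_cong[OF unit_pairs(10), of underlying]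
  by (simp_all del: algebras_simps(2))

lemma internal_category_composition:
  assumes "is_internal_category (algebras A P) G c"
  shows "composition (underlying c)" "c = (V, underlying c, GE G)" "is_algebra_arr A P V (underlying c) (GE G)"
proof -
  let ?C = "algebras A P"
  have c: "c \<in> Hom ?C (Dom ?C (fst pairs)) (GE G)"
    and u: "c \<cdot>\<^bsub>?C\<^esub> right_unit_pair = Idn ?C (GE G)" and v: "c \<cdot>\<^bsub>?C\<^esub> left_unit_pair = Idn ?C (GE G)"
    using assms unfolding is_internal_category_def Let_def by blast+
  from c show eq: "c = (V, underlying c, GE G)"
    by (cases c) simp
  have "is_algebra_arr A P (fst c) (underlying c) (snd (snd c))"
    using c by (intro algebra_arr_of_Arr) (simp only: Hom_iff)
  then show arr: "is_algebra_arr A P V (underlying c) (GE G)"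
    by (subst (asm) (1 3) eq) simp
  show "composition (underlying c)"
  proof (rule composition_of_units[of "underlying c" "underlying right_unit_pair" "underlying left_unit_pair"])
    show "underlying c \<cdot> underlying right_unit_pair = Idn A (Dom A s)"
      using arg_cong[OF u, of underlying] by simp
    show "underlying c \<cdot> underlying left_unit_pair = Idn A (Dom A s)"
      using arg_cong[OF v, of underlying] by simp
  qed (use arr unit_pairs_underlying in \<open>simp_all add: is_algebra_arr_iff\<close>)
qed

lemma composition_internal_category:
  assumes c: "composition c" and arr: "is_algebra_arr A P V c (GE G)"
  shows "is_internal_category (algebras A P) G (V, c, GE G)"
proof -
  let ?C = "algebras A P" and ?c = "(V, c, GE G)"
  let ?a = "fst triples" and ?b = "snd triples"
  note T = Alg.is_pullbackD[OF triples_pullback]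
  have cA: "?c \<in> Arr ?C"
    using arr by simp
  have pa: "fst pairs \<cdot>\<^bsub>?C\<^esub> ?a \<in> Arr ?C" "snd pairs \<cdot>\<^bsub>?C\<^esub> ?b \<in> Arr ?C" "?c \<cdot>\<^bsub>?C\<^esub> ?a \<in> Arr ?C" "?c \<cdot>\<^bsub>?C\<^esub> ?b \<in> Arr ?C"
    using T cA pairs_arrs by (auto intro!: Alg.Cmp_Arr(1) simp del: algebras_simps(2,5,6))
  have ends: "snd (snd ?a) = V" "snd (snd ?b) = V" "fst ?b = fst ?a"
    using T pairs_arrs by (simp_all del: algebras_simps(2,5,6))
  have ua: "underlying ?a \<in> Arr A" "Cod A (underlying ?a) = fst V" "Dom A (underlying ?a) = fst (fst ?a)"
    and ub: "underlying ?b \<in> Arr A" "Cod A (underlying ?b) = fst V" "Dom A (underlying ?b) = fst (fst ?a)"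
    using underlying_Arr[OF T(4)] underlying_Arr[OF T(5)] ends by simp_all
  have qa: "q \<cdot> underlying ?a = p \<cdot> underlying ?b"
    using arg_cong[OF T(9), of underlying] by simp
  note C = compositionD[OF c]
  have sc: "s \<cdot> (c \<cdot> underlying ?a) = s \<cdot> (q \<cdot> underlying ?a)"
    by (rule Cmp_reassoc[OF composition_source[OF c]]) (use C ua in auto)
  have tc: "t \<cdot> (c \<cdot> underlying ?b) = t \<cdot> (p \<cdot> underlying ?b)"
    by (rule Cmp_reassoc[OF composition_target[OF c]]) (use C ub in auto)
  have eqx: "Gs G \<cdot>\<^bsub>?C\<^esub> (?c \<cdot>\<^bsub>?C\<^esub> ?a) = Gt G \<cdot>\<^bsub>?C\<^esub> (snd pairs \<cdot>\<^bsub>?C\<^esub> ?b)"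
    by (rule algebra_arr_eqI) (use ends graph_arrs sc qa tq_Cmp[OF ub(1)] ub in simp_all)
  have eqy: "Gs G \<cdot>\<^bsub>?C\<^esub> (fst pairs \<cdot>\<^bsub>?C\<^esub> ?a) = Gt G \<cdot>\<^bsub>?C\<^esub> (?c \<cdot>\<^bsub>?C\<^esub> ?b)"
    by (rule algebra_arr_eqI) (use ends graph_arrs tc qa[symmetric] tq_Cmp[OF ua(1)] ua in simp_all)
  let ?x = "pb_pair ?C pairs (?c \<cdot>\<^bsub>?C\<^esub> ?a) (snd pairs \<cdot>\<^bsub>?C\<^esub> ?b)"
  let ?y = "pb_pair ?C pairs (fst pairs \<cdot>\<^bsub>?C\<^esub> ?a) (?c \<cdot>\<^bsub>?C\<^esub> ?b)"
  note X = Alg.pb_pair_props[OF pairs_pullback pa(3,2) _ _ _ eqx]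
  note Y = Alg.pb_pair_props[OF pairs_pullback pa(1,4) _ _ _ eqy]
  have X': "?x \<in> Arr ?C" "fst ?x = fst ?a" "snd (snd ?x) = V" "p \<cdot> underlying ?x = c \<cdot> underlying ?a"
    "q \<cdot> underlying ?x = q \<cdot> underlying ?b"
    and Y': "?y \<in> Arr ?C" "fst ?y = fst ?a" "snd (snd ?y) = V" "p \<cdot> underlying ?y = p \<cdot> underlying ?a"
    "q \<cdot> underlying ?y = c \<cdot> underlying ?b"
  proof -
    have e: "Dom ?C (snd pairs \<cdot>\<^bsub>?C\<^esub> ?b) = Dom ?C (?c \<cdot>\<^bsub>?C\<^esub> ?a)" "Cod ?C (?c \<cdot>\<^bsub>?C\<^esub> ?a) = Dom ?C (Gs G)"
      "Cod ?C (snd pairs \<cdot>\<^bsub>?C\<^esub> ?b) = Dom ?C (Gt G)"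
      "Dom ?C (?c \<cdot>\<^bsub>?C\<^esub> ?b) = Dom ?C (fst pairs \<cdot>\<^bsub>?C\<^esub> ?a)" "Cod ?C (fst pairs \<cdot>\<^bsub>?C\<^esub> ?a) = Dom ?C (Gs G)"
      "Cod ?C (?c \<cdot>\<^bsub>?C\<^esub> ?b) = Dom ?C (Gt G)"
      using ends graph_arrs pairs_arrs by simp_all
    note X = X[OF e(1-3)] and Y = Y[OF e(4-6)]
    show "?x \<in> Arr ?C" "?y \<in> Arr ?C"
      by (fact X(1) Y(1))+
    show "fst ?x = fst ?a" "snd (snd ?x) = V" "fst ?y = fst ?a" "snd (snd ?y) = V"
      using X(2,3) Y(2,3) by simp_all
    show "p \<cdot> underlying ?x = c \<cdot> underlying ?a" "q \<cdot> underlying ?x = q \<cdot> underlying ?b"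
      "p \<cdot> underlying ?y = p \<cdot> underlying ?a" "q \<cdot> underlying ?y = c \<cdot> underlying ?b"
      using arg_cong[OF X(4), of underlying] arg_cong[OF X(5), of underlying]
        arg_cong[OF Y(4), of underlying] arg_cong[OF Y(5), of underlying] by simp_all
  qed
  have "c \<cdot> underlying ?x = c \<cdot> underlying ?y"
    by (rule composition_assoc[OF c ua(1) _ ub(1) _ _ qa])
      (use underlying_Arr[OF X'(1)] underlying_Arr[OF Y'(1)] X' Y' ua ub in simp_all)
  then have "?c \<cdot>\<^bsub>?C\<^esub> ?x = ?c \<cdot>\<^bsub>?C\<^esub> ?y"
    using X'(2) Y'(2) by simp
  moreover have "?c \<cdot>\<^bsub>?C\<^esub> right_unit_pair = Idn ?C (GE G)"
    by (rule algebra_arr_eqI)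
      (use unit_pairs(2) composition_right_unit[OF c unit_pairs_underlying(1)] unit_pairs_underlying in simp_all)
  moreover have "?c \<cdot>\<^bsub>?C\<^esub> left_unit_pair = Idn ?C (GE G)"
    by (rule algebra_arr_eqI)
      (use unit_pairs(7) composition_left_unit[OF c unit_pairs_underlying(6)] unit_pairs_underlying in simp_all)
  moreover have "Gs G \<cdot>\<^bsub>?C\<^esub> ?c = Gs G \<cdot>\<^bsub>?C\<^esub> snd pairs" "Gt G \<cdot>\<^bsub>?C\<^esub> ?c = Gt G \<cdot>\<^bsub>?C\<^esub> fst pairs"
    by (rule algebra_arr_eqI; simp add: pairs_arrs composition_source[OF c] composition_target[OF c])+
  ultimately show ?thesis
    unfolding is_internal_category_def Let_def using G cA by (simp del: algebras_simps(5,6))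
qed

lemma internal_category_iff:
  "is_internal_category (algebras A P) G c \<longleftrightarrow>
    (\<exists>c0. c = (V, c0, GE G) \<and> composition c0 \<and> is_algebra_arr A P V c0 (GE G))"
  using internal_category_composition composition_internal_category by blast

lemma internal_category_unique:
  "is_internal_category (algebras A P) G c \<Longrightarrow> is_internal_category (algebras A P) G d \<Longrightarrow> c = d"
  using composition_unique by (auto simp: internal_category_iff)

section \<open>The vanishing condition\<close>

abbreviation "ker_s \<equiv> kernel_arr A s"
abbreviation "ker_t \<equiv> kernel_arr A t"

lemma kernels:
  "is_kernel A s ker_s" "is_kernel A t ker_t"
  "ker_s \<in> Arr A" "Cod A ker_s = fst (GE G)" "s \<cdot> ker_s = Zero A (Dom A ker_s) (fst (GB G))"
  "ker_t \<in> Arr A" "Cod A ker_t = fst (GE G)" "t \<cdot> ker_t = Zero A (Dom A ker_t) (fst (GB G))"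
proof -
  show k: "is_kernel A s ker_s" "is_kernel A t ker_t"
    by (rule kernel_arr; simp)+
  show "ker_s \<in> Arr A" "Cod A ker_s = fst (GE G)" "s \<cdot> ker_s = Zero A (Dom A ker_s) (fst (GB G))"
    "ker_t \<in> Arr A" "Cod A ker_t = fst (GE G)" "t \<cdot> ker_t = Zero A (Dom A ker_t) (fst (GB G))"
    using is_kernelD[OF k(1)] is_kernelD[OF k(2)] by simp_all
qed

text \<open>The arities \<open>n \<ge> 2\<close> are written as \<open>m + 2\<close>, which removes the truncated subtraction.\<close>

lemma cat1_condition_iff:
  "cat1_condition A P G \<longleftrightarrow> (\<forall>m. word_value (GE G) (ker_s # ker_t # replicate m (Idn A (fst (GE G))))
    = Zero A (OObj P (Suc (Suc m)) \<odot> tensor A (Dom A ker_s # Dom A ker_t # replicate m (fst (GE G)))) (fst (GE G)))"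
proof -
  have "(\<forall>n\<ge>2. Q n) \<longleftrightarrow> (\<forall>m. Q (Suc (Suc m)))" for Q :: "nat \<Rightarrow> bool"
  proof
    assume Q: "\<forall>m. Q (Suc (Suc m))"
    show "\<forall>n\<ge>2. Q n"
    proof (intro allI impI)
      fix n :: nat assume "2 \<le> n"
      then have "n = Suc (Suc (n - 2))"
        by simp
      then show "Q n"
        using Q by metis
    qed
  qed simp
  then show ?thesis
    unfolding cat1_condition_def Let_def by (simp add: word_value_def alg_component_def)
qed

text \<open>
  With \<open>k\<close> and \<open>l\<close> the parts of \<open>p\<close> and \<open>q\<close> in the kernels, the value of every word that contains
  both letters is zero, so the telescope compares the \<open>n\<close>-ary operations on \<open>c\<close> with those on
  \<open>p\<close>, \<open>q\<close> and \<open>mid\<close>, which are algebra arrows.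
\<close>

lemma cat1_condition_imp_algebra_arr:
  assumes cat1: "cat1_condition A P G" and c: "composition c"
  shows "is_algebra_arr A P V c (GE G)"
proof -
  let ?E = "fst (GE G)" and ?v = "fst V" and ?T = "word_value (GE G)"
  define k where "k = p \<boxplus> neg mid"
  define l where "l = q \<boxplus> neg mid"
  note D = is_algebraD[OF carriers(4)] and DV = is_algebraD[OF carriers(6)]
  note C = compositionD[OF c]
  have k: "k \<in> Hom A ?v ?E" and l: "l \<in> Hom A ?v ?E" and mid: "mid \<in> Hom A ?v ?E"
    by (simp_all add: k_def l_def)
  have parts: "p = mid \<boxplus> k" "q = mid \<boxplus> l" "c = p \<boxplus> l" "c = q \<boxplus> k"
    using composition_split[OF c] by (simp_all add: k_def l_def)
  have "s \<cdot> k = Zero A ?v (fst (GB G))"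
    unfolding k_def using Cmp_diff_eq_Zero_iff[of s p mid] by (simp add: s_mid)
  then obtain k' where k': "k' \<in> Arr A" "Dom A k' = ?v" "Cod A k' = Dom A ker_s" "ker_s \<cdot> k' = k"
    using kernel_lift[OF kernels(1), of k thesis] k by auto
  have "t \<cdot> l = Zero A ?v (fst (GB G))"
    unfolding l_def using Cmp_diff_eq_Zero_iff[of t q mid] by (simp add: t_mid tq)
  then obtain l' where l': "l' \<in> Arr A" "Dom A l' = ?v" "Cod A l' = Dom A ker_t" "ker_t \<cdot> l' = l"
    using kernel_lift[OF kernels(2), of l thesis] l by auto
  have front: "?T (k # l # zs) = Zero A (OObj P (Suc (Suc (length zs))) \<odot> tensor A (replicate (Suc (Suc (length zs))) ?v)) ?E"
    if zs: "set zs \<subseteq> Hom A ?v ?E" for zs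
  proof -
    let ?w = "ker_s # ker_t # replicate (length zs) (Idn A ?E)" and ?w' = "k' # l' # zs"
    have idzs: "map2 (Cmp A) (replicate (length zs) (Idn A ?E)) zs = zs"
      using zs D by (intro nth_equalityI) (auto simp: subset_iff)
    have la: "list_all2 (\<lambda>g f. g \<in> Arr A \<and> f \<in> Arr A \<and> Cod A f = Dom A g) ?w ?w'"
    proof -
      have "list_all2 (\<lambda>g f. g \<in> Arr A \<and> f \<in> Arr A \<and> Cod A f = Dom A g) (replicate (length zs) (Idn A ?E)) zs"
        using zs D by (auto simp: list_all2_conv_all_nth subset_iff)
      then show ?thesis
        using kernels k' l' by simp
    qed
    have "?T (k # l # zs) = ?T (map2 (Cmp A) ?w ?w')"
      using k'(4) l'(4) idzs by simp
    also have "\<dots> = ?T ?w \<cdot> (Idn A (OObj P (length ?w)) \<boxtimes> tensor_arr A ?w')"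
      by (rule word_value_Cmp[OF carriers(4) la]) (use kernels D in simp)
    also have "\<dots> = Zero A (OObj P (Suc (Suc (length zs))) \<odot> tensor A (Dom A ker_s # Dom A ker_t # replicate (length zs) ?E)) ?E
        \<cdot> (Idn A (OObj P (length ?w)) \<boxtimes> tensor_arr A ?w')"
      using cat1 by (simp only: cat1_condition_iff)
    also have "\<dots> = Zero A (OObj P (Suc (Suc (length zs))) \<odot> tensor A (replicate (Suc (Suc (length zs))) ?v)) ?E"
    proof -
      have "set zs \<subseteq> Arr A" "map (Dom A) zs = replicate (length zs) ?v" "map (Cod A) zs = replicate (length zs) ?E"
        using Hom_subset_Arr[OF zs] map_Dom_Cod_Hom[OF zs] by auto
      then show ?thesis
        using k' l' D by simp
    qed
    finally show ?thesis .
  qed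
  have vanish: "?T (us @ k # vs) = Zero A (OObj P n \<odot> tensor A (replicate n ?v)) ?E"
    if w: "set us \<subseteq> Hom A ?v ?E" "set vs \<subseteq> Hom A ?v ?E" "length us + Suc (length vs) = n" "l \<in> set us \<union> set vs"
    for us vs n
  proof -
    let ?w = "us @ k # vs"
    have n: "length ?w = n"
      using w by simp
    obtain b where b: "b < length ?w" "b \<noteq> length us" "?w ! b = l"
    proof (cases "l \<in> set us")
      case True
      then obtain j where "j < length us" "us ! j = l"
        by (auto simp: in_set_conv_nth)
      then show ?thesis
        by (intro that[of j]) (auto simp: nth_append)
    next
      case False
      then obtain j where "j < length vs" "vs ! j = l"
        using w(4) by (auto simp: in_set_conv_nth)
      then show ?thesis
        by (intro that[of "Suc (length us + j)"]) (auto simp: nth_append)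
    qed
    have a: "length us < length ?w"
      by simp
    obtain \<sigma> zs where \<sigma>: "\<sigma> permutes {..<length ?w}" "perm_list \<sigma> ?w = ?w ! length us # ?w ! b # zs"
      "set zs \<subseteq> set ?w" "length ?w = Suc (Suc (length zs))"
      by (rule perm_list_front[OF a b(1) b(2)[symmetric]])
    have ww: "set ?w \<subseteq> Hom A ?v ?E"
      using w k by auto
    have "?T (perm_list \<sigma> ?w) = Zero A (OObj P (length ?w) \<odot> tensor A (replicate (length ?w) ?v)) ?E"
      unfolding \<sigma>(2,4) using front[OF subset_trans[OF \<sigma>(3) ww]] b(3) by simp
    then have "?T ?w = Zero A (OObj P (length ?w) \<odot> tensor A (replicate (length ?w) ?v)) ?E"
      by (rule word_value_perm[OF carriers(4) ww \<sigma>(1)]) (use DV in simp)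
    then show ?thesis
      unfolding n .
  qed
  have "c \<cdot> alg_component A P V n = alg_component A P (GE G) n \<cdot> op_power n c" for n
  proof -
    let ?X = "OObj P n \<odot> tensor A (replicate n ?v)"
    have "?T (replicate 0 p @ replicate n c) \<boxplus> ?T (replicate n mid) = ?T (replicate n p) \<boxplus> ?T (replicate 0 mid @ replicate n q)"
    proof (rule multilinear_telescope[where T = ?T and n = n and v = ?v and E = ?E and k = k and l = l and x = ?X and y = ?E])
      show "?T w \<in> Hom A ?X ?E" if "set w \<subseteq> Hom A ?v ?E" "length w = n" for w
        using word_value_Arr[OF carriers(4) Hom_subset_Arr[OF that(1)]] map_Dom_Cod_Hom[OF that(1)] that(2) by simp
      show "?T (us @ (f \<boxplus> g) # vs) = ?T (us @ f # vs) \<boxplus> ?T (us @ g # vs)"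
        if "set us \<subseteq> Hom A ?v ?E" "set vs \<subseteq> Hom A ?v ?E" "f \<in> Hom A ?v ?E" "g \<in> Hom A ?v ?E" for us vs f g
        by (rule word_value_Add[OF carriers(4) that])
    qed (use k l mid parts vanish in auto)
    then have "alg_component A P (GE G) n \<cdot> op_power n c \<boxplus> alg_component A P (GE G) n \<cdot> op_power n mid
        = alg_component A P (GE G) n \<cdot> op_power n p \<boxplus> alg_component A P (GE G) n \<cdot> op_power n q"
      by (simp add: word_value_replicate)
    also have "\<dots> = p \<cdot> alg_component A P V n \<boxplus> q \<cdot> alg_component A P V n"
      using pairs_algebra_arrs by (simp add: is_algebra_arr_iff)
    also have "\<dots> = c \<cdot> alg_component A P V n \<boxplus> mid \<cdot> alg_component A P V n"
      by (rule composition_Cmp[OF c, symmetric]) (use DV in auto)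
    also have "mid \<cdot> alg_component A P V n = alg_component A P (GE G) n \<cdot> op_power n mid"
      using mid_algebra_arr by (simp add: is_algebra_arr_iff)
    finally show ?thesis
      by (subst (asm) Add_right_cancel) (use C D DV in auto)
  qed
  then show ?thesis
    using C D DV by (simp add: is_algebra_arr_iff)
qed

text \<open>
  Evaluation of the four algebra arrows \<open>c\<close>, \<open>mid\<close>, \<open>p\<close>, \<open>q\<close> at \<open>\<alpha> = (k, 0)\<close>, \<open>\<beta> = (0, l)\<close> and
  \<open>\<gamma> = (x, i s x)\<close>: in the last three words a zero occurs.
\<close>

lemma algebra_arr_imp_cat1_condition:
  assumes c: "composition c" and arr: "is_algebra_arr A P V c (GE G)"
  shows "cat1_condition A P G"
  unfolding cat1_condition_iff
proof
  fix m
  let ?E = "fst (GE G)" and ?B = "fst (GB G)" and ?K = "Dom A ker_s" and ?L = "Dom A ker_t"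
  note D = is_algebraD[OF carriers(4)] and DB = is_algebraD[OF carriers(5)] and DV = is_algebraD[OF carriers(6)]
  note C = compositionD[OF c]
  have KL: "?K \<in> Obj A" "?L \<in> Obj A"
    using kernels by auto
  obtain \<alpha> where \<alpha>: "\<alpha> \<in> Arr A" "Dom A \<alpha> = ?K" "Cod A \<alpha> = fst V" "p \<cdot> \<alpha> = ker_s" "q \<cdot> \<alpha> = Zero A ?K ?E"
    using pullback_lift[OF pb, of ker_s "Zero A ?K ?E" thesis] kernels KL D by auto
  obtain \<beta> where \<beta>: "\<beta> \<in> Arr A" "Dom A \<beta> = ?L" "Cod A \<beta> = fst V" "p \<cdot> \<beta> = Zero A ?L ?E" "q \<cdot> \<beta> = ker_t"
    using pullback_lift[OF pb, of "Zero A ?L ?E" ker_t thesis] kernels KL D by auto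
  obtain \<gamma> where \<gamma>: "\<gamma> \<in> Arr A" "Dom A \<gamma> = ?E" "Cod A \<gamma> = fst V" "p \<cdot> \<gamma> = Idn A ?E" "q \<cdot> \<gamma> = i \<cdot> s"
    using unit_pairs_underlying(1-5) by blast
  have m\<alpha>: "mid \<cdot> \<alpha> = Zero A ?K ?E" and m\<beta>: "mid \<cdot> \<beta> = Zero A ?L ?E"
    using \<alpha> \<beta> kernels KL D DB by (simp_all add: mid_Cmp)
  have c\<alpha>: "c \<cdot> \<alpha> = ker_s"
    using composition_Cmp[OF c, of \<alpha>] \<alpha> m\<alpha> kernels KL D C by simp
  have c\<beta>: "c \<cdot> \<beta> = ker_t"
    using composition_Cmp[OF c, of \<beta>] \<beta> m\<beta> kernels KL D C by simp
  have c\<gamma>: "c \<cdot> \<gamma> = Idn A ?E"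
    using composition_right_unit[OF c, of \<gamma>] \<gamma> by simp
  let ?w = "\<alpha> # \<beta> # replicate m \<gamma>"
  let ?X = "OObj P (Suc (Suc m)) \<odot> tensor A (?K # ?L # replicate m ?E)"
  let ?W = "word_value V ?w"
  have wA: "set ?w \<subseteq> Arr A" "map (Cod A) ?w = replicate (length ?w) (fst V)"
    using \<alpha> \<beta> \<gamma> by auto
  have W: "?W \<in> Arr A" "Dom A ?W = ?X" "Cod A ?W = fst V"
    using word_value_Arr[OF carriers(6) wA] \<alpha>(2) \<beta>(2) \<gamma>(2) by simp_all
  have zero1: "word_value (GE G) (a # Zero A ?L ?E # replicate m b) = Zero A ?X ?E"
    if "a \<in> Hom A ?K ?E" "b \<in> Hom A ?E ?E" for a b
    using word_value_Zero[OF carriers(4), of "[a]" "replicate m b" ?L] that KL by simp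
  have zero0: "word_value (GE G) (Zero A ?K ?E # a # replicate m b) = Zero A ?X ?E"
    if "a \<in> Hom A ?L ?E" "b \<in> Hom A ?E ?E" for a b
    using word_value_Zero[OF carriers(4), of "[]" "a # replicate m b" ?K] that KL by simp
  have "p \<cdot> ?W = Zero A ?X ?E"
    using word_value_algebra_arr[OF pairs_algebra_arrs(1) wA] \<alpha> \<beta> \<gamma> kernels D zero1[of ker_s "Idn A ?E"] by simp
  moreover have "q \<cdot> ?W = Zero A ?X ?E"
    using word_value_algebra_arr[OF pairs_algebra_arrs(2) wA] \<alpha> \<beta> \<gamma> kernels D zero0[of ker_t "i \<cdot> s"] by simp
  moreover have "mid \<cdot> ?W = Zero A ?X ?E"
    using word_value_algebra_arr[OF mid_algebra_arr wA] \<alpha> \<beta> \<gamma> m\<alpha> m\<beta> KL D zero0[of "Zero A ?L ?E" "mid \<cdot> \<gamma>"] by simp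
  moreover have "c \<cdot> ?W \<boxplus> mid \<cdot> ?W = p \<cdot> ?W \<boxplus> q \<cdot> ?W"
    by (rule composition_Cmp[OF c W(1)]) (use W(3) in simp)
  moreover have X: "?X \<in> Obj A"
    using Dom_Obj[OF W(1)] W(2) by simp
  ultimately have "c \<cdot> ?W = Zero A ?X ?E"
    using W C D by simp
  then show "word_value (GE G) (ker_s # ker_t # replicate m (Idn A ?E)) = Zero A ?X ?E"
    using word_value_algebra_arr[OF arr wA] c\<alpha> c\<beta> c\<gamma> by simp
qed

lemma internal_category_exists_iff:
  "(\<exists>c. is_internal_category (algebras A P) G c) \<longleftrightarrow> cat1_condition A P G"
proof
  assume "\<exists>c. is_internal_category (algebras A P) G c"
  then show "cat1_condition A P G"
    using algebra_arr_imp_cat1_condition by (auto simp: internal_category_iff)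
next
  assume "cat1_condition A P G"
  moreover obtain c where "composition c"
    using composition_exists by blast
  ultimately show "\<exists>c. is_internal_category (algebras A P) G c"
    using cat1_condition_imp_algebra_arr by (auto simp: internal_category_iff)
qed

end

section \<open>The categories of graphs and of internal categories\<close>

context category
begin

lemma is_graph_arrD:
  assumes "is_graph_arr C X \<phi> Y"
  shows "fst \<phi> \<in> Arr C" "Dom C (fst \<phi>) = GE X" "Cod C (fst \<phi>) = GE Y"
    "snd \<phi> \<in> Arr C" "Dom C (snd \<phi>) = GB X" "Cod C (snd \<phi>) = GB Y"
    "Gs Y \<cdot> fst \<phi> = snd \<phi> \<cdot> Gs X" "Gt Y \<cdot> fst \<phi> = snd \<phi> \<cdot> Gt X" "Gi Y \<cdot> snd \<phi> = fst \<phi> \<cdot> Gi X"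
    "is_reflexive_graph C X" "is_reflexive_graph C Y"
  using assms by (auto simp: is_graph_arr_def)

lemma is_reflexive_graphD:
  assumes "is_reflexive_graph C X"
  shows "GE X \<in> Obj C" "GB X \<in> Obj C" "Gs X \<in> Arr C" "Dom C (Gs X) = GE X" "Cod C (Gs X) = GB X"
    "Gt X \<in> Arr C" "Dom C (Gt X) = GE X" "Cod C (Gt X) = GB X"
    "Gi X \<in> Arr C" "Dom C (Gi X) = GB X" "Cod C (Gi X) = GE X"
  using assms by (auto simp: is_reflexive_graph_def)

lemma is_graph_arr_Idn: "is_reflexive_graph C X \<Longrightarrow> is_graph_arr C X (Idn C (GE X), Idn C (GB X)) X"
  using is_reflexive_graphD[of X] by (simp add: is_graph_arr_def)

lemma is_graph_arr_Cmp:
  assumes "is_graph_arr C X \<phi> Y" "is_graph_arr C Y \<psi> Z"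
  shows "is_graph_arr C X (fst \<psi> \<cdot> fst \<phi>, snd \<psi> \<cdot> snd \<phi>) Z"
proof -
  note F = is_graph_arrD[OF assms(1)] and G = is_graph_arrD[OF assms(2)]
  note X = is_reflexive_graphD[OF F(10)] and Y = is_reflexive_graphD[OF G(10)] and Z = is_reflexive_graphD[OF G(11)]
  have "a \<cdot> (v \<cdot> u) = (v' \<cdot> u') \<cdot> b"
    if "a \<cdot> v = v' \<cdot> m" "m \<cdot> u = u' \<cdot> b" "a \<in> Arr C" "v \<in> Arr C" "u \<in> Arr C" "v' \<in> Arr C" "u' \<in> Arr C" "m \<in> Arr C"
      "b \<in> Arr C" "Cod C u = Dom C v" "Cod C v = Dom C a" "Dom C m = Dom C v" "Cod C m = Dom C v'"
      "Cod C u' = Dom C v'" "Cod C b = Dom C u'" for a v u v' u' m b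
  proof -
    have "a \<cdot> (v \<cdot> u) = v' \<cdot> (m \<cdot> u)"
      by (rule Cmp_reassoc[OF that(1)]) (use that(3-) in auto)
    also have "\<dots> = (v' \<cdot> u') \<cdot> b"
      unfolding that(2) using that(3-) by simp
    finally show ?thesis .
  qed
  note sq = this
  have "Gs Z \<cdot> (fst \<psi> \<cdot> fst \<phi>) = (snd \<psi> \<cdot> snd \<phi>) \<cdot> Gs X" "Gt Z \<cdot> (fst \<psi> \<cdot> fst \<phi>) = (snd \<psi> \<cdot> snd \<phi>) \<cdot> Gt X"
    "Gi Z \<cdot> (snd \<psi> \<cdot> snd \<phi>) = (fst \<psi> \<cdot> fst \<phi>) \<cdot> Gi X"
    by (rule sq[OF G(7) F(7)] sq[OF G(8) F(8)] sq[OF G(9) F(9)];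
        use F(1-6) G(1-6) X Y Z in simp)+
  then show ?thesis
    using F(1-6,10) G(1-6,11) by (simp add: is_graph_arr_def)
qed

lemma reflexive_graphs_simps [simp]:
  "Obj (reflexive_graphs C) = {G. is_reflexive_graph C G}"
  "Arr (reflexive_graphs C) = {(G, \<phi>, H). is_graph_arr C G \<phi> H}"
  "Dom (reflexive_graphs C) u = fst u" "Cod (reflexive_graphs C) u = snd (snd u)"
  "Idn (reflexive_graphs C) G = (G, (Idn C (GE G), Idn C (GB G)), G)"
  "v \<cdot>\<^bsub>reflexive_graphs C\<^esub> u = (fst u,
     (fst (fst (snd v)) \<cdot> fst (fst (snd u)), snd (fst (snd v)) \<cdot> snd (fst (snd u))), snd (snd v))"
  by (simp_all add: reflexive_graphs_def)

lemma category_reflexive_graphs: "category (reflexive_graphs C)"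
proof
  fix f g h a b c d
  assume f: "f \<in> Hom (reflexive_graphs C) a b"
  then obtain \<phi> where \<phi>: "f = (a, \<phi>, b)" "is_graph_arr C a \<phi> b"
    by (cases f) auto
  show "f \<cdot>\<^bsub>reflexive_graphs C\<^esub> Idn (reflexive_graphs C) a = f"
    "Idn (reflexive_graphs C) b \<cdot>\<^bsub>reflexive_graphs C\<^esub> f = f"
    using \<phi> is_graph_arrD[OF \<phi>(2)] by simp_all
  assume g: "g \<in> Hom (reflexive_graphs C) b c"
  then obtain \<psi> where \<psi>: "g = (b, \<psi>, c)" "is_graph_arr C b \<psi> c"
    by (cases g) auto
  show "g \<cdot>\<^bsub>reflexive_graphs C\<^esub> f \<in> Hom (reflexive_graphs C) a c"
    using \<phi> \<psi> is_graph_arr_Cmp[OF \<phi>(2) \<psi>(2)] by simp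
  assume h: "h \<in> Hom (reflexive_graphs C) c d"
  then obtain \<chi> where \<chi>: "h = (c, \<chi>, d)" "is_graph_arr C c \<chi> d"
    by (cases h) auto
  show "h \<cdot>\<^bsub>reflexive_graphs C\<^esub> (g \<cdot>\<^bsub>reflexive_graphs C\<^esub> f) = h \<cdot>\<^bsub>reflexive_graphs C\<^esub> g \<cdot>\<^bsub>reflexive_graphs C\<^esub> f"
    using \<phi>(1) \<psi>(1) \<chi>(1) is_graph_arrD[OF \<phi>(2)] is_graph_arrD[OF \<psi>(2)] is_graph_arrD[OF \<chi>(2)] by simp
qed (auto simp: is_graph_arr_Idn dest: is_graph_arrD)

end

lemma category_full_subcategory:
  assumes "category C"
  shows "category (full_subcategory C S)"
proof -
  interpret category C
    by (rule assms)
  show ?thesis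
    by unfold_locales (auto simp: full_subcategory_def)
qed

lemma internal_categories_simps [simp]:
  "Obj (internal_categories C) = {X. is_internal_category C (fst X) (snd X)}"
  "Arr (internal_categories C) = {(X, \<phi>, Y). is_internal_functor C X \<phi> Y}"
  "Dom (internal_categories C) u = fst u" "Cod (internal_categories C) u = snd (snd u)"
  "Idn (internal_categories C) X = (X, (Idn C (GE (fst X)), Idn C (GB (fst X))), X)"
  "v \<cdot>\<^bsub>internal_categories C\<^esub> u = (fst u,
     (fst (fst (snd v)) \<cdot>\<^bsub>C\<^esub> fst (fst (snd u)), snd (fst (snd v)) \<cdot>\<^bsub>C\<^esub> snd (fst (snd u))), snd (snd v))"
  by (simp_all add: internal_categories_def)

lemma is_internal_category_graph: "is_internal_category C G c \<Longrightarrow> is_reflexive_graph C G"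
  by (simp add: is_internal_category_def)

lemma is_internal_functorD:
  "is_internal_functor C X \<phi> Y \<Longrightarrow> is_internal_category C (fst X) (snd X) \<and>
    is_internal_category C (fst Y) (snd Y) \<and> is_graph_arr C (fst X) \<phi> (fst Y)"
  by (simp add: is_internal_functor_def)

text \<open>
  If a graph carries at most one internal category structure and graph morphisms preserve it, then
  forgetting the composition identifies the internal categories with a full subcategory of the
  graphs.
\<close>

lemma (in category) internal_categories_iso:
  assumes unique: "\<And>G c d. is_internal_category C G c \<Longrightarrow> is_internal_category C G d \<Longrightarrow> c = d"
    and graph_arr_functor: "\<And>X \<phi> Y. is_internal_category C (fst X) (snd X) \<Longrightarrow> is_internal_category C (fst Y) (snd Y) \<Longrightarrow>
      is_graph_arr C (fst X) \<phi> (fst Y) \<Longrightarrow> is_internal_functor C X \<phi> Y"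
    and S: "\<And>G. is_reflexive_graph C G \<Longrightarrow> S G \<longleftrightarrow> (\<exists>c. is_internal_category C G c)"
    and D: "D = full_subcategory (reflexive_graphs C) S"
  shows "\<exists>Fo Fa. category_iso D (internal_categories C) Fo Fa \<and>
    (\<forall>G \<in> Obj D. fst (Fo G) = G) \<and> (\<forall>\<phi> \<in> Arr D. underlying_graph_arr (Fa \<phi>) = \<phi>)"
proof -
  let ?I = "internal_categories C"
  have D_simps: "Obj D = {G. is_reflexive_graph C G \<and> S G}"
    "Arr D = {(G, \<phi>, H). is_graph_arr C G \<phi> H \<and> S G \<and> S H}"
    "\<And>u. Dom D u = fst u" "\<And>u. Cod D u = snd (snd u)"
    "\<And>G. Idn D G = (G, (Idn C (GE G), Idn C (GB G)), G)"
    "\<And>u v. v \<cdot>\<^bsub>D\<^esub> u = (fst u,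
       (fst (fst (snd v)) \<cdot> fst (fst (snd u)), snd (fst (snd v)) \<cdot> snd (fst (snd u))), snd (snd v))"
    unfolding D full_subcategory_def by (auto simp: reflexive_graphs_def)
  have catD: "category D"
    unfolding D by (intro category_full_subcategory category_reflexive_graphs)
  have fun_iff: "is_internal_functor C X \<phi> Y \<longleftrightarrow> is_internal_category C (fst X) (snd X) \<and>
      is_internal_category C (fst Y) (snd Y) \<and> is_graph_arr C (fst X) \<phi> (fst Y)" for X \<phi> Y
    using graph_arr_functor is_internal_functorD by blast
  have catI: "category ?I"
  proof
    fix f g h a b c d
    assume f: "f \<in> Hom ?I a b"
    then obtain \<phi> where \<phi>: "f = (a, \<phi>, b)" "is_graph_arr C (fst a) \<phi> (fst b)"
      "is_internal_category C (fst a) (snd a)" "is_internal_category C (fst b) (snd b)"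
      by (cases f) (auto simp: fun_iff)
    show "f \<cdot>\<^bsub>?I\<^esub> Idn ?I a = f" "Idn ?I b \<cdot>\<^bsub>?I\<^esub> f = f"
      using \<phi> is_graph_arrD[OF \<phi>(2)] by simp_all
    assume g: "g \<in> Hom ?I b c"
    then obtain \<psi> where \<psi>: "g = (b, \<psi>, c)" "is_graph_arr C (fst b) \<psi> (fst c)"
      "is_internal_category C (fst c) (snd c)"
      by (cases g) (auto simp: fun_iff)
    show "g \<cdot>\<^bsub>?I\<^esub> f \<in> Hom ?I a c"
      using \<phi> \<psi> is_graph_arr_Cmp[OF \<phi>(2) \<psi>(2)] by (simp add: fun_iff)
    assume h: "h \<in> Hom ?I c d"
    then obtain \<chi> where \<chi>: "h = (c, \<chi>, d)" "is_graph_arr C (fst c) \<chi> (fst d)"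
      by (cases h) (auto simp: fun_iff)
    show "h \<cdot>\<^bsub>?I\<^esub> (g \<cdot>\<^bsub>?I\<^esub> f) = h \<cdot>\<^bsub>?I\<^esub> g \<cdot>\<^bsub>?I\<^esub> f"
      using \<phi>(1) \<psi>(1) \<chi>(1) is_graph_arrD[OF \<phi>(2)] is_graph_arrD[OF \<psi>(2)] is_graph_arrD[OF \<chi>(2)] by simp
  qed (auto simp: fun_iff is_graph_arr_Idn is_internal_category_graph)
  define comp where "comp G = (SOME c. is_internal_category C G c)" for G
  have comp: "is_internal_category C G (comp G)" if "is_reflexive_graph C G" "S G" for G
    using S[OF that(1)] that(2) unfolding comp_def by (metis someI_ex)
  have comp_eq: "comp G = c" if "is_internal_category C G c" for G c
    using that unique unfolding comp_def by (metis someI)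
  have S_of: "S G" if "is_internal_category C G c" for G c
    using S[OF is_internal_category_graph[OF that]] that by blast
  let ?Fo = "\<lambda>G. (G, comp G)"
  let ?Fa = "\<lambda>u. (?Fo (fst u), fst (snd u), ?Fo (snd (snd u)))"
  have F: "is_functor D ?I ?Fo ?Fa"
    unfolding is_functor_def is_functor_axioms_def
    using catD catI comp by (auto simp: D_simps fun_iff dest: is_graph_arrD(10,11))
  have H: "is_functor ?I D fst underlying_graph_arr"
    unfolding is_functor_def is_functor_axioms_def
    using catD catI S_of by (auto simp: D_simps fun_iff underlying_graph_arr_def dest: is_internal_category_graph)
  have inv: "\<forall>a \<in> Obj D. fst (?Fo a) = a" "\<forall>f \<in> Arr D. underlying_graph_arr (?Fa f) = f"
    "\<forall>b \<in> Obj ?I. ?Fo (fst b) = b" "\<forall>g \<in> Arr ?I. ?Fa (underlying_graph_arr g) = g"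
    using comp_eq by (auto simp: underlying_graph_arr_def fun_iff)
  have "category_iso D ?I ?Fo ?Fa"
    unfolding category_iso_def using F H inv by blast
  then show ?thesis
    using inv(1,2) by blast
qed

section \<open>The isomorphism of categories\<close>

text \<open>
  A morphism of reflexive graphs is additive on the underlying objects, so it commutes with the
  composition \<open>g + f - i s g\<close>.
\<close>

lemma (in operadic_category) graph_arr_is_internal_functor:
  assumes X: "is_internal_category (algebras A P) (fst X) (snd X)"
    and Y: "is_internal_category (algebras A P) (fst Y) (snd Y)"
    and \<phi>: "is_graph_arr (algebras A P) (fst X) \<phi> (fst Y)"
  shows "is_internal_functor (algebras A P) X \<phi> Y"
proof -
  let ?C = "algebras A P"
  interpret X: algebra_graph A P "fst X"
    by unfold_locales (rule is_internal_category_graph[OF X])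
  interpret Y: algebra_graph A P "fst Y"
    by unfold_locales (rule is_internal_category_graph[OF Y])
  note ph = X.Alg.is_graph_arrD[OF \<phi>]
  let ?f = "underlying (fst \<phi>)" and ?g = "underlying (snd \<phi>)"
  let ?u = "fst \<phi> \<cdot>\<^bsub>?C\<^esub> fst X.pairs" and ?v = "fst \<phi> \<cdot>\<^bsub>?C\<^esub> snd X.pairs"
  let ?w = "pb_pair ?C Y.pairs ?u ?v"
  note CX = X.internal_category_composition[OF X] and CY = Y.internal_category_composition[OF Y]
  note cX = X.compositionD[OF CX(1)] and cY = Y.compositionD[OF CY(1)]
  have f: "?f \<in> Arr A" "Dom A ?f = fst (GE (fst X))" "Cod A ?f = fst (GE (fst Y))"
    "?g \<in> Arr A" "Dom A ?g = fst (GB (fst X))" "Cod A ?g = fst (GB (fst Y))"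
    using underlying_Arr[OF ph(1)] underlying_Arr[OF ph(4)] ph(2,3,5,6) by simp_all
  have fs: "Y.s \<cdot> ?f = ?g \<cdot> X.s" and ft: "Y.t \<cdot> ?f = ?g \<cdot> X.t" and fi: "Y.i \<cdot> ?g = ?f \<cdot> X.i"
    using arg_cong[OF ph(7), of underlying] arg_cong[OF ph(8), of underlying] arg_cong[OF ph(9), of underlying]
    by simp_all
  have fsp: "Y.s \<cdot> (?f \<cdot> X.p) = ?g \<cdot> (X.s \<cdot> X.p)" and ftq: "Y.t \<cdot> (?f \<cdot> X.q) = ?g \<cdot> (X.t \<cdot> X.q)"
    by (rule Cmp_reassoc[OF fs] Cmp_reassoc[OF ft]; use f in simp)+
  have ends: "fst (fst \<phi>) = GE (fst X)" "snd (snd (fst \<phi>)) = GE (fst Y)"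
    using ph(2,3) by simp_all
  have uv: "?u \<in> Arr ?C" "?v \<in> Arr ?C"
    using ph(1) X.pairs_arrs ends by (auto intro!: X.Alg.Cmp_Arr(1) simp del: algebras_simps(2,5,6))
  have "Gs (fst Y) \<cdot>\<^bsub>?C\<^esub> ?u = Gt (fst Y) \<cdot>\<^bsub>?C\<^esub> ?v"
    by (rule algebra_arr_eqI) (use fsp ftq X.tq X.pairs_arrs Y.graph_arrs in simp_all)
  from X.Alg.pb_pair_props[OF Y.pairs_pullback uv _ _ _ this]
  have w: "?w \<in> Arr ?C" "fst ?w = X.V" "snd (snd ?w) = Y.V" "fst Y.pairs \<cdot>\<^bsub>?C\<^esub> ?w = ?u" "snd Y.pairs \<cdot>\<^bsub>?C\<^esub> ?w = ?v"
    using ends X.pairs_arrs Y.graph_arrs by (simp_all del: algebras_simps(2))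
  have uw: "underlying ?w \<in> Arr A" "Dom A (underlying ?w) = fst X.V" "Cod A (underlying ?w) = fst Y.V"
    "Y.p \<cdot> underlying ?w = ?f \<cdot> X.p" "Y.q \<cdot> underlying ?w = ?f \<cdot> X.q"
    using underlying_Arr[OF w(1)] w(2,3) arg_cong[OF w(4), of underlying] arg_cong[OF w(5), of underlying]
    by simp_all
  have "Y.mid \<cdot> underlying ?w = ?f \<cdot> X.mid"
  proof -
    have "Y.mid \<cdot> underlying ?w = Y.i \<cdot> (?g \<cdot> (X.s \<cdot> X.p))"
      using Y.mid_Cmp[OF uw(1)] uw fsp by simp
    also have "\<dots> = ?f \<cdot> (X.i \<cdot> (X.s \<cdot> X.p))"
      by (rule Cmp_reassoc[OF fi]) (use f in simp_all)
    finally show ?thesis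
      by (simp add: X.mid_def)
  qed
  then have "underlying (snd Y) \<cdot> underlying ?w \<boxplus> ?f \<cdot> X.mid = ?f \<cdot> underlying (snd X) \<boxplus> ?f \<cdot> X.mid"
    using Y.composition_Cmp[OF CY(1) uw(1)] X.composition_Cmp_left[OF CX(1) f(1)] uw f by simp
  then have "?f \<cdot> underlying (snd X) = underlying (snd Y) \<cdot> underlying ?w"
    by (subst (asm) Add_right_cancel) (use cX cY uw f in auto)
  then have "fst \<phi> \<cdot>\<^bsub>?C\<^esub> snd X = snd Y \<cdot>\<^bsub>?C\<^esub> ?w"
    by (intro algebra_arr_eqI)
      (use w(2) ends arg_cong[OF CX(2), of fst] arg_cong[OF CY(2), of "\<lambda>z. snd (snd z)"] in simp_all)
  then show ?thesis
    unfolding is_internal_functor_def Let_def using X Y \<phi> by blast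
qed

text \<open>
  A sequence of objects is a diagram on the discrete category on a countable subset of the infinite
  type that measures smallness.
\<close>

lemma bicomplete_sequential_coproduct:
  fixes C :: "('o, 'm, 'z) category_scheme"
  assumes inf: "infinite (UNIV :: 'i set)" and cat: "category C" and bi: "bicomplete TYPE('i) C"
    and a: "\<And>n. a n \<in> Obj C"
  shows "\<exists>x \<iota>. is_coproduct C a x \<iota>"
proof -
  interpret category C
    by (rule cat)
  obtain e :: "nat \<Rightarrow> 'i" where e: "inj e"
    using infinite_countable_subset[OF inf] by blast
  define J :: "('i, 'i) category" where
    "J = \<lparr>Obj = range e, Arr = range e, Dom = id, Cod = id, Idn = id, Cmp = (\<lambda>g f. f)\<rparr>"
  let ?Do = "\<lambda>j. a (inv_into UNIV e j)"
  let ?Da = "\<lambda>j. Idn C (?Do j)"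
  have J: "category J"
    by unfold_locales (auto simp: J_def)
  have "is_functor J C ?Do ?Da"
    unfolding is_functor_def is_functor_axioms_def using J cat a by (auto simp: J_def)
  then obtain x c where col: "is_colimit J C ?Do ?Da x c"
    using bi unfolding bicomplete_def by blast
  have inv: "inv_into UNIV e (e n) = n" for n
    by (rule inv_f_f[OF e])
  have co: "is_cocone J C ?Do ?Da y d \<longleftrightarrow> y \<in> Obj C \<and> (\<forall>n. d (e n) \<in> Hom C (a n) y)" for y d
    unfolding is_cocone_def by (auto simp: J_def inv a)
  have "\<exists>!h. h \<in> Hom C x y \<and> (\<forall>n. h \<cdot>\<^bsub>C\<^esub> c (e n) = f n)" if y: "y \<in> Obj C" "\<forall>n. f n \<in> Hom C (a n) y" for y f
  proof -
    have "is_cocone J C ?Do ?Da y (\<lambda>j. f (inv_into UNIV e j))"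
      using y by (simp add: co inv)
    then have "\<exists>!h. h \<in> Hom C x y \<and> (\<forall>j \<in> Obj J. h \<cdot>\<^bsub>C\<^esub> c j = f (inv_into UNIV e j))"
      using col unfolding is_colimit_def by blast
    then show ?thesis
      by (simp add: J_def inv)
  qed
  moreover have "x \<in> Obj C \<and> (\<forall>n. c (e n) \<in> Hom C (a n) x)"
    using col by (simp add: is_colimit_def co)
  ultimately have "is_coproduct C a x (\<lambda>n. c (e n))"
    unfolding is_coproduct_def by blast
  then show ?thesis
    by blast
qed

theorem theorem22:
  fixes A :: "('o, 'm) monoidal" and P :: "('o, 'm) operad"
  assumes "infinite (UNIV :: 'i set)"
    and "abelian_category A"
    and "bicomplete TYPE('i) A"
    and "closed_symmetric_monoidal_category A"
    and "symmetric_operad A P"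
    and "reduced_operad A P"
  shows "(\<exists>Fo Fa.
            category_iso (cat1_algebras A P) (internal_categories (algebras A P)) Fo Fa \<and>
            (\<forall>G \<in> Obj (cat1_algebras A P). fst (Fo G) = G) \<and>
            (\<forall>\<phi> \<in> Arr (cat1_algebras A P). underlying_graph_arr (Fa \<phi>) = \<phi>)) \<and>
         (\<forall>G. is_reflexive_graph (algebras A P) G \<longrightarrow>
            ((\<exists>c. is_internal_category (algebras A P) G c) \<longleftrightarrow> cat1_condition A P G))"
proof -
  interpret abelian_category A
    by (rule assms(2))
  have coprod: "\<exists>x \<iota>. is_coproduct A a x \<iota>" if "\<And>n. a n \<in> Obj A" for a
    by (rule bicomplete_sequential_coproduct[OF assms(1) category_axioms assms(3) that])
  interpret operadic_category A P
    unfolding operadic_category_def operadic_category_axioms_def abelian_closed_monoidal_category_def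
    using assms(2,4,5) coprod by blast
  interpret Alg: category "algebras A P"
    by (rule category_algebras)
  have graph: "algebra_graph A P G" if "is_reflexive_graph (algebras A P) G" for G
    by unfold_locales (rule that)
  have iff: "(\<exists>c. is_internal_category (algebras A P) G c) \<longleftrightarrow> cat1_condition A P G"
    if "is_reflexive_graph (algebras A P) G" for G
    by (rule algebra_graph.internal_category_exists_iff[OF graph[OF that]])
  have unique: "c = d" if "is_internal_category (algebras A P) G c" "is_internal_category (algebras A P) G d" for G c d
    by (rule algebra_graph.internal_category_unique[OF graph[OF is_internal_category_graph[OF that(1)]] that])
  have "\<exists>Fo Fa. category_iso (cat1_algebras A P) (internal_categories (algebras A P)) Fo Fa \<and>
      (\<forall>G \<in> Obj (cat1_algebras A P). fst (Fo G) = G) \<and>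
      (\<forall>\<phi> \<in> Arr (cat1_algebras A P). underlying_graph_arr (Fa \<phi>) = \<phi>)"
    by (rule Alg.internal_categories_iso[OF unique graph_arr_is_internal_functor iff[symmetric] cat1_algebras_def])
  then show ?thesis
    using iff by blast
qed

end
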